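(* Let $G$ be a finite group and $n\ge 1$. The following three definitions of the $n$-th Hecke operator (all spelled out in the context) lead to exactly the same formula for functions $f(g,h;\tau)$, where $(g,h)$ is a commuting pair in $G$ and $\tau$ lies in the upper half plane: (1) the geometric definition using isogenies, when $f$ is an element of (twisted) Ginzburg–Kapranov–Vasserot equivariant elliptic cohomology of the point, i.e. a section of $\mathcal L^\alpha$; (2) the combinatorial definition using equivariant power operations, when $f$ is an element of Devoto's equivariant Tate $K$-theory of the point on which $P_n$ is defined; (3) for $g=1$, the definition of the twisted Hecke operator $\widehat T_n$ acting on (replicable) McKay–Thompson series. The formula is $$T_n(f)(g,h;\tau)=\frac1n\sum_{\substack{ad=n\\ 0\le b<d}} f\left(g^d,\,g^{-b}h^a;\,\frac{a\tau+b}{d}\right).$$ (In case (1) with $\alpha\ne 0$, the summand $f(g^d,g^{-b}h^a;\frac{a\tau+b}{d})\in L^\alpha_{g^d,g^{-b}h^a}$ is regarded as an element of $(L^\alpha_{g,h})^{\otimes n}$ via the isometry $(\phi_{a,b,d})_*$ defined in the context; in case (3) one sets $g=1$.)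
   Context: **Geometric definition (1).** Fix a CW structure on $BG$ (lifted to $EG$) and a cocycle $\alpha\in Z^3(BG;\mathbb R/\mathbb Z)$ that is normalized, i.e. restricts to $0$ on the 2-skeleton $BG^{(2)}$. For a principal $G$-bundle $P$ over an oriented torus $\Sigma$, let $\mathcal C_P$ be the groupoid whose objects are cellular classifying maps ($G$-maps) $f:P\to EG$ and whose morphisms $f\to f'$ are homotopy classes rel boundary of cellular $G$-homotopies $h:[0,1]\times P\to EG$ from $f$ to $f'$. Let $\mathcal F_P$ be the functor from $\mathcal C_P$ to metrized complex lines with $\mathcal F_P(f)=\mathbb C$ and $\mathcal F_P(h)$ = multiplication by $e^{2\pi i(\bar h^*\alpha)(x)}$, where $\bar h=h/G:[0,1]\times\Sigma\to BG$ and $x$ represents the (relative) fundamental class of $[0,1]\times \Sigma$. This functor has no holonomy, and the metrized line $L^\alpha_P$ is the space of invariant sections of $\mathcal F_P$, i.e. families $(s(f))_f$, $s(f)\in\mathbb C$, with $\mathcal F_P(h)s(f)=s(f')$ for every $h:f\to f'$. A bundle isomorphism $\psi:P'\to P$ covering an orientation-preserving diffeomorphism induces $\psi_*:L^\alpha_{P'}\to L^\alpha_P$, $(\psi_*s)(f)=s(f\circ\psi)$. If $\phi:E'\to E$ is an isogeny of degree $n$ and $P$ is a $G$-bundle over $E$, then, writing $\tilde\phi:\phi^*P\to P$ for the induced map, $\phi_*:L^\alpha_{\phi^*P}\to (L^\alpha_P)^{\otimes n}$ is the isometry $(\phi_*s)(f)=s(f\circ\tilde\phi)\in\mathbb C=\mathbb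 C^{\otimes n}$. An element of $\mathrm{Ell}^\alpha_G(\mathrm{pt})$, i.e. a section $f$ of $\mathcal L^\alpha$ over the moduli stack of principal $G$-bundles over complex elliptic curves, assigns to each principal $G$-bundle $P$ over an elliptic curve $E$ an element of $L^\alpha_P$, compatibly with all isomorphisms, varying holomorphically in $E$. Identify $\mathbb Z^2$ with $\langle\tau,1\rangle$ by $(1,0)\mapsto -1$, $(0,1)\mapsto\tau$; then $f(g,h;\tau)\in L^\alpha_{g,h}$ is the value of $f$ at the bundle $P_{g,h}$ over $\mathbb C/\langle\tau,1\rangle$ classified by the homomorphism $\mathbb Z^2\to G$, $(1,0)\mapsto g$, $(0,1)\mapsto h$; here $L^\alpha_{g,h}=L^\alpha_{P_{g,h}}$. The Hecke operator is $T_n=t_!\circ s^*$, where $s$ and $t$ are the maps on the stack of triples (degree $n$ covering $\phi:E'\to E$ with connected total space, $G$-bundle $P\to E$) returning $\phi^*P\to E'$ and $P\to E$ respectively, and $t_!$ is integration along the fibre with the weights $1/|\mathrm{Aut}|$. Explicitly $$T_n(f)(P\to E)=\sum_{[\sigma,\rho]}\frac{1}{|C_{\Sigma_n}(\sigma,\rho)|}\,\phi_*\,f(\phi^*P\to E')\in (L_P^\alpha)^{\otimes n},$$ where $[\sigma,\rho]$ runs over the simultaneous conjugacy classes of commuting pairs in the symmetric group $\Sigma_n$ generating a transitive subgroup, $C_{\Sigma_n}(\sigma,\rho)$ is the common centralizer, and $\phi:E'\to E$ is the connected $n$-fold covering with monodromy $(\sigma,\rho)$, made an isogeny of elliptic curves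 by choosing a basepoint over $0$. The isogeny $\phi_{a,b,d}:\mathbb C/\langle\tau',1\rangle\to\mathbb C/\langle\tau,1\rangle$, with $\tau'=(a\tau+b)/d$, sends $\tau'\mapsto a\tau+b$ and $1\mapsto d$. **Combinatorial definition (2).** Devoto's equivariant Tate $K$-theory of the point, with $q$ inverted, is $\bigoplus_{[g]}R(C_g)((q^{1/|g|}))$, the sum over conjugacy classes of $G$, $C_g$ the centralizer of $g$, $R$ the representation ring. For an element $f$ with components $f_g$, $f(g,h;\tau)$ denotes the value at $h\in C_g$ of the character $f_g$, with $q^{1/|g|}=e^{2\pi i\tau/|g|}$ (expansions may be taken formally). The power operation $P_n$ is defined on the subring of those $f$ such that, for all $g$ and $j$, the coefficient of $q^{j/|g|}$ in $f_g$ is a $\mathbb Z$-combination of representations of $C_g$ on which $g$ acts as $e^{2\pi i j/|g|}$. Pulled back to $G\times\Sigma_n$, the component of $P_n(f)$ at $(g,\sigma)$, where $\sigma$ has $N_k$ cycles of length $k$, is $$\bigotimes_k\bigl(f_{g^k}(q^{1/k})\bigr)^{\otimes N_k}$$ as a representation of $C_{G\times\Sigma_n}(g,\sigma)=C_g\times\prod_k\bigl((\mathbb Z/k)\wr\Sigma_{N_k}\bigr)$: $C_g\subseteq C_{g^k}$ acts diagonally; $\Sigma_{N_k}$ permutes the tensor factors; and the generator of a copy of $\mathbb Z/k$ (one $k$-cycle of $\sigma$) acts on the corresponding tensor factor, on the coefficient of $q^{j/(k|g^k|)}$, as $e^{2\pi i j/(k|g^k|)}\,g^{-1}$. (For virtual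 representations one uses Atiyah's extension of the tensor power to virtual representations via graded tensor powers.) $P_n(f)(\sigma,\rho)(g,h;\tau)$ is the trace of $(h,\rho)\in C_{G\times\Sigma_n}(g,\sigma)$ on this component, with $q=e^{2\pi i\tau}$. The Hecke operator is $$T_n(f)=\frac1n\sum_{[\sigma,\rho]\ \text{transitive}}P_n(f)(\sigma,\rho),$$ the sum over simultaneous conjugacy classes of commuting pairs in $\Sigma_n$ such that $\langle\sigma,\rho\rangle$ acts transitively on $\{1,\dots,n\}$. **Twisted Hecke operators (3).** A McKay–Thompson series is a series $f=q^{-1}+a_1q+a_2q^2+\dots$ with coefficients in $R(G)$ (for Moonshine, $G$ is the Monster); $f(1,h;\tau)$ is the function obtained by evaluating all characters at $h$, $q=e^{2\pi i\tau}$. For a Laurent series $f=q^{-1}+a_1q+\cdots$ the $n$-th Faber polynomial $\Phi_n$ is the unique polynomial of degree $n$ such that $\Phi_n(f)=q^{-n}+b_1q+b_2q^2+\cdots$. The McKay–Thompson series $f$ is replicable if for all $n$ $$\Phi_n(f)=\sum_{ad=n,\,0\le b<d}f^{(a)}\left(\frac{a\tau+b}{d}\right),$$ where $f^{(a)}$ is the $a$-th Adams operation applied to the coefficients of $f$ (whose character at $h$ is the original character at $h^a$). The twisted Hecke operator is $\widehat T_n(f)=\frac1n\Phi_n(f)$. *)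

theory Defs
  imports
    "HOL-Algebra.Sym_Groups"
    "HOL-Homology.Homology"
    "HOL-Complex_Analysis.Complex_Analysis"
    "HOL-Combinatorics.Combinatorics"
    "HOL-Computational_Algebra.Formal_Laurent_Series"
    "Jordan_Normal_Form.Matrix"
begin

section \<open>Commuting pairs and the index set of the Hecke sum\<close>

definition commuting_pairs :: "'g monoid \<Rightarrow> ('g \<times> 'g) set" where
  "commuting_pairs G = {(g, h). g \<in> carrier G \<and> h \<in> carrier G \<and> g \<otimes>\<^bsub>G\<^esub> h = h \<otimes>\<^bsub>G\<^esub> g}"

definition hecke_index :: "nat \<Rightarrow> (nat \<times> nat \<times> nat) set" where
  "hecke_index n = {(a, b, d). a * d = n \<and> b < d}"

definition transitive_pairs :: "nat \<Rightarrow> ((nat \<Rightarrow> nat) \<times> (nat \<Rightarrow> nat)) set" where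
  "transitive_pairs n = {(\<sigma>, \<rho>). (\<sigma>, \<rho>) \<in> commuting_pairs (sym_group n) \<and>
     (\<forall>i\<in>{1..n}. \<forall>j\<in>{1..n}. \<exists>\<pi>\<in>generate (sym_group n) {\<sigma>, \<rho>}. \<pi> i = j)}"

definition conj_class :: "nat \<Rightarrow> (nat \<Rightarrow> nat) \<times> (nat \<Rightarrow> nat) \<Rightarrow> ((nat \<Rightarrow> nat) \<times> (nat \<Rightarrow> nat)) set" where
  "conj_class n = (\<lambda>(\<sigma>, \<rho>). (\<lambda>\<pi>.
     (\<pi> \<otimes>\<^bsub>sym_group n\<^esub> \<sigma> \<otimes>\<^bsub>sym_group n\<^esub> inv\<^bsub>sym_group n\<^esub> \<pi>,
      \<pi> \<otimes>\<^bsub>sym_group n\<^esub> \<rho> \<otimes>\<^bsub>sym_group n\<^esub> inv\<^bsub>sym_group n\<^esub> \<pi>)) ` carrier (sym_group n))"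

definition transitive_classes :: "nat \<Rightarrow> ((nat \<Rightarrow> nat) \<times> (nat \<Rightarrow> nat)) set set" where
  "transitive_classes n = conj_class n ` transitive_pairs n"

definition pair_centralizer :: "nat \<Rightarrow> (nat \<Rightarrow> nat) \<Rightarrow> (nat \<Rightarrow> nat) \<Rightarrow> (nat \<Rightarrow> nat) set" where
  "pair_centralizer n \<sigma> \<rho> = {\<pi> \<in> carrier (sym_group n).
     \<pi> \<otimes>\<^bsub>sym_group n\<^esub> \<sigma> = \<sigma> \<otimes>\<^bsub>sym_group n\<^esub> \<pi> \<and> \<pi> \<otimes>\<^bsub>sym_group n\<^esub> \<rho> = \<rho> \<otimes>\<^bsub>sym_group n\<^esub> \<pi>}"


section \<open>CW structures and the classifying space\<close>

definition disc :: "nat \<Rightarrow> (nat \<Rightarrow> real) set" where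
  "disc n = {x \<in> topspace (Euclidean_space n). (\<Sum>i<n. (x i)\<^sup>2) \<le> 1}"

definition open_disc :: "nat \<Rightarrow> (nat \<Rightarrow> real) set" where
  "open_disc n = {x \<in> topspace (Euclidean_space n). (\<Sum>i<n. (x i)\<^sup>2) < 1}"

text \<open>A CW structure is given by its characteristic maps: \<open>\<Phi> n\<close> is the set of characteristic maps
  of the \<open>n\<close>-cells.\<close>

definition cw_structure :: "'b topology \<Rightarrow> (nat \<Rightarrow> ((nat \<Rightarrow> real) \<Rightarrow> 'b) set) \<Rightarrow> bool" where
  "cw_structure X \<Phi> \<longleftrightarrow>
     Hausdorff_space X \<and>
     (\<forall>n. \<forall>\<phi>\<in>\<Phi> n. continuous_map (subtopology (Euclidean_space n) (disc n)) X \<phi> \<and>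
                    embedding_map (subtopology (Euclidean_space n) (open_disc n)) X \<phi>) \<and>
     topspace X = (\<Union>n. \<Union>\<phi>\<in>\<Phi> n. \<phi> ` open_disc n) \<and>
     (\<forall>m n. \<forall>\<phi>\<in>\<Phi> m. \<forall>\<theta>\<in>\<Phi> n. (m, \<phi>) \<noteq> (n, \<theta>) \<longrightarrow> \<phi> ` open_disc m \<inter> \<theta> ` open_disc n = {}) \<and>
     (\<forall>n. \<forall>\<phi>\<in>\<Phi> n. \<exists>F. finite F \<and> (\<forall>(m, \<theta>)\<in>F. m < n \<and> \<theta> \<in> \<Phi> m) \<and>
        \<phi> ` (disc n - open_disc n) \<subseteq> (\<Union>(m, \<theta>)\<in>F. \<theta> ` open_disc m)) \<and>
     (\<forall>C. C \<subseteq> topspace X \<longrightarrow>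
        (closedin X C \<longleftrightarrow>
         (\<forall>n. \<forall>\<phi>\<in>\<Phi> n. closedin (subtopology (Euclidean_space n) (disc n)) {x \<in> disc n. \<phi> x \<in> C})))"

definition skeleton :: "(nat \<Rightarrow> ((nat \<Rightarrow> real) \<Rightarrow> 'b) set) \<Rightarrow> nat \<Rightarrow> 'b set" where
  "skeleton \<Phi> k = (\<Union>n\<in>{..k}. \<Union>\<phi>\<in>\<Phi> n. \<phi> ` disc n)"

definition principal_bundle ::
    "'g monoid \<Rightarrow> 'p topology \<Rightarrow> 'b topology \<Rightarrow> ('p \<Rightarrow> 'b) \<Rightarrow> ('p \<Rightarrow> 'g \<Rightarrow> 'p) \<Rightarrow> bool" where
  "principal_bundle G X B p r \<longleftrightarrow>
     continuous_map X B p \<and>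
     (\<forall>\<gamma>\<in>carrier G. continuous_map X X (\<lambda>x. r x \<gamma>)) \<and>
     (\<forall>x\<in>topspace X. r x \<one>\<^bsub>G\<^esub> = x \<and>
        (\<forall>\<gamma>\<in>carrier G. p (r x \<gamma>) = p x \<and> (\<forall>\<delta>\<in>carrier G. r x (\<gamma> \<otimes>\<^bsub>G\<^esub> \<delta>) = r (r x \<gamma>) \<delta>))) \<and>
     (\<forall>b\<in>topspace B. \<exists>U k. openin B U \<and> b \<in> U \<and>
        homeomorphic_map (prod_topology (subtopology B U) (discrete_topology (carrier G)))
                         (subtopology X {x \<in> topspace X. p x \<in> U}) k \<and>
        (\<forall>u\<in>U. \<forall>\<gamma>\<in>carrier G. p (k (u, \<gamma>)) = u \<and>
           (\<forall>\<delta>\<in>carrier G. k (u, \<gamma> \<otimes>\<^bsub>G\<^esub> \<delta>) = r (k (u, \<gamma>)) \<delta>)))"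

record ('e, 'b, 'g) classifying_data =
  EG :: "'e topology"
  BG :: "'b topology"
  EG_proj :: "'e \<Rightarrow> 'b"
  EG_act :: "'e \<Rightarrow> 'g \<Rightarrow> 'e"
  BG_cells :: "nat \<Rightarrow> ((nat \<Rightarrow> real) \<Rightarrow> 'b) set"

definition classifying_space :: "'g monoid \<Rightarrow> ('e, 'b, 'g) classifying_data \<Rightarrow> bool" where
  "classifying_space G D \<longleftrightarrow>
     topspace (EG D) \<noteq> {} \<and> contractible_space (EG D) \<and>
     principal_bundle G (EG D) (BG D) (EG_proj D) (EG_act D) \<and>
     cw_structure (BG D) (BG_cells D)"

definition EG_cells :: "('e, 'b, 'g) classifying_data \<Rightarrow> nat \<Rightarrow> ((nat \<Rightarrow> real) \<Rightarrow> 'e) set" where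
  "EG_cells D n = {\<psi>. continuous_map (subtopology (Euclidean_space n) (disc n)) (EG D) \<psi> \<and>
     (\<exists>\<phi>\<in>BG_cells D n. \<forall>x\<in>disc n. EG_proj D (\<psi> x) = \<phi> x)}"

text \<open>An \<open>\<real>/\<int>\<close>-valued singular cochain is represented by a real-valued lift; only its values modulo
  \<open>\<int>\<close> are ever used, so ``is \<open>0\<close> in \<open>\<real>/\<int>\<close>'' becomes ``is an integer''.\<close>

definition cochain_eval :: "(((nat \<Rightarrow> real) \<Rightarrow> 'a) \<Rightarrow> real) \<Rightarrow> 'a chain \<Rightarrow> real" where
  "cochain_eval \<alpha> c = (\<Sum>s\<in>Poly_Mapping.keys c. of_int (Poly_Mapping.lookup c s) * \<alpha> s)"

definition normalized_cocycle ::
    "('e, 'b, 'g) classifying_data \<Rightarrow> (((nat \<Rightarrow> real) \<Rightarrow> 'b) \<Rightarrow> real) \<Rightarrow> bool" where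
  "normalized_cocycle D \<alpha> \<longleftrightarrow>
     (\<forall>s. singular_simplex 4 (BG D) s \<longrightarrow> cochain_eval \<alpha> (chain_boundary 4 (frag_of s)) \<in> \<int>) \<and>
     (\<forall>s. singular_simplex 3 (subtopology (BG D) (skeleton (BG_cells D) 2)) s \<longrightarrow> \<alpha> s \<in> \<int>)"


section \<open>Elliptic curves and principal bundles over them\<close>

definition lattice_span :: "complex \<Rightarrow> complex \<Rightarrow> complex set" where
  "lattice_span w1 w2 = {of_int j * w1 + of_int k * w2 | j k. True}"

text \<open>The sign of \<open>Im (cnj w1 * w2)\<close> is the orientation of the basis; it vanishes iff the two numbers
  are linearly dependent over the reals.\<close>

definition lattice_basis :: "complex set \<Rightarrow> complex \<Rightarrow> complex \<Rightarrow> bool" where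
  "lattice_basis \<Lambda> w1 w2 \<longleftrightarrow> Im (cnj w1 * w2) \<noteq> 0 \<and> \<Lambda> = lattice_span w1 w2"

definition torus_point :: "complex set \<Rightarrow> complex \<Rightarrow> complex set" where
  "torus_point \<Lambda> z = (\<lambda>w. z + w) ` \<Lambda>"

definition torus :: "complex set \<Rightarrow> complex set topology" where
  "torus \<Lambda> = topology (\<lambda>U. U \<subseteq> range (torus_point \<Lambda>) \<and> open {z. torus_point \<Lambda> z \<in> U})"

lemma istopology_torus:
  "istopology (\<lambda>U. U \<subseteq> range (torus_point \<Lambda>) \<and> open {z. torus_point \<Lambda> z \<in> U})"
proof -
  have I: "{z. torus_point \<Lambda> z \<in> S \<inter> T} = {z. torus_point \<Lambda> z \<in> S} \<inter> {z. torus_point \<Lambda> z \<in> T}" for S T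
    by auto
  have U: "{z. torus_point \<Lambda> z \<in> \<Union>K} = (\<Union>S\<in>K. {z. torus_point \<Lambda> z \<in> S})" for K
    by auto
  show ?thesis
    unfolding istopology_def I U by (auto intro!: open_Int open_UN)
qed

definition torus_mult :: "complex set \<Rightarrow> complex \<Rightarrow> complex set \<Rightarrow> complex set" where
  "torus_mult \<Lambda> m X = (\<Union>z\<in>X. torus_point \<Lambda> (m * z))"

record ('p, 'g) pbundle =
  base_lattice :: "complex set"
  total_space :: "'p topology"
  bundle_proj :: "'p \<Rightarrow> complex set"
  bundle_act :: "'p \<Rightarrow> 'g \<Rightarrow> 'p"

definition elliptic_bundle :: "'g monoid \<Rightarrow> ('p, 'g) pbundle \<Rightarrow> bool" where
  "elliptic_bundle G P \<longleftrightarrow> (\<exists>w1 w2. lattice_basis (base_lattice P) w1 w2) \<and>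
     principal_bundle G (total_space P) (torus (base_lattice P)) (bundle_proj P) (bundle_act P)"

text \<open>A bundle map covering the map \<open>z \<mapsto> m z\<close> of elliptic curves. Any such map identifies its source
  with the pullback of its target.\<close>

definition bundle_map ::
    "'g monoid \<Rightarrow> complex \<Rightarrow> ('p, 'g) pbundle \<Rightarrow> ('p, 'g) pbundle \<Rightarrow> ('p \<Rightarrow> 'p) \<Rightarrow> bool" where
  "bundle_map G m Q P \<psi> \<longleftrightarrow> (\<lambda>z. m * z) ` base_lattice Q \<subseteq> base_lattice P \<and>
     continuous_map (total_space Q) (total_space P) \<psi> \<and>
     (\<forall>x\<in>topspace (total_space Q). bundle_proj P (\<psi> x) = torus_mult (base_lattice P) m (bundle_proj Q x) \<and>
        (\<forall>\<gamma>\<in>carrier G. \<psi> (bundle_act Q x \<gamma>) = bundle_act P (\<psi> x) \<gamma>))"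

definition bundle_iso ::
    "'g monoid \<Rightarrow> complex \<Rightarrow> ('p, 'g) pbundle \<Rightarrow> ('p, 'g) pbundle \<Rightarrow> ('p \<Rightarrow> 'p) \<Rightarrow> bool" where
  "bundle_iso G u Q P \<psi> \<longleftrightarrow> u \<noteq> 0 \<and> (\<lambda>z. u * z) ` base_lattice Q = base_lattice P \<and>
     bundle_map G u Q P \<psi> \<and> homeomorphic_map (total_space Q) (total_space P) \<psi>"

text \<open>The bundle over \<open>\<complex>/\<langle>\<tau>,1\<rangle>\<close> classified by \<open>(1,0) \<mapsto> g\<close>, \<open>(0,1) \<mapsto> h\<close>, where \<open>(k,m)\<close> corresponds to
  the lattice point \<open>m\<tau> - k\<close>: the quotient of \<open>\<complex> \<times> G\<close> by
  \<open>(z + (m\<tau> - k), \<gamma>) \<sim> (z, g\<^sup>k h\<^sup>m \<gamma>)\<close>.\<close>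

definition twist_class :: "'g monoid \<Rightarrow> 'g \<Rightarrow> 'g \<Rightarrow> complex \<Rightarrow> complex \<times> 'g \<Rightarrow> (complex \<times> 'g) set" where
  "twist_class G g h \<tau> = (\<lambda>(z, \<gamma>).
     {(z - (of_int m * \<tau> - of_int k), g [^]\<^bsub>G\<^esub> k \<otimes>\<^bsub>G\<^esub> h [^]\<^bsub>G\<^esub> m \<otimes>\<^bsub>G\<^esub> \<gamma>) | (k::int) (m::int). True})"

definition twisted_bundle ::
    "'g monoid \<Rightarrow> 'g \<Rightarrow> 'g \<Rightarrow> complex \<Rightarrow> ((complex \<times> 'g) set, 'g) pbundle" where
  "twisted_bundle G g h \<tau> = \<lparr>
     base_lattice = lattice_span \<tau> 1,
     total_space = topology (\<lambda>U. U \<subseteq> twist_class G g h \<tau> ` (UNIV \<times> carrier G) \<and>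
                           (\<forall>\<gamma>\<in>carrier G. open {z. twist_class G g h \<tau> (z, \<gamma>) \<in> U})),
     bundle_proj = (\<lambda>X. fst ` X),
     bundle_act = (\<lambda>X \<delta>. (\<lambda>(z, \<gamma>). (z, \<gamma> \<otimes>\<^bsub>G\<^esub> \<delta>)) ` X)\<rparr>"

lemma istopology_twisted:
  "istopology (\<lambda>U. U \<subseteq> twist_class G g h \<tau> ` (UNIV \<times> carrier G) \<and>
                   (\<forall>\<gamma>\<in>carrier G. open {z. twist_class G g h \<tau> (z, \<gamma>) \<in> U}))"
proof -
  have I: "{z. twist_class G g h \<tau> (z, \<gamma>) \<in> S \<inter> T} =
      {z. twist_class G g h \<tau> (z, \<gamma>) \<in> S} \<inter> {z. twist_class G g h \<tau> (z, \<gamma>) \<in> T}" for S T \<gamma>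
    by auto
  have U: "{z. twist_class G g h \<tau> (z, \<gamma>) \<in> \<Union>K} = (\<Union>S\<in>K. {z. twist_class G g h \<tau> (z, \<gamma>) \<in> S})" for K \<gamma>
    by auto
  show ?thesis
    unfolding istopology_def I U by (auto intro!: open_Int open_UN)
qed

text \<open>The map \<open>[z,\<gamma>] \<mapsto> [m z,\<gamma>]\<close> into the twisted bundle of \<open>(g,h;\<tau>)\<close>. For \<open>m = d\<close> and source the
  twisted bundle of \<open>(g\<^sup>d, g\<^sup>-\<^sup>b h\<^sup>a; (a\<tau>+b)/d)\<close> it covers the isogeny \<open>\<phi>\<^sub>a\<^sub>,\<^sub>b\<^sub>,\<^sub>d\<close> and
  preserves the base point \<open>[0,1]\<close>.\<close>

definition twisted_mult ::
    "'g monoid \<Rightarrow> 'g \<Rightarrow> 'g \<Rightarrow> complex \<Rightarrow> complex \<Rightarrow> (complex \<times> 'g) set \<Rightarrow> (complex \<times> 'g) set" where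
  "twisted_mult G g h \<tau> m X = (\<Union>(z, \<gamma>)\<in>X. twist_class G g h \<tau> (m * z, \<gamma>))"

text \<open>The isomorphism from the twisted bundle of \<open>(g,h;\<tau>)\<close> to that of \<open>(g,h;\<i>)\<close> covering the real-linear
  diffeomorphism with \<open>1 \<mapsto> 1\<close>, \<open>\<tau> \<mapsto> \<i>\<close>.\<close>

definition twisted_straighten :: "complex \<Rightarrow> (complex \<times> 'g) set \<Rightarrow> (complex \<times> 'g) set" where
  "twisted_straighten \<tau> X =
     (\<lambda>(z, \<gamma>). (Complex (Re z - Re \<tau> * Im z / Im \<tau>) (Im z / Im \<tau>), \<gamma>)) ` X"


section \<open>The line of a bundle\<close>

text \<open>No CW structure on the torus is part of the data, and precomposition with arbitrary
  diffeomorphisms and isogenies has to preserve cellularity. A map from the two-dimensional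
  torus, resp. a homotopy on its three-dimensional cylinder, is therefore called cellular if it takes values
  in the 2-skeleton, resp. in the 3-skeleton. Classifying maps are normalised to be \<open>undefined\<close> outside
  the total space.\<close>

definition classifying_maps ::
    "'g monoid \<Rightarrow> ('e, 'b, 'g) classifying_data \<Rightarrow> ('p, 'g) pbundle \<Rightarrow> ('p \<Rightarrow> 'e) set" where
  "classifying_maps G D P = {c \<in> extensional (topspace (total_space P)).
     continuous_map (total_space P) (EG D) c \<and>
     (\<forall>x\<in>topspace (total_space P). \<forall>\<gamma>\<in>carrier G. c (bundle_act P x \<gamma>) = EG_act D (c x) \<gamma>) \<and>
     c ` topspace (total_space P) \<subseteq> skeleton (EG_cells D) 2}"

definition cellular_homotopy ::
    "'g monoid \<Rightarrow> ('e, 'b, 'g) classifying_data \<Rightarrow> ('p, 'g) pbundle \<Rightarrow> ('p \<Rightarrow> 'e) \<Rightarrow> ('p \<Rightarrow> 'e) \<Rightarrow>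
     (real \<times> 'p \<Rightarrow> 'e) \<Rightarrow> bool" where
  "cellular_homotopy G D P c c' k \<longleftrightarrow>
     continuous_map (prod_topology (top_of_set {0..1}) (total_space P)) (EG D) k \<and>
     (\<forall>x\<in>topspace (total_space P). k (0, x) = c x \<and> k (1, x) = c' x \<and>
        (\<forall>t\<in>{0..1}. \<forall>\<gamma>\<in>carrier G. k (t, bundle_act P x \<gamma>) = EG_act D (k (t, x)) \<gamma>)) \<and>
     k ` ({0..1} \<times> topspace (total_space P)) \<subseteq> skeleton (EG_cells D) 3"

definition quotient_homotopy ::
    "('e, 'b, 'g) classifying_data \<Rightarrow> ('p, 'g) pbundle \<Rightarrow> (real \<times> 'p \<Rightarrow> 'e) \<Rightarrow> real \<times> complex set \<Rightarrow> 'b" where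
  "quotient_homotopy D P k = (\<lambda>(t, y). EG_proj D (k (t, SOME x. x \<in> topspace (total_space P) \<and> bundle_proj P x = y)))"

text \<open>The fundamental class of \<open>[0,1] \<times> \<complex>/\<Lambda>\<close>: the unit cube mapped by
  \<open>(t,u,v) \<mapsto> (t, u w1 + v w2)\<close>, for an oriented basis of \<open>\<Lambda>\<close>, and cut into six simplices. The simplex of
  \<open>\<kappa>\<close> has as vertices the points of the edge path from \<open>(0,0,0)\<close> to \<open>(1,1,1)\<close> that moves
  in direction \<open>i\<close> in step \<open>\<kappa> i\<close>; the \<open>i\<close>-th cube coordinate of a point with
  barycentric coordinates \<open>s\<close> is the sum of the \<open>s j\<close> with \<open>j > \<kappa> i\<close>.\<close>

definition cube_simplex ::
    "complex set \<Rightarrow> complex \<Rightarrow> complex \<Rightarrow> (nat \<Rightarrow> nat) \<Rightarrow> (nat \<Rightarrow> real) \<Rightarrow> real \<times> complex set" where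
  "cube_simplex \<Lambda> w1 w2 \<kappa> = restrict (\<lambda>s.
     let x = (\<lambda>i. \<Sum>j\<in>{\<kappa> i<..3}. s j)
     in (x 0, torus_point \<Lambda> (of_real (x 1) * w1 + of_real (x 2) * w2))) (standard_simplex 3)"

definition cube_cycle :: "complex set \<Rightarrow> complex \<Rightarrow> complex \<Rightarrow> (real \<times> complex set) chain" where
  "cube_cycle \<Lambda> w1 w2 =
     (\<Sum>\<kappa>\<in>{\<kappa>. \<kappa> permutes {..<3}}. frag_cmul (sign \<kappa>) (frag_of (cube_simplex \<Lambda> w1 w2 \<kappa>)))"

definition fundamental_cycle :: "complex set \<Rightarrow> (real \<times> complex set) chain \<Rightarrow> bool" where
  "fundamental_cycle \<Lambda> x \<longleftrightarrow>
     (let X = prod_topology (top_of_set {0..1}) (torus \<Lambda>); S = {0, 1} \<times> topspace (torus \<Lambda>)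
      in singular_relcycle 3 X S x \<and>
         (\<exists>w1 w2. lattice_basis \<Lambda> w1 w2 \<and> Im (cnj w1 * w2) > 0 \<and>
                  homologous_rel 3 X S x (cube_cycle \<Lambda> w1 w2)))"

text \<open>The invariant sections. The factor \<open>e\<^sup>2\<^sup>\<pi>\<^sup>i\<^sup>\<alpha>\<close> depends only on the
  homotopy class of \<open>k\<close> and the homology class of \<open>x\<close>, so all representatives are allowed. A section is
  set to \<open>0\<close> off the set of classifying maps. Elements of tensor powers of the line are likewise
  complex-valued functions of the classifying map, as \<open>\<complex>\<^sup>\<otimes>\<^sup>n = \<complex>\<close>.\<close>

definition bundle_line ::
    "'g monoid \<Rightarrow> ('e, 'b, 'g) classifying_data \<Rightarrow> (((nat \<Rightarrow> real) \<Rightarrow> 'b) \<Rightarrow> real) \<Rightarrow> ('p, 'g) pbundle \<Rightarrow>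
     (('p \<Rightarrow> 'e) \<Rightarrow> complex) set" where
  "bundle_line G D \<alpha> P = {s.
     (\<forall>c. c \<notin> classifying_maps G D P \<longrightarrow> s c = 0) \<and>
     (\<forall>c\<in>classifying_maps G D P. \<forall>c'\<in>classifying_maps G D P. \<forall>k x.
        cellular_homotopy G D P c c' k \<and> fundamental_cycle (base_lattice P) x \<longrightarrow>
        exp (2 * of_real pi * \<i> * of_real (cochain_eval \<alpha> (chain_map 3 (quotient_homotopy D P k) x))) * s c
          = s c')}"

text \<open>For a bundle isomorphism this is the induced map of lines; for the canonical map out of a pullback
  along an isogeny \<open>\<phi>\<close> of degree \<open>n\<close> it is \<open>\<phi>\<^sub>*\<close>, with values in the \<open>n\<close>-th tensor power.\<close>

definition pushforward ::
    "'g monoid \<Rightarrow> ('e, 'b, 'g) classifying_data \<Rightarrow> ('p, 'g) pbundle \<Rightarrow> ('p, 'g) pbundle \<Rightarrow> ('p \<Rightarrow> 'p) \<Rightarrow>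
     (('p \<Rightarrow> 'e) \<Rightarrow> complex) \<Rightarrow> (('p \<Rightarrow> 'e) \<Rightarrow> complex)" where
  "pushforward G D Q P \<psi> s =
     (\<lambda>c. if c \<in> classifying_maps G D P then s (restrict (c \<circ> \<psi>) (topspace (total_space Q))) else 0)"

text \<open>Sections over the moduli stack. The total spaces are taken in a fixed type in which every bundle
  has a copy. Every bundle is isomorphic to a twisted bundle of some \<open>(g,h;\<tau>)\<close>, and
  for fixed \<open>(g,h)\<close> the lines over the upper half plane form the constant family given by
  \<^const>\<open>twisted_straighten\<close>, whence the form of the holomorphy condition.\<close>

definition elliptic_section ::
    "'g monoid \<Rightarrow> ('e, 'b, 'g) classifying_data \<Rightarrow> (((nat \<Rightarrow> real) \<Rightarrow> 'b) \<Rightarrow> real) \<Rightarrow>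
     (((complex \<times> 'g) set, 'g) pbundle \<Rightarrow> ((complex \<times> 'g) set \<Rightarrow> 'e) \<Rightarrow> complex) \<Rightarrow> bool" where
  "elliptic_section G D \<alpha> F \<longleftrightarrow>
     (\<forall>P. elliptic_bundle G P \<longrightarrow> F P \<in> bundle_line G D \<alpha> P) \<and>
     (\<forall>P Q u \<psi>. elliptic_bundle G P \<and> elliptic_bundle G Q \<and> bundle_iso G u Q P \<psi> \<longrightarrow>
        F P = pushforward G D Q P \<psi> (F Q)) \<and>
     (\<forall>(g, h)\<in>commuting_pairs G. \<forall>c\<in>classifying_maps G D (twisted_bundle G g h \<i>).
        (\<lambda>\<tau>. F (twisted_bundle G g h \<tau>)
               (restrict (c \<circ> twisted_straighten \<tau>) (topspace (total_space (twisted_bundle G g h \<tau>)))))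
        holomorphic_on {\<tau>. Im \<tau> > 0})"


section \<open>The geometric Hecke operator\<close>

definition covering_monodromy ::
    "nat \<Rightarrow> complex set \<Rightarrow> complex set \<Rightarrow> complex \<Rightarrow> complex \<Rightarrow> complex \<Rightarrow>
     (nat \<Rightarrow> nat) \<Rightarrow> (nat \<Rightarrow> nat) \<Rightarrow> bool" where
  "covering_monodromy n \<Lambda>' \<Lambda> m w1 w2 \<sigma> \<rho> \<longleftrightarrow>
     m \<noteq> 0 \<and> (\<lambda>z. m * z) ` \<Lambda>' \<subseteq> \<Lambda> \<and>
     (\<exists>l. bij_betw l {1..n} {y \<in> topspace (torus \<Lambda>'). torus_mult \<Lambda> m y = torus_point \<Lambda> 0} \<and>
        (\<forall>i\<in>{1..n}. \<forall>(w, \<pi>)\<in>{(w1, \<sigma>), (w2, \<rho>)}.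
           \<exists>p. pathin (torus \<Lambda>') p \<and> p 0 = l i \<and> p 1 = l (\<pi> i) \<and>
               (\<forall>t\<in>{0..1}. torus_mult \<Lambda> m (p t) = torus_point \<Lambda> (of_real t * w))))"

text \<open>\<open>Q\<close> is the pullback of \<open>P\<close>, with canonical map \<open>\<psi>\<close>, along the covering \<open>z \<mapsto> m z\<close> whose monodromy
  along \<open>w1\<close> and \<open>w2\<close> is \<open>(\<sigma>,\<rho>)\<close>.\<close>

definition covering_pullback ::
    "'g monoid \<Rightarrow> nat \<Rightarrow> complex \<Rightarrow> complex \<Rightarrow> ('p, 'g) pbundle \<Rightarrow> (nat \<Rightarrow> nat) \<Rightarrow> (nat \<Rightarrow> nat) \<Rightarrow>
     complex \<Rightarrow> ('p, 'g) pbundle \<Rightarrow> ('p \<Rightarrow> 'p) \<Rightarrow> bool" where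
  "covering_pullback G n w1 w2 P \<sigma> \<rho> m Q \<psi> \<longleftrightarrow>
     elliptic_bundle G Q \<and> covering_monodromy n (base_lattice Q) (base_lattice P) m w1 w2 \<sigma> \<rho> \<and> bundle_map G m Q P \<psi>"

text \<open>Here \<open>(w1,w2)\<close> is the basis of \<open>base_lattice P\<close> that corresponds to \<open>(1,0),(0,1)\<close>.\<close>

definition geometric_hecke ::
    "'g monoid \<Rightarrow> ('e, 'b, 'g) classifying_data \<Rightarrow> nat \<Rightarrow> complex \<Rightarrow> complex \<Rightarrow>
     (('p, 'g) pbundle \<Rightarrow> ('p \<Rightarrow> 'e) \<Rightarrow> complex) \<Rightarrow> ('p, 'g) pbundle \<Rightarrow> ('p \<Rightarrow> 'e) \<Rightarrow> complex" where
  "geometric_hecke G D n w1 w2 F P = (\<lambda>c. \<Sum>C\<in>transitive_classes n.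
     let (\<sigma>, \<rho>) = (SOME p. p \<in> C);
         (m, Q, \<psi>) = (SOME (m, Q, \<psi>). covering_pullback G n w1 w2 P \<sigma> \<rho> m Q \<psi>)
     in 1 / of_nat (card (pair_centralizer n \<sigma> \<rho>)) * pushforward G D Q P \<psi> (F Q) c)"


section \<open>Representation rings\<close>

type_synonym 'g rep = "'g \<Rightarrow> complex mat"

definition rep_dim :: "'g monoid \<Rightarrow> 'g rep \<Rightarrow> nat" where
  "rep_dim G V = dim_row (V \<one>\<^bsub>G\<^esub>)"

definition is_rep :: "'g monoid \<Rightarrow> 'g set \<Rightarrow> 'g rep \<Rightarrow> bool" where
  "is_rep G H V \<longleftrightarrow> V \<one>\<^bsub>G\<^esub> = 1\<^sub>m (rep_dim G V) \<and>
     (\<forall>x\<in>H. V x \<in> carrier_mat (rep_dim G V) (rep_dim G V) \<and> (\<forall>y\<in>H. V (x \<otimes>\<^bsub>G\<^esub> y) = V x * V y))"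

definition rep_iso :: "'g monoid \<Rightarrow> 'g set \<Rightarrow> 'g rep \<Rightarrow> 'g rep \<Rightarrow> bool" where
  "rep_iso G H V W \<longleftrightarrow> rep_dim G V = rep_dim G W \<and>
     (\<exists>S\<in>carrier_mat (rep_dim G V) (rep_dim G V). invertible_mat S \<and> (\<forall>x\<in>H. S * V x = W x * S))"

definition rep_sum :: "'g monoid \<Rightarrow> 'g rep \<Rightarrow> 'g rep \<Rightarrow> 'g rep" where
  "rep_sum G V W = (\<lambda>x. four_block_mat (V x) (0\<^sub>m (rep_dim G V) (rep_dim G W))
                                       (0\<^sub>m (rep_dim G W) (rep_dim G V)) (W x))"

definition rep_trace :: "complex mat \<Rightarrow> complex" where
  "rep_trace A = (\<Sum>i<dim_row A. index_mat A (i, i))"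

text \<open>The representation ring as Grothendieck group: the pair \<open>(V,W)\<close> stands for the virtual
  representation \<open>V - W\<close>.\<close>

definition virtual_reps :: "'g monoid \<Rightarrow> 'g set \<Rightarrow> ('g rep \<times> 'g rep) set" where
  "virtual_reps G H = {(V, W). is_rep G H V \<and> is_rep G H W}"

definition virtual_equiv :: "'g monoid \<Rightarrow> 'g set \<Rightarrow> (('g rep \<times> 'g rep) \<times> ('g rep \<times> 'g rep)) set" where
  "virtual_equiv G H = {((V, W), (V', W')).
     (V, W) \<in> virtual_reps G H \<and> (V', W') \<in> virtual_reps G H \<and>
     rep_iso G H (rep_sum G V W') (rep_sum G V' W)}"

definition rep_ring :: "'g monoid \<Rightarrow> 'g set \<Rightarrow> ('g rep \<times> 'g rep) set set" where
  "rep_ring G H = virtual_reps G H // virtual_equiv G H"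

definition virtual_char :: "('g rep \<times> 'g rep) set \<Rightarrow> 'g \<Rightarrow> complex" where
  "virtual_char \<xi> x = (let (V, W) = (SOME p. p \<in> \<xi>) in rep_trace (V x) - rep_trace (W x))"

definition zero_rep :: "'g rep" where
  "zero_rep = (\<lambda>_. 1\<^sub>m 0)"

definition trivial_rep :: "'g rep" where
  "trivial_rep = (\<lambda>_. 1\<^sub>m 1)"

definition virtual_class :: "'g monoid \<Rightarrow> 'g set \<Rightarrow> 'g rep \<Rightarrow> ('g rep \<times> 'g rep) set" where
  "virtual_class G H V = virtual_equiv G H `` {(V, zero_rep)}"


section \<open>Series in fractional powers of \<open>q\<close>\<close>

text \<open>A series is given by its coefficients, the argument being the rational exponent of \<open>q\<close>. The series
  \<open>q_series N s\<close> is \<open>\<Sum>\<^sub>j s j q\<^bsup>j/N\<^esup>\<close>.\<close>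

type_synonym qser = "rat \<Rightarrow> complex"

definition q_series :: "nat \<Rightarrow> (int \<Rightarrow> complex) \<Rightarrow> qser" where
  "q_series N s = (\<lambda>x. if x * of_nat N \<in> \<int> then s \<lfloor>x * of_nat N\<rfloor> else 0)"

definition q_power :: "rat \<Rightarrow> complex \<Rightarrow> complex" where
  "q_power x \<tau> = exp (2 * of_real pi * \<i> * of_rat x * \<tau>)"

definition q_convergent :: "qser \<Rightarrow> bool" where
  "q_convergent s \<longleftrightarrow> (\<forall>\<tau>. Im \<tau> > 0 \<longrightarrow> (\<lambda>x. s x * q_power x \<tau>) summable_on UNIV)"

definition q_eval :: "qser \<Rightarrow> complex \<Rightarrow> complex" where
  "q_eval s \<tau> = (\<Sum>\<^sub>\<infinity>x. s x * q_power x \<tau>)"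

text \<open>The formal version of \<open>\<tau> \<mapsto> (a\<tau>+b)/d\<close>: \<open>q\<^sup>y\<close> becomes \<open>e\<^bsup>2\<pi>iyb/d\<^esup> q\<^bsup>ya/d\<^esup>\<close>.\<close>

definition q_subst :: "nat \<Rightarrow> nat \<Rightarrow> nat \<Rightarrow> qser \<Rightarrow> qser" where
  "q_subst a b d s = (\<lambda>x. let y = x * of_nat d / of_nat a in s y * q_power y (of_nat b / of_nat d))"


section \<open>Devoto's Tate \<open>K\<close>-theory and the power operation\<close>

definition elem_centralizer :: "'g monoid \<Rightarrow> 'g \<Rightarrow> 'g set" where
  "elem_centralizer G g = {x \<in> carrier G. x \<otimes>\<^bsub>G\<^esub> g = g \<otimes>\<^bsub>G\<^esub> x}"

text \<open>\<open>f g j\<close> is the coefficient of \<open>q\<^bsup>j/|g|\<^esup>\<close> in \<open>f\<^sub>g\<close>. Instead of choosing a representative of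
  each conjugacy class, components are given for all \<open>g\<close> and required to correspond to each other under
  conjugation.\<close>

definition devoto_tate_K :: "'g monoid \<Rightarrow> ('g \<Rightarrow> int \<Rightarrow> ('g rep \<times> 'g rep) set) \<Rightarrow> bool" where
  "devoto_tate_K G f \<longleftrightarrow>
     (\<forall>g\<in>carrier G.
        (\<forall>j. f g j \<in> rep_ring G (elem_centralizer G g)) \<and>
        (\<exists>N. \<forall>j<N. f g j = virtual_class G (elem_centralizer G g) zero_rep) \<and>
        (\<forall>x\<in>carrier G. \<forall>j. \<forall>(V, W)\<in>f g j.
           (\<lambda>y. V (inv\<^bsub>G\<^esub> x \<otimes>\<^bsub>G\<^esub> y \<otimes>\<^bsub>G\<^esub> x), \<lambda>y. W (inv\<^bsub>G\<^esub> x \<otimes>\<^bsub>G\<^esub> y \<otimes>\<^bsub>G\<^esub> x))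
             \<in> f (x \<otimes>\<^bsub>G\<^esub> g \<otimes>\<^bsub>G\<^esub> inv\<^bsub>G\<^esub> x) j))"

definition tate_series :: "'g monoid \<Rightarrow> ('g \<Rightarrow> int \<Rightarrow> ('g rep \<times> 'g rep) set) \<Rightarrow> 'g \<Rightarrow> 'g \<Rightarrow> qser" where
  "tate_series G f g h = q_series (group.ord G g) (\<lambda>j. virtual_char (f g j) h)"

definition acts_as_scalar :: "'g monoid \<Rightarrow> 'g \<Rightarrow> complex \<Rightarrow> 'g rep \<Rightarrow> bool" where
  "acts_as_scalar G g z V \<longleftrightarrow> V g = z \<cdot>\<^sub>m 1\<^sub>m (rep_dim G V)"

definition rotation_scalar :: "'g monoid \<Rightarrow> 'g \<Rightarrow> int \<Rightarrow> complex" where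
  "rotation_scalar G g j = cis (2 * pi * of_int j / of_nat (group.ord G g))"

definition power_domain :: "'g monoid \<Rightarrow> ('g \<Rightarrow> int \<Rightarrow> ('g rep \<times> 'g rep) set) \<Rightarrow> bool" where
  "power_domain G f \<longleftrightarrow> (\<forall>g\<in>carrier G. \<forall>j. \<exists>(V, W)\<in>f g j.
     acts_as_scalar G g (rotation_scalar G g j) V \<and> acts_as_scalar G g (rotation_scalar G g j) W)"

text \<open>Virtual coefficients are represented by \<open>\<int>/2\<close>-graded representations (even part first), and tensor
  powers are graded tensor powers. A graded model is a choice of such representatives that
  is bounded below in \<open>j\<close>, so that the coefficients of the tensor product are finite-dimensional.\<close>

definition graded_model ::
    "'g monoid \<Rightarrow> ('g \<Rightarrow> int \<Rightarrow> ('g rep \<times> 'g rep) set) \<Rightarrow> ('g \<Rightarrow> int \<Rightarrow> 'g rep \<times> 'g rep) \<Rightarrow> bool" where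
  "graded_model G f R \<longleftrightarrow> (\<forall>g\<in>carrier G.
     (\<forall>j. R g j \<in> f g j \<and>
        acts_as_scalar G g (rotation_scalar G g j) (fst (R g j)) \<and>
        acts_as_scalar G g (rotation_scalar G g j) (snd (R g j))) \<and>
     (\<exists>N. \<forall>j<N. rep_dim G (fst (R g j)) = 0 \<and> rep_dim G (snd (R g j)) = 0))"

definition graded_part :: "bool \<Rightarrow> 'g rep \<times> 'g rep \<Rightarrow> 'g rep" where
  "graded_part \<epsilon> VW = (if \<epsilon> then snd VW else fst VW)"

definition cycles :: "nat \<Rightarrow> (nat \<Rightarrow> nat) \<Rightarrow> nat set set" where
  "cycles n \<sigma> = orbit \<sigma> ` {1..n}"

text \<open>The decomposition of the centralizer of \<open>\<sigma>\<close> into wreath products is fixed by taking the least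
  element of each cycle as its base point. The permutation \<open>\<rho>\<close> maps a cycle \<open>c\<close> to the cycle \<open>\<rho> ` c\<close>, preserving
  base points up to \<open>rotation \<sigma> \<rho> c\<close> further steps of \<open>\<sigma>\<close>.\<close>

definition rotation :: "(nat \<Rightarrow> nat) \<Rightarrow> (nat \<Rightarrow> nat) \<Rightarrow> nat set \<Rightarrow> nat" where
  "rotation \<sigma> \<rho> c = (LEAST r. \<rho> (Min c) = (\<sigma> ^^ r) (Min (\<rho> ` c)))"

text \<open>A basis vector of the tensor factor of a \<open>k\<close>-cycle is a triple \<open>(j, \<epsilon>, i)\<close>: the \<open>i\<close>-th basis vector of
  the even or odd part of the coefficient of \<open>q\<^bsup>j/(k|g\<^sup>k|)\<^esup>\<close> in \<open>f\<^bsub>g\<^sup>k\<^esub>(q\<^bsup>1/k\<^esup>)\<close>. A basis vector of the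
  tensor product assigns one to each cycle.\<close>

type_synonym tensor_index = "nat set \<Rightarrow> int \<times> bool \<times> nat"

definition tensor_basis ::
    "'g monoid \<Rightarrow> nat \<Rightarrow> ('g \<Rightarrow> int \<Rightarrow> 'g rep \<times> 'g rep) \<Rightarrow> 'g \<Rightarrow> (nat \<Rightarrow> nat) \<Rightarrow> tensor_index set" where
  "tensor_basis G n R g \<sigma> = (PiE (cycles n \<sigma>) (\<lambda>c.
     {(j, \<epsilon>, i). i < rep_dim G (graded_part \<epsilon> (R (g [^]\<^bsub>G\<^esub> card c) j))}))"

definition tensor_exponent :: "'g monoid \<Rightarrow> nat \<Rightarrow> 'g \<Rightarrow> (nat \<Rightarrow> nat) \<Rightarrow> tensor_index \<Rightarrow> rat" where
  "tensor_exponent G n g \<sigma> v = (\<Sum>c\<in>cycles n \<sigma>.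
     of_int (fst (v c)) / of_nat (card c * group.ord G (g [^]\<^bsub>G\<^esub> card c)))"

definition odd_cycles :: "nat \<Rightarrow> (nat \<Rightarrow> nat) \<Rightarrow> tensor_index \<Rightarrow> nat set set" where
  "odd_cycles n \<sigma> v = {c \<in> cycles n \<sigma>. fst (snd (v c))}"

text \<open>The sign rule: cycles are ordered by their base points, and each pair of odd factors whose order is
  reversed contributes \<open>-1\<close>.\<close>

definition koszul_sign :: "nat \<Rightarrow> (nat \<Rightarrow> nat) \<Rightarrow> (nat \<Rightarrow> nat) \<Rightarrow> tensor_index \<Rightarrow> complex" where
  "koszul_sign n \<sigma> \<rho> v = (-1) ^ card {(c, c'). c \<in> odd_cycles n \<sigma> v \<and> c' \<in> odd_cycles n \<sigma> v \<and>
     Min c < Min c' \<and> Min (\<rho> ` c') < Min (\<rho> ` c)}"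

text \<open>The action of \<open>(h,\<rho>)\<close> on the factor of the cycle \<open>c\<close>, with values in the factor of \<open>\<rho> ` c\<close>: the
  operator \<open>h\<close> composed with the \<open>rotation \<sigma> \<rho> c\<close>-th power of the generator \<open>e\<^bsup>2\<pi>ij/(k|g\<^sup>k|)\<^esup> g\<^sup>-\<^sup>1\<close> of \<open>\<int>/k\<close>.\<close>

definition factor_action ::
    "'g monoid \<Rightarrow> ('g \<Rightarrow> int \<Rightarrow> 'g rep \<times> 'g rep) \<Rightarrow> 'g \<Rightarrow> (nat \<Rightarrow> nat) \<Rightarrow> 'g \<Rightarrow> (nat \<Rightarrow> nat) \<Rightarrow>
     nat set \<Rightarrow> int \<Rightarrow> bool \<Rightarrow> complex mat" where
  "factor_action G R g \<sigma> h \<rho> c j \<epsilon> =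
     (let k = card c; r = rotation \<sigma> \<rho> c
      in cis (2 * pi * of_int j / of_nat (k * group.ord G (g [^]\<^bsub>G\<^esub> k))) ^ r \<cdot>\<^sub>m
         graded_part \<epsilon> (R (g [^]\<^bsub>G\<^esub> k) j) (h \<otimes>\<^bsub>G\<^esub> (inv\<^bsub>G\<^esub> g) [^]\<^bsub>G\<^esub> r))"

text \<open>The matrix of \<open>(h,\<rho>)\<close> on the component of the power operation at \<open>(g,\<sigma>)\<close>: row \<open>v'\<close>, column \<open>v\<close>.\<close>

definition power_matrix ::
    "'g monoid \<Rightarrow> nat \<Rightarrow> ('g \<Rightarrow> int \<Rightarrow> 'g rep \<times> 'g rep) \<Rightarrow> 'g \<Rightarrow> (nat \<Rightarrow> nat) \<Rightarrow> 'g \<Rightarrow> (nat \<Rightarrow> nat) \<Rightarrow>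
     tensor_index \<Rightarrow> tensor_index \<Rightarrow> complex" where
  "power_matrix G n R g \<sigma> h \<rho> v' v = koszul_sign n \<sigma> \<rho> v *
     (\<Prod>c\<in>cycles n \<sigma>. let (j, \<epsilon>, i) = v c; (j', \<epsilon>', i') = v' (\<rho> ` c)
        in if j' = j \<and> \<epsilon>' = \<epsilon> then index_mat (factor_action G R g \<sigma> h \<rho> c j \<epsilon>) (i', i) else 0)"

text \<open>\<open>P\<^sub>n(f)(\<sigma>,\<rho>)(g,h)\<close>: the trace on the even part minus the trace on the odd part.\<close>

definition power_operation ::
    "'g monoid \<Rightarrow> nat \<Rightarrow> ('g \<Rightarrow> int \<Rightarrow> ('g rep \<times> 'g rep) set) \<Rightarrow> (nat \<Rightarrow> nat) \<Rightarrow> (nat \<Rightarrow> nat) \<Rightarrow>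
     'g \<Rightarrow> 'g \<Rightarrow> qser" where
  "power_operation G n f \<sigma> \<rho> g h = (let R = (SOME R. graded_model G f R)
     in (\<lambda>x. \<Sum>v\<in>{v \<in> tensor_basis G n R g \<sigma>. tensor_exponent G n g \<sigma> v = x}.
          (-1) ^ card (odd_cycles n \<sigma> v) * power_matrix G n R g \<sigma> h \<rho> v v))"

definition devoto_hecke ::
    "'g monoid \<Rightarrow> nat \<Rightarrow> ('g \<Rightarrow> int \<Rightarrow> ('g rep \<times> 'g rep) set) \<Rightarrow> 'g \<Rightarrow> 'g \<Rightarrow> qser" where
  "devoto_hecke G n f g h = (\<lambda>x. 1 / of_nat n * (\<Sum>C\<in>transitive_classes n.
     let (\<sigma>, \<rho>) = (SOME p. p \<in> C) in power_operation G n f \<sigma> \<rho> g h x))"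


section \<open>McKay--Thompson series and twisted Hecke operators\<close>

text \<open>\<open>f i\<close> is the coefficient of \<open>q\<^sup>i\<close>.\<close>

definition mckay_thompson :: "'g monoid \<Rightarrow> (int \<Rightarrow> ('g rep \<times> 'g rep) set) \<Rightarrow> bool" where
  "mckay_thompson G f \<longleftrightarrow>
     f (-1) = virtual_class G (carrier G) trivial_rep \<and>
     (\<forall>i. i = 0 \<or> i < -1 \<longrightarrow> f i = virtual_class G (carrier G) zero_rep) \<and>
     (\<forall>i\<ge>1. f i \<in> rep_ring G (carrier G))"

definition mt_series :: "(int \<Rightarrow> ('g rep \<times> 'g rep) set) \<Rightarrow> 'g \<Rightarrow> qser" where
  "mt_series f h = q_series 1 (\<lambda>i. virtual_char (f i) h)"

definition mt_fls :: "(int \<Rightarrow> ('g rep \<times> 'g rep) set) \<Rightarrow> 'g \<Rightarrow> complex fls" where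
  "mt_fls f h = Abs_fls (\<lambda>i. virtual_char (f i) h)"

definition poly_fls :: "complex poly \<Rightarrow> complex fls \<Rightarrow> complex fls" where
  "poly_fls p F = poly (map_poly fls_const p) F"

definition faber :: "nat \<Rightarrow> complex fls \<Rightarrow> complex poly" where
  "faber n F = (THE p. degree p = n \<and>
     (\<forall>i\<le>0. fls_nth (poly_fls p F) i = (if i = - int n then 1 else 0)))"

definition adams_operation ::
    "'g monoid \<Rightarrow> nat \<Rightarrow> ('g rep \<times> 'g rep) set \<Rightarrow> ('g rep \<times> 'g rep) set \<Rightarrow> bool" where
  "adams_operation G a \<xi> \<xi>' \<longleftrightarrow> \<xi>' \<in> rep_ring G (carrier G) \<and>
     (\<forall>h\<in>carrier G. virtual_char \<xi>' h = virtual_char \<xi> (h [^]\<^bsub>G\<^esub> a))"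

text \<open>\<open>\<psi> a i\<close> is the \<open>a\<close>-th Adams operation of \<open>f i\<close>; it always exists and is determined by its character.
  The identity of series over \<open>R(G) \<otimes> \<complex>\<close> is expressed by evaluating at all \<open>h\<close>.\<close>

definition replicable :: "'g monoid \<Rightarrow> (int \<Rightarrow> ('g rep \<times> 'g rep) set) \<Rightarrow> bool" where
  "replicable G f \<longleftrightarrow> (\<exists>\<psi>.
     (\<forall>a\<ge>1. \<forall>i. adams_operation G a (f i) (\<psi> a i)) \<and>
     (\<forall>n\<ge>1. \<forall>h\<in>carrier G.
        q_series 1 (fls_nth (poly_fls (faber n (mt_fls f h)) (mt_fls f h))) =
        (\<lambda>x. \<Sum>(a, b, d)\<in>hecke_index n. q_subst a b d (mt_series (\<psi> a) h) x)))"

definition twisted_hecke :: "nat \<Rightarrow> (int \<Rightarrow> ('g rep \<times> 'g rep) set) \<Rightarrow> 'g \<Rightarrow> qser" where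
  "twisted_hecke n f h = (\<lambda>x.
     1 / of_nat n * q_series 1 (fls_nth (poly_fls (faber n (mt_fls f h)) (mt_fls f h))) x)"

end

theory Submission
  imports Defs
begin

text \<open>A transitive commuting pair of permutations is a transitive action of \<open>\<int>\<^sup>2\<close>, so it is determined up to
  conjugation by the stabilizer of a point, a sublattice of index \<open>n\<close>. Its Hermite normal form is a triple
  \<open>(a,b,d)\<close> with \<open>ad = n\<close> and \<open>0 \<le> b < d\<close>: \<open>\<sigma>\<close> has \<open>a\<close> cycles of length \<open>d\<close>, which \<open>\<rho>\<close> permutes cyclically,
  and \<open>\<rho>\<^sup>a = \<sigma>\<^sup>b\<close>. In the geometric case the corresponding covering of \<open>\<complex>/\<langle>\<tau>,1\<rangle>\<close> is the isogeny
  \<open>\<phi>\<^sub>a\<^sub>,\<^sub>b\<^sub>,\<^sub>d\<close>, every other model of the pullback is isomorphic to the twisted bundle over its source, and the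
  centralizer has order \<open>n\<close>. In the combinatorial case the trace of a cyclic permutation of \<open>a\<close> tensor
  factors is the trace of the product of the operators along the cycle, which is
  \<open>h\<^sup>a g\<^sup>-\<^sup>b\<close> times a root of unity.\<close>

section \<open>Transitive commuting pairs of permutations\<close>

text \<open>The operators involve arbitrary choices: a representative of each class, a model of each
  covering and of the pulled back bundle, graded representatives of the coefficients. Each summand
  has to be independent of them, and the lattice in \<open>pair_type\<close> is the invariant that
  shows it. The sign in g^(-b) comes from sending (1,0) to -1: in the basis (-1, \<tau>) the number
  a\<tau> + b has coordinates (-b, a). In the combinatorial case the rotations met along the
  \<rho>-cycle of tensor factors add up to b only modulo d. The excess disappears because on the
  domain of P_n the element g^d acts on the coefficient of q^(j/|g^d|) by e^(2 pi i j/|g^d|), so the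
  generator of Z/d really has order dividing d. For virtual coefficients two signs meet on the odd
  part, (-1)^a from the graded trace and (-1)^(a-1) from the sign rule; their product -1 is what a
  difference of characters requires. For g = 1 the replication identity divided by n is already the
  formula, since the a-th Adams operation evaluates characters at h^a.\<close>

text \<open>The stabilizer in \<open>\<int>\<^sup>2\<close> of a point under the action of \<open>(\<sigma>,\<rho>)\<close> is the lattice spanned by
  \<open>(d,0)\<close> and \<open>(-b,a)\<close>, that is, \<open>\<sigma>\<^sup>d = 1\<close> and \<open>\<rho>\<^sup>a = \<sigma>\<^sup>b\<close>.\<close>

definition hecke_lattice :: "nat \<Rightarrow> nat \<Rightarrow> nat \<Rightarrow> (int \<times> int) set" where
  "hecke_lattice a b d = {(v * int d - u * int b, u * int a) | u v. True}"

text \<open>Two words with natural exponents are compared, so no inverse permutation occurs, and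
  every element of Z^2 is still reached as a difference of exponents. Transitivity is implied by
  counting: the lattice has index ad = n.\<close>

definition pair_type :: "nat \<Rightarrow> nat \<Rightarrow> nat \<Rightarrow> nat \<Rightarrow> (nat \<Rightarrow> nat) \<Rightarrow> (nat \<Rightarrow> nat) \<Rightarrow> bool" where
  "pair_type n a b d \<sigma> \<rho> \<longleftrightarrow>
     \<sigma> permutes {1..n} \<and> \<rho> permutes {1..n} \<and> \<sigma> \<circ> \<rho> = \<rho> \<circ> \<sigma> \<and> (a, b, d) \<in> hecke_index n \<and>
     (\<forall>i\<in>{1..n}. \<forall>s t s' t'. (\<sigma> ^^ s) ((\<rho> ^^ t) i) = (\<sigma> ^^ s') ((\<rho> ^^ t') i) \<longleftrightarrow>
        (int s - int s', int t - int t') \<in> hecke_lattice a b d)"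

lemma pair_type_iff:
  assumes "pair_type n a b d \<sigma> \<rho>" "i \<in> {1..n}"
  shows "(\<sigma> ^^ s) ((\<rho> ^^ t) i) = (\<sigma> ^^ s') ((\<rho> ^^ t') i) \<longleftrightarrow>
    (int s - int s', int t - int t') \<in> hecke_lattice a b d"
  using assms unfolding pair_type_def by blast

section \<open>Sublattices of Z^2 in Hermite normal form\<close>

lemma hecke_index_pos:
  assumes "(a, b, d) \<in> hecke_index n" "n \<ge> 1"
  shows "a > 0" "d > 0" "b < d" "a * d = n"
  using assms by (auto simp: hecke_index_def intro!: Nat.gr0I)

lemma finite_hecke_index:
  assumes "n \<ge> 1" shows "finite (hecke_index n)"
proof (rule finite_subset)
  show "hecke_index n \<subseteq> {..n} \<times> {..n} \<times> {..n}"
  proof clarsimp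
    fix a b d assume "(a, b, d) \<in> hecke_index n"
    from hecke_index_pos[OF this assms] show "a \<le> n \<and> b \<le> n \<and> d \<le> n"
      by (metis dvd_imp_le dvd_triv_left dvd_triv_right less_imp_le nat_0_less_mult_iff order_trans)
  qed
qed auto

text \<open>A lattice point determines its multiple u of (-b, a) by u = y div a, because a > 0; what
  remains, x + b u, has to be a multiple of d.\<close>

lemma mem_hecke_lattice:
  assumes "a > 0"
  shows "(x, y) \<in> hecke_lattice a b d \<longleftrightarrow> int a dvd y \<and> int d dvd x + int b * (y div int a)"
proof
  assume "(x, y) \<in> hecke_lattice a b d"
  then obtain u v where "x = v * int d - u * int b" "y = u * int a"
    by (auto simp: hecke_lattice_def)
  with assms show "int a dvd y \<and> int d dvd x + int b * (y div int a)"
    by (auto simp: algebra_simps)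
next
  assume H: "int a dvd y \<and> int d dvd x + int b * (y div int a)"
  then obtain u where u: "y = int a * u" by (auto elim: dvdE)
  with H assms obtain v where v: "x + int b * u = int d * v" by (auto elim!: dvdE)
  have "x = v * int d - u * int b" "y = u * int a"
    using u v by (auto simp: algebra_simps)
  then show "(x, y) \<in> hecke_lattice a b d"
    by (auto simp: hecke_lattice_def)
qed

lemma hecke_lattice_diff:
  assumes "p \<in> hecke_lattice a b d" "q \<in> hecke_lattice a b d"
  shows "p - q \<in> hecke_lattice a b d"
proof -
  from assms obtain u v u' v' where "p = (v * int d - u * int b, u * int a)"
    "q = (v' * int d - u' * int b, u' * int a)"
    by (auto simp: hecke_lattice_def)
  then have "p - q = ((v - v') * int d - (u - u') * int b, (u - u') * int a)"
    by (auto simp: algebra_simps)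
  then show ?thesis unfolding hecke_lattice_def by blast
qed

lemma zero_in_hecke_lattice: "0 \<in> hecke_lattice a b d"
  unfolding hecke_lattice_def by (auto simp: zero_prod_def intro!: exI[of _ 0])

lemma hecke_lattice_add:
  assumes "p \<in> hecke_lattice a b d" "q \<in> hecke_lattice a b d"
  shows "p + q \<in> hecke_lattice a b d"
  using hecke_lattice_diff[OF assms(1) hecke_lattice_diff[OF zero_in_hecke_lattice assms(2)]] by simp

text \<open>Z^2 modulo the lattice has order ad, so ad annihilates it. This lets positive words
  stand in for inverses in \<open>transitive_imp_pair_type\<close>.\<close>

lemma mult_in_hecke_lattice:
  "(int (a * d) * x, int (a * d) * y) \<in> hecke_lattice a b d"
proof -
  have "(int (a * d) * x, int (a * d) * y)
      = ((int a * x + int b * y) * int d - (int d * y) * int b, (int d * y) * int a)"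
    by (simp add: algebra_simps)
  then show ?thesis unfolding hecke_lattice_def by blast
qed

text \<open>Uniqueness of the Hermite normal form: the lattice points on the first axis give d, then
  ad = n gives a, and the point (-b, a) gives b modulo d, which suffices as both candidates lie
  below d.\<close>

lemma hecke_lattice_eqD:
  assumes "(a, b, d) \<in> hecke_index n" "(a', b', d') \<in> hecke_index n" "n \<ge> 1"
    and "hecke_lattice a b d = hecke_lattice a' b' d'"
  shows "a = a'" "b = b'" "d = d'"
proof -
  note p = hecke_index_pos[OF assms(1,3)] and p' = hecke_index_pos[OF assms(2,3)]
  note mem = mem_hecke_lattice[OF p(1)] mem_hecke_lattice[OF p'(1)]
  have "(int x, 0) \<in> hecke_lattice a b d \<longleftrightarrow> d dvd x" "(int x, 0) \<in> hecke_lattice a' b' d' \<longleftrightarrow> d' dvd x" for x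
    by (auto simp: mem)
  then show d: "d = d'"
    using assms(4) by (metis dvd_antisym dvd_refl)
  with p p' show a: "a = a'" by (metis mult_right_cancel less_not_refl)
  have "(- int b, int a) \<in> hecke_lattice a b d"
    using p by (simp add: mem)
  then have "(- int b, int a') \<in> hecke_lattice a' b' d'"
    using assms(4) a by metis
  then have "int d dvd int b' - int b"
    unfolding mem using p' by (simp add: d)
  moreover have "\<bar>int b' - int b\<bar> < int d"
    using p p' d by auto
  ultimately show "b = b'"
    using zdvd_imp_le[of "int d" "\<bar>int b' - int b\<bar>"] by auto
qed

text \<open>For positive a and d this is the representative of a coset in the box 0 <= x < d, 0 <= y
  < a: subtracting y div a copies of (-b, a) adds b (y div a) to x, and then x is reduced modulo
  d.\<close>

definition hecke_reduce :: "nat \<Rightarrow> nat \<Rightarrow> nat \<Rightarrow> int \<times> int \<Rightarrow> int \<times> int" where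
  "hecke_reduce a b d = (\<lambda>(x, y). ((x + int b * (y div int a)) mod int d, y mod int a))"

lemma hecke_reduce_eq_iff:
  assumes "a > 0"
  shows "hecke_reduce a b d p = hecke_reduce a b d q \<longleftrightarrow> p - q \<in> hecke_lattice a b d"
proof -
  obtain x y x' y' where pq: "p = (x, y)" "q = (x', y')" by fastforce
  show ?thesis
  proof (cases "int a dvd y - y'")
    case True
    then obtain u where u: "y = y' + int a * u" by (metis add.commute diff_add_cancel dvdE)
    then have "y mod int a = y' mod int a" "y div int a = y' div int a + u" "(y - y') div int a = u"
      using assms by auto
    with True show ?thesis
      by (auto simp: pq hecke_reduce_def mem_hecke_lattice[OF assms] mod_eq_dvd_iff algebra_simps)
  next
    case False
    then show ?thesis
      by (auto simp: pq hecke_reduce_def mem_hecke_lattice[OF assms] mod_eq_dvd_iff)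
  qed
qed

lemma hecke_reduce_fixed:
  assumes "x < d" "y < a"
  shows "hecke_reduce a b d (int x, int y) = (int x, int y)"
  using assms by (simp add: hecke_reduce_def)

lemma hecke_reduce_nat:
  assumes "a > 0" "d > 0"
  obtains x y where "x < d" "y < a" "hecke_reduce a b d p = (int x, int y)"
proof -
  obtain u v where p: "p = (u, v)" by fastforce
  have "0 \<le> (u + int b * (v div int a)) mod int d" "(u + int b * (v div int a)) mod int d < int d"
    "0 \<le> v mod int a" "v mod int a < int a"
    using assms by auto
  then show ?thesis
    by (intro that[of "nat ((u + int b * (v div int a)) mod int d)" "nat (v mod int a)"])
       (auto simp: p hecke_reduce_def)
qed

lemma hecke_reduce_reduce:
  assumes "a > 0" "d > 0"
  shows "p - hecke_reduce a b d p \<in> hecke_lattice a b d"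
proof -
  obtain x y where xy: "x < d" "y < a" "hecke_reduce a b d p = (int x, int y)"
    by (rule hecke_reduce_nat[OF assms])
  then show ?thesis
    using hecke_reduce_eq_iff[OF assms(1), of b d p "hecke_reduce a b d p"] hecke_reduce_fixed[of x d y a b]
    by simp
qed

text \<open>Two parametrisations with the same fibres differ by a bijection of their images. It
  serves both to conjugate two pairs of the same type and to label the fibre of an isogeny by 1,
  ..., n.\<close>

lemma bij_betw_same_kernel:
  assumes "\<And>p q. p \<in> S \<Longrightarrow> q \<in> S \<Longrightarrow> f p = f q \<longleftrightarrow> f' p = f' q"
  obtains h where "bij_betw h (f ` S) (f' ` S)" "\<And>p. p \<in> S \<Longrightarrow> h (f p) = f' p"
proof -
  define h where "h = f' \<circ> inv_into S f"
  have h: "h (f p) = f' p" if "p \<in> S" for p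
    using that assms[of "inv_into S f (f p)" p] f_inv_into_f[of "f p" f S] inv_into_into[of "f p" f S]
    by (auto simp: h_def)
  have "bij_betw h (f ` S) (f' ` S)"
    unfolding bij_betw_def inj_on_def using h assms by (auto simp: image_iff)
  with h show ?thesis using that by blast
qed

section \<open>Words in a pair of commuting permutations\<close>

lemma funpow_commute_apply:
  fixes \<sigma> \<rho> :: "'a \<Rightarrow> 'a"
  assumes "\<sigma> \<circ> \<rho> = \<rho> \<circ> \<sigma>"
  shows "(\<sigma> ^^ s) ((\<rho> ^^ t) i) = (\<rho> ^^ t) ((\<sigma> ^^ s) i)"
proof -
  have 1: "\<sigma> ((\<rho> ^^ t) i) = (\<rho> ^^ t) (\<sigma> i)" for i
    using assms by (induction t) (auto simp: fun_eq_iff)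
  show ?thesis by (induction s) (auto simp: 1)
qed

lemma funpow_pair_add:
  fixes \<sigma> \<rho> :: "'a \<Rightarrow> 'a"
  assumes "\<sigma> \<circ> \<rho> = \<rho> \<circ> \<sigma>"
  shows "(\<sigma> ^^ s) ((\<rho> ^^ t) ((\<sigma> ^^ s') ((\<rho> ^^ t') i))) = (\<sigma> ^^ (s + s')) ((\<rho> ^^ (t + t')) i)"
  by (simp add: funpow_add funpow_commute_apply[OF assms])

lemma permutes_funpow_inj:
  assumes "\<sigma> permutes A"
  shows "(\<sigma> ^^ s) i = (\<sigma> ^^ s) j \<longleftrightarrow> i = j"
  using permutes_inj[OF assms] by (meson inj_eq inj_fn)

lemma permutes_funpow_in:
  assumes "\<sigma> permutes A"
  shows "(\<sigma> ^^ s) i \<in> A \<longleftrightarrow> i \<in> A"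
  by (induction s) (auto simp: permutes_in_image[OF assms])

lemma permutes_return:
  assumes "\<sigma> permutes A" "finite A"
  obtains s where "s > 0" "(\<sigma> ^^ s) i = i"
proof -
  have "i \<in> orbit \<sigma> i"
    using assms by (intro permutation_self_in_orbit) (auto simp: permutation_permutes)
  then show ?thesis using that by (auto simp: orbit_altdef)
qed

text \<open>A permutation of a finite set has finite order, so its inverse is a natural power of it.
  Together with commutativity this reduces every element of the generated group to a monomial with
  natural exponents.\<close>

lemma generate_pair_funpow:
  assumes s: "\<sigma> permutes {1..n}" and r: "\<rho> permutes {1..n}" and comm: "\<sigma> \<circ> \<rho> = \<rho> \<circ> \<sigma>"
  shows "generate (sym_group n) {\<sigma>, \<rho>} = {(\<sigma> ^^ x) \<circ> (\<rho> ^^ y) | x y. True}"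
proof -
  have inv_pow: "\<exists>k. inv' p = p ^^ k" if "p permutes {1..n}" for p :: "nat \<Rightarrow> nat"
  proof -
    have "permutation p" by (rule permutes_imp_permutation[OF _ that]) simp
    then obtain k where k: "p ^^ k = id" "k > 0" by (rule permutation_is_nilpotent)
    then obtain m where m: "k = Suc m" by (cases k) auto
    have "p \<circ> p ^^ m = id" "p ^^ m \<circ> p = id"
      using k(1) unfolding m by (simp, simp only: funpow_Suc_right)
    then have "inv' p = p ^^ m" by (rule inv_unique_comp)
    then show ?thesis ..
  qed
  have mem: "\<exists>x y. p = \<sigma> ^^ x \<circ> \<rho> ^^ y" if "p \<in> generate (sym_group n) {\<sigma>, \<rho>}" for p
    using that
  proof induction
    case one
    show ?case by (rule exI[of _ 0], rule exI[of _ 0]) (simp add: sym_group_one)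
  next
    case (incl h)
    then consider "h = \<sigma>" | "h = \<rho>" by blast
    then show ?case
    proof cases
      case 1
      then show ?thesis by (intro exI[of _ 1] exI[of _ 0]) simp
    next
      case 2
      then show ?thesis by (intro exI[of _ 0] exI[of _ 1]) simp
    qed
  next
    case (inv h)
    then have "h permutes {1..n}" using s r by auto
    then obtain k where k: "inv' h = h ^^ k" using inv_pow by blast
    have eq: "inv\<^bsub>sym_group n\<^esub> h = h ^^ k"
      using \<open>h permutes {1..n}\<close> k by (simp add: sym_group_carrier)
    from inv consider "h = \<sigma>" | "h = \<rho>" by blast
    then show ?case
    proof cases
      case 1
      then show ?thesis unfolding eq by (intro exI[of _ k] exI[of _ 0]) simp
    next
      case 2
      then show ?thesis unfolding eq by (intro exI[of _ 0] exI[of _ k]) simp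
    qed
  next
    case (eng h1 h2)
    then obtain x y x' y' where "h1 = \<sigma> ^^ x \<circ> \<rho> ^^ y" "h2 = \<sigma> ^^ x' \<circ> \<rho> ^^ y'" by blast
    then have "h1 \<circ> h2 = \<sigma> ^^ (x + x') \<circ> \<rho> ^^ (y + y')"
      by (simp add: fun_eq_iff funpow_pair_add[OF comm])
    then show ?case unfolding sym_group_mult by blast
  qed
  have pow: "p ^^ k \<in> generate (sym_group n) {\<sigma>, \<rho>}" if "p \<in> {\<sigma>, \<rho>}" for p k
  proof (induction k)
    case 0
    show ?case
      using generate.one[of "sym_group n" "{\<sigma>, \<rho>}"] by (simp only: sym_group_one funpow.simps)
  next
    case (Suc k)
    show ?case
      using generate.eng[OF generate.incl[OF that] Suc] by (simp only: sym_group_mult funpow.simps)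
  qed
  have "\<sigma> ^^ x \<circ> \<rho> ^^ y \<in> generate (sym_group n) {\<sigma>, \<rho>}" for x y
    using generate.eng[OF pow pow, of \<sigma> \<rho> x y] by (simp add: sym_group_mult)
  with mem show ?thesis by blast
qed

section \<open>Transitive pairs and their types\<close>

lemma transitive_pairs_iff:
  "(\<sigma>, \<rho>) \<in> transitive_pairs n \<longleftrightarrow>
     \<sigma> permutes {1..n} \<and> \<rho> permutes {1..n} \<and> \<sigma> \<circ> \<rho> = \<rho> \<circ> \<sigma> \<and>
     (\<forall>i\<in>{1..n}. \<forall>j\<in>{1..n}. \<exists>s t. (\<sigma> ^^ s) ((\<rho> ^^ t) i) = j)"
proof -
  have "(\<exists>\<pi>\<in>generate (sym_group n) {\<sigma>, \<rho>}. \<pi> i = j) \<longleftrightarrow> (\<exists>s t. (\<sigma> ^^ s) ((\<rho> ^^ t) i) = j)"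
    if "\<sigma> permutes {1..n}" "\<rho> permutes {1..n}" "\<sigma> \<circ> \<rho> = \<rho> \<circ> \<sigma>" for i j
    unfolding generate_pair_funpow[OF that] by (auto simp: Bex_def) (metis comp_apply)+
  then show ?thesis
    by (auto simp: transitive_pairs_def commuting_pairs_def sym_group_carrier sym_group_mult)
qed

text \<open>Distinct pairs in the box lie in distinct cosets of the lattice, hence give distinct
  points; since the box has da = n elements, all n points are reached. This is where transitivity
  comes from.\<close>

lemma pair_type_box:
  assumes "pair_type n a b d \<sigma> \<rho>" "n \<ge> 1" "i \<in> {1..n}"
  shows "bij_betw (\<lambda>(s, t). (\<sigma> ^^ s) ((\<rho> ^^ t) i)) ({..<d} \<times> {..<a}) {1..n}"
proof -
  have H: "(a, b, d) \<in> hecke_index n" "\<sigma> permutes {1..n}" "\<rho> permutes {1..n}"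
    using assms by (simp_all only: pair_type_def)
  note p = hecke_index_pos[OF H(1) assms(2)]
  have "inj_on (\<lambda>(s, t). (\<sigma> ^^ s) ((\<rho> ^^ t) i)) ({..<d} \<times> {..<a})"
  proof (rule inj_onI, clarsimp)
    fix s t s' t' assume b: "s < d" "t < a" "s' < d" "t' < a"
      and "(\<sigma> ^^ s) ((\<rho> ^^ t) i) = (\<sigma> ^^ s') ((\<rho> ^^ t') i)"
    then have "(int s, int t) - (int s', int t') \<in> hecke_lattice a b d"
      using pair_type_iff[OF assms(1,3)] by auto
    then show "s = s' \<and> t = t'"
      using b hecke_reduce_eq_iff[OF p(1), of b d "(int s, int t)" "(int s', int t')"]
      by (auto simp: hecke_reduce_fixed)
  qed
  moreover have "(\<lambda>(s, t). (\<sigma> ^^ s) ((\<rho> ^^ t) i)) ` ({..<d} \<times> {..<a}) = {1..n}"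
  proof (rule card_seteq)
    show "(\<lambda>(s, t). (\<sigma> ^^ s) ((\<rho> ^^ t) i)) ` ({..<d} \<times> {..<a}) \<subseteq> {1..n}"
      using permutes_funpow_in[OF H(2)] permutes_funpow_in[OF H(3)] assms(3) by fastforce
    show "card {1..n} \<le> card ((\<lambda>(s, t). (\<sigma> ^^ s) ((\<rho> ^^ t) i)) ` ({..<d} \<times> {..<a}))"
      using calculation p by (simp add: card_image card_cartesian_product mult.commute)
  qed simp
  ultimately show ?thesis by (auto simp: bij_betw_def)
qed

lemma pair_type_reach:
  assumes "pair_type n a b d \<sigma> \<rho>" "n \<ge> 1" "i \<in> {1..n}" "j \<in> {1..n}"
  obtains s t where "s < d" "t < a" "j = (\<sigma> ^^ s) ((\<rho> ^^ t) i)"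
proof -
  have "j \<in> (\<lambda>(s, t). (\<sigma> ^^ s) ((\<rho> ^^ t) i)) ` ({..<d} \<times> {..<a})"
    using bij_betw_imp_surj_on[OF pair_type_box[OF assms(1-3)]] assms(4) by simp
  then show ?thesis using that by auto
qed

lemma pair_type_orbit_image:
  assumes "pair_type n a b d \<sigma> \<rho>" "n \<ge> 1" "i \<in> {1..n}"
  shows "(\<lambda>(s, t). (\<sigma> ^^ s) ((\<rho> ^^ t) i)) ` UNIV = {1..n}"
proof -
  have p: "\<sigma> permutes {1..n}" "\<rho> permutes {1..n}" using assms by (simp_all only: pair_type_def)
  have "(\<sigma> ^^ s) ((\<rho> ^^ t) i) \<in> {1..n}" for s t
    by (simp only: permutes_funpow_in[OF p(1)] permutes_funpow_in[OF p(2)] assms(3))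
  then have "(\<lambda>(s, t). (\<sigma> ^^ s) ((\<rho> ^^ t) i)) ` UNIV \<subseteq> {1..n}"
    by (simp only: image_subset_iff split_paired_all case_prod_conv) simp
  moreover have "{1..n} \<subseteq> (\<lambda>(s, t). (\<sigma> ^^ s) ((\<rho> ^^ t) i)) ` UNIV"
    unfolding bij_betw_imp_surj_on[OF pair_type_box[OF assms], symmetric] by (rule image_mono) simp
  ultimately show ?thesis by (rule equalityI)
qed

lemma pair_type_imp_transitive:
  assumes "pair_type n a b d \<sigma> \<rho>" "n \<ge> 1"
  shows "(\<sigma>, \<rho>) \<in> transitive_pairs n"
proof -
  have "\<exists>s t. (\<sigma> ^^ s) ((\<rho> ^^ t) i) = j" if "i \<in> {1..n}" "j \<in> {1..n}" for i j
    by (rule pair_type_reach[OF assms that]) auto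
  then show ?thesis
    using assms unfolding transitive_pairs_iff pair_type_def by blast
qed

text \<open>The action on the single point 1 already determines the lattice, and the lattice
  determines the triple.\<close>

lemma pair_type_unique:
  assumes "pair_type n a b d \<sigma> \<rho>" "pair_type n a' b' d' \<sigma> \<rho>" "n \<ge> 1"
  shows "a = a'" "b = b'" "d = d'"
proof -
  have H: "(a, b, d) \<in> hecke_index n" "(a', b', d') \<in> hecke_index n"
    using assms by (simp_all only: pair_type_def)
  have one: "1 \<in> {1..n}" using assms(3) by simp
  have "(x, y) \<in> hecke_lattice a b d \<longleftrightarrow> (x, y) \<in> hecke_lattice a' b' d'" for x y
  proof -
    \<comment> \<open>One of the two parts is zero; an arbitrary integer vector thus becomes a
      difference of natural exponents, as \<open>pair_type\<close> requires.\<close>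
    have xy: "x = int (nat x) - int (nat (- x))" "y = int (nat y) - int (nat (- y))" by auto
    have iff: "(int s - int s', int t - int t') \<in> hecke_lattice a b d \<longleftrightarrow>
        (int s - int s', int t - int t') \<in> hecke_lattice a' b' d'" for s t s' t'
      using pair_type_iff[OF assms(1) one] pair_type_iff[OF assms(2) one] by blast
    show ?thesis
      using iff[of "nat x" "nat (- x)" "nat y" "nat (- y)"] xy by simp
  qed
  then have "hecke_lattice a b d = hecke_lattice a' b' d'" by auto
  from hecke_lattice_eqD[OF H assms(3) this] show "a = a'" "b = b'" "d = d'" .
qed

text \<open>The normal form is read off at the point 1: d is the length of its \<sigma>-cycle, a the
  first positive power of \<rho> that returns to this cycle, and b the place where it
  returns.\<close>

lemma transitive_imp_pair_type:
  assumes "(\<sigma>, \<rho>) \<in> transitive_pairs n" "n \<ge> 1"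
  obtains a b d where "pair_type n a b d \<sigma> \<rho>"
proof -
  define i0 :: nat where "i0 = 1"
  have s: "\<sigma> permutes {1..n}" and r: "\<rho> permutes {1..n}" and comm: "\<sigma> \<circ> \<rho> = \<rho> \<circ> \<sigma>"
    and trans: "\<And>i j. i \<in> {1..n} \<Longrightarrow> j \<in> {1..n} \<Longrightarrow> \<exists>s t. (\<sigma> ^^ s) ((\<rho> ^^ t) i) = j"
    using assms by (auto simp: transitive_pairs_iff)
  note comm' = funpow_commute_apply[OF comm]
  define d where "d = (LEAST d. d > 0 \<and> (\<sigma> ^^ d) i0 = i0)"
  define a where "a = (LEAST a. a > 0 \<and> (\<exists>x. (\<rho> ^^ a) i0 = (\<sigma> ^^ x) i0))"
  obtain k where "k > 0 \<and> (\<sigma> ^^ k) i0 = i0" using permutes_return[OF s] by blast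
  then have d: "d > 0 \<and> (\<sigma> ^^ d) i0 = i0" unfolding d_def by (rule LeastI)
  have d_min: "\<not> (x > 0 \<and> (\<sigma> ^^ x) i0 = i0)" if "x < d" for x
    using that unfolding d_def by (rule not_less_Least)
  obtain k where "k > 0" "(\<rho> ^^ k) i0 = i0" using permutes_return[OF r] by blast
  then have "k > 0 \<and> (\<exists>x. (\<rho> ^^ k) i0 = (\<sigma> ^^ x) i0)" by (auto intro: exI[of _ 0])
  then have a: "a > 0 \<and> (\<exists>x. (\<rho> ^^ a) i0 = (\<sigma> ^^ x) i0)" unfolding a_def by (rule LeastI)
  have a_min: "\<not> (y > 0 \<and> (\<exists>x. (\<rho> ^^ y) i0 = (\<sigma> ^^ x) i0))" if "y < a" for y
    using that unfolding a_def by (rule not_less_Least)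
  from a obtain c where c: "(\<rho> ^^ a) i0 = (\<sigma> ^^ c) i0" by blast
  \<comment> \<open>Positions on the cycle count modulo its length d, so the return place can be
    normalised to b < d.\<close>
  define b where "b = c mod d"
  have b: "(\<rho> ^^ a) i0 = (\<sigma> ^^ b) i0"
    using d unfolding b_def by (simp add: c funpow_mod_eq)
  have "b < d" using d by (simp add: b_def)
  have s_iff: "(\<sigma> ^^ x) i0 = i0 \<longleftrightarrow> d dvd x" for x
  proof -
    have "(\<sigma> ^^ x) i0 = (\<sigma> ^^ (x mod d)) i0" using d by (simp add: funpow_mod_eq)
    moreover have "x mod d < d" using d by simp
    ultimately show ?thesis using d_min[of "x mod d"] by (auto simp: dvd_eq_mod_eq_0)
  qed
  have ra: "(\<rho> ^^ (a * u)) i0 = (\<sigma> ^^ (b * u)) i0" for u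
  proof (induction u)
    case (Suc u)
    have "(\<rho> ^^ (a * Suc u)) i0 = (\<rho> ^^ (a * u)) ((\<rho> ^^ a) i0)"
      by (simp add: funpow_add[symmetric] add.commute flip: comp_apply[of "\<rho> ^^ (a * u)" "\<rho> ^^ a"])
    also have "\<dots> = (\<sigma> ^^ b) ((\<rho> ^^ (a * u)) i0)" by (simp add: b comm')
    also have "\<dots> = (\<sigma> ^^ (b * Suc u)) i0" by (simp add: Suc funpow_add)
    finally show ?case .
  qed simp
  \<comment> \<open>The stabilizer of the base point, at first only for natural exponents; y is
    split into multiples of a, which \<sigma> absorbs, and a remainder.\<close>
  have fix1: "(\<sigma> ^^ x) ((\<rho> ^^ y) i0) = i0 \<longleftrightarrow> (int x, int y) \<in> hecke_lattice a b d" for x y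
  proof -
    define u where "u = y div a"
    have "y = a * u + y mod a" by (simp add: u_def)
    then have "(\<rho> ^^ y) i0 = (\<rho> ^^ (y mod a)) ((\<rho> ^^ (a * u)) i0)"
      by (metis add.commute comp_apply funpow_add)
    then have eq: "(\<sigma> ^^ x) ((\<rho> ^^ y) i0) = (\<sigma> ^^ (x + b * u)) ((\<rho> ^^ (y mod a)) i0)"
      by (simp add: ra comm'[symmetric] funpow_add)
    have mem: "(int x, int y) \<in> hecke_lattice a b d \<longleftrightarrow> a dvd y \<and> d dvd x + b * u"
      using a by (simp add: mem_hecke_lattice u_def flip: zdiv_int of_nat_mult of_nat_add)
    show ?thesis
    proof (cases "a dvd y")
      case True
      then show ?thesis using eq by (simp add: mem s_iff)
    next
      case False
      \<comment> \<open>Otherwise \<rho> would bring i0 back to its \<sigma>-cycle after fewer than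
        a steps. The power z of \<sigma> is undone by applying the power (d - 1) z, since
        \<open>\<sigma> ^^ (d * z)\<close> fixes i0.\<close>
      have "(\<sigma> ^^ (x + b * u)) ((\<rho> ^^ (y mod a)) i0) \<noteq> i0"
      proof
        assume H: "(\<sigma> ^^ (x + b * u)) ((\<rho> ^^ (y mod a)) i0) = i0"
        let ?z = "x + b * u"
        have "(\<sigma> ^^ ((d - 1) * ?z)) i0 = (\<sigma> ^^ ((d - 1) * ?z)) ((\<sigma> ^^ ?z) ((\<rho> ^^ (y mod a)) i0))"
          by (simp only: H)
        also have "\<dots> = (\<sigma> ^^ ((d - 1) * ?z + ?z)) ((\<rho> ^^ (y mod a)) i0)"
          by (simp only: funpow_add comp_apply)
        also have "(d - 1) * ?z + ?z = d * ?z" using d by (cases d) auto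
        also have "(\<sigma> ^^ (d * ?z)) ((\<rho> ^^ (y mod a)) i0) = (\<rho> ^^ (y mod a)) ((\<sigma> ^^ (d * ?z)) i0)"
          by (rule comm')
        also have "(\<sigma> ^^ (d * ?z)) i0 = i0" by (simp only: s_iff dvd_triv_left)
        finally have "\<exists>z. (\<rho> ^^ (y mod a)) i0 = (\<sigma> ^^ z) i0" by metis
        moreover have "y mod a > 0" "y mod a < a" using False a by (auto simp: dvd_eq_mod_eq_0)
        ultimately show False using a_min by blast
      qed
      with False show ?thesis using eq by (simp add: mem)
    qed
  qed
  have iff1: "(\<sigma> ^^ x) ((\<rho> ^^ y) i0) = (\<sigma> ^^ x') ((\<rho> ^^ y') i0) \<longleftrightarrow>
      (int x - int x', int y - int y') \<in> hecke_lattice a b d" for x y x' y'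
  proof -
    \<comment> \<open>As k annihilates Z^2 modulo the lattice, the word with exponents (k - 1)(x',
      y') carries the right-hand point back to i0. Being injective, it turns the comparison of two
      words into a stabilizer question answered by \<open>fix1\<close>.\<close>
    define k where "k = a * d"
    have k: "k > 0" using a d by (simp add: k_def)
    have Lk: "(int (k * x'), int (k * y')) \<in> hecke_lattice a b d"
      unfolding k_def of_nat_mult using mult_in_hecke_lattice[of a d "int x'" "int y'" b] by simp
    let ?f = "\<lambda>z. (\<sigma> ^^ ((k - 1) * x')) ((\<rho> ^^ ((k - 1) * y')) z)"
    have inj: "?f z = ?f z' \<longleftrightarrow> z = z'" for z z'
      by (simp add: permutes_funpow_inj[OF s] permutes_funpow_inj[OF r])
    have k1: "(k - 1) * m + m = k * m" for m using k by (cases k) auto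
    have "?f ((\<sigma> ^^ x') ((\<rho> ^^ y') i0)) = i0"
      unfolding funpow_pair_add[OF comm] k1 fix1 by (rule Lk)
    then have "(\<sigma> ^^ x) ((\<rho> ^^ y) i0) = (\<sigma> ^^ x') ((\<rho> ^^ y') i0) \<longleftrightarrow> ?f ((\<sigma> ^^ x) ((\<rho> ^^ y) i0)) = i0"
      using inj by metis
    also have "\<dots> \<longleftrightarrow> (int ((k - 1) * x' + x), int ((k - 1) * y' + y)) \<in> hecke_lattice a b d"
      unfolding funpow_pair_add[OF comm] fix1 ..
    also have "(int ((k - 1) * x' + x), int ((k - 1) * y' + y))
        = (int x - int x', int y - int y') + (int (k * x'), int (k * y'))"
      using k by (cases k) (auto simp: algebra_simps)
    also have "\<dots> \<in> hecke_lattice a b d \<longleftrightarrow> (int x - int x', int y - int y') \<in> hecke_lattice a b d"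
      using Lk hecke_lattice_add hecke_lattice_diff by (metis add_diff_cancel_right')
    finally show ?thesis .
  qed
  have one: "i0 \<in> {1..n}" using assms(2) by (simp add: i0_def)
  \<comment> \<open>Every point is a word applied to i0, and a common shift of the exponents leaves
    their differences alone.\<close>
  have iff: "(\<sigma> ^^ x) ((\<rho> ^^ y) i) = (\<sigma> ^^ x') ((\<rho> ^^ y') i) \<longleftrightarrow>
      (int x - int x', int y - int y') \<in> hecke_lattice a b d" if i: "i \<in> {1..n}" for i x y x' y'
  proof -
    obtain p q where i': "i = (\<sigma> ^^ p) ((\<rho> ^^ q) i0)" using trans[OF one i] by metis
    have "(\<sigma> ^^ x) ((\<rho> ^^ y) i) = (\<sigma> ^^ x') ((\<rho> ^^ y') i) \<longleftrightarrow>
        (\<sigma> ^^ (x + p)) ((\<rho> ^^ (y + q)) i0) = (\<sigma> ^^ (x' + p)) ((\<rho> ^^ (y' + q)) i0)"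
      unfolding i' funpow_pair_add[OF comm] ..
    then show ?thesis by (simp add: iff1)
  qed
  let ?e = "\<lambda>(x, y). (\<sigma> ^^ x) ((\<rho> ^^ y) i0)"
  \<comment> \<open>Only ad = n is still missing; it follows by counting the box against
    {1..n}.\<close>
  have "bij_betw ?e ({..<d} \<times> {..<a}) {1..n}"
    unfolding bij_betw_def
  proof
    show "inj_on ?e ({..<d} \<times> {..<a})"
    proof (rule inj_onI)
      fix z z' assume "z \<in> {..<d} \<times> {..<a}" "z' \<in> {..<d} \<times> {..<a}" "?e z = ?e z'"
      then obtain x y x' y' where z: "z = (x, y)" "z' = (x', y')"
        and H: "x < d" "y < a" "x' < d" "y' < a" "?e (x, y) = ?e (x', y')" by auto
      then have "(int x, int y) - (int x', int y') \<in> hecke_lattice a b d" by (simp add: iff1)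
      with H show "z = z'"
        using hecke_reduce_eq_iff[of a b d "(int x, int y)" "(int x', int y')"] a
        by (auto simp: hecke_reduce_fixed z)
    qed
    show "?e ` ({..<d} \<times> {..<a}) = {1..n}"
    proof (intro equalityI subsetI)
      fix i assume "i \<in> ?e ` ({..<d} \<times> {..<a})"
      then show "i \<in> {1..n}"
        using one permutes_funpow_in[OF s] permutes_funpow_in[OF r] by fastforce
    next
      fix i assume "i \<in> {1..n}"
      then obtain p q where i: "i = (\<sigma> ^^ p) ((\<rho> ^^ q) i0)" using trans[OF one] by metis
      obtain x y where xy: "x < d" "y < a" "hecke_reduce a b d (int p, int q) = (int x, int y)"
        using hecke_reduce_nat a d by metis
      then have "(int p, int q) - (int x, int y) \<in> hecke_lattice a b d"
        using hecke_reduce_reduce[of a d "(int p, int q)" b] a d by simp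
      then have "i = ?e (x, y)" by (simp add: i iff1)
      with xy show "i \<in> ?e ` ({..<d} \<times> {..<a})" by blast
    qed
  qed
  from bij_betw_same_card[OF this] have "a * d = n"
    by (simp add: card_cartesian_product mult.commute)
  with \<open>b < d\<close> have "pair_type n a b d \<sigma> \<rho>"
    using s r comm iff by (simp add: pair_type_def hecke_index_def)
  then show ?thesis by (rule that)
qed

text \<open>The model is Z^2 acting by translations on its quotient by the lattice; the reduced
  pairs are n representatives, and a bijection with {1..n} transports the action.\<close>

lemma ex_pair_type:
  assumes "(a, b, d) \<in> hecke_index n" "n \<ge> 1"
  obtains \<sigma> \<rho> where "pair_type n a b d \<sigma> \<rho>"
proof -
  note p = hecke_index_pos[OF assms]
  let ?R = "hecke_reduce a b d" and ?B = "(\<lambda>(x, y). (int x, int y)) ` ({..<d} \<times> {..<a})"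
  have "inj_on (\<lambda>(x, y). (int x, int y)) ({..<d} \<times> {..<a})" by (auto intro: inj_onI)
  then have "card ?B = n"
    using p by (simp add: card_image card_cartesian_product mult.commute)
  then obtain e where e: "bij_betw e {1..n} ?B"
    using finite_same_card_bij[of "{1..n}" ?B] by auto
  define e' where "e' = inv_into {1..n} e"
  have img: "e ` {1..n} = ?B" using e by (simp only: bij_betw_def)
  have e': "e' z \<in> {1..n}" "e (e' z) = z" if "z \<in> ?B" for z
    using that unfolding e'_def img[symmetric] by (rule inv_into_into, rule f_inv_into_f)
  have ee: "e' (e i) = i" if "i \<in> {1..n}" for i
    using that e unfolding e'_def by (simp add: bij_betw_def)
  have eB: "e i \<in> ?B" if "i \<in> {1..n}" for i
    using that unfolding img[symmetric] by (rule imageI)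
  have RB: "?R z \<in> ?B" for z
    using hecke_reduce_nat[OF p(1,2), of b z] by (metis (mono_tags, lifting) SigmaI case_prod_conv imageI lessThan_iff)
  have fixed: "?R z = z" if "z \<in> ?B" for z
    using that by (auto simp: hecke_reduce_fixed)
  have shift: "?R (w + ?R z) = ?R (w + z)" for w z
    using hecke_reduce_reduce[OF p(1,2), of z b] zero_in_hecke_lattice[of a b d]
      hecke_lattice_diff[of 0 a b d "z - ?R z"]
    unfolding hecke_reduce_eq_iff[OF p(1)] by (simp add: algebra_simps)
  \<comment> \<open>Translation by w modulo the lattice, read through the labels and extended by the
    identity outside {1..n}. The pair consists of the translations by the two unit vectors.\<close>
  define S where "S w = (\<lambda>i. if i \<in> {1..n} then e' (?R (w + e i)) else i)" for w
  have Se: "S w (e' (?R z)) = e' (?R (w + z))" for w z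
    using e'[OF RB] by (simp add: S_def shift)
  have S_add: "S w (S w' i) = S (w + w') i" for w w' i
    using e'[OF RB] by (auto simp: S_def shift add.assoc)
  have S0: "S 0 = id" by (auto simp: S_def fun_eq_iff ee fixed eB)
  have perm: "S w permutes {1..n}" for w
  proof (rule bij_imp_permutes)
    show "bij_betw (S w) {1..n} {1..n}"
    proof (rule bij_betw_byWitness[where f' = "S (- w)"])
      show "\<forall>i\<in>{1..n}. S (- w) (S w i) = i" "\<forall>i\<in>{1..n}. S w (S (- w) i) = i"
        by (auto simp: S_add S0)
      show "S w ` {1..n} \<subseteq> {1..n}" "S (- w) ` {1..n} \<subseteq> {1..n}"
        unfolding S_def using e'(1)[OF RB] by (simp_all add: image_subset_iff)
    qed
  qed (simp only: S_def if_False)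
  have pow: "(S (x, y) ^^ k) i = S (int k * x, int k * y) i" for x y k i
    by (induction k) (auto simp: S0[unfolded zero_prod_def] S_add algebra_simps)
  have "pair_type n a b d (S (1, 0)) (S (0, 1))"
    unfolding pair_type_def
  proof (intro conjI ballI allI)
    show "S (1, 0) \<circ> S (0, 1) = S (0, 1) \<circ> S (1, 0)"
      by (auto simp: S_add fun_eq_iff)
    fix i s t s' t' assume i: "i \<in> {1..n}"
    have inj: "e' z = e' z' \<longleftrightarrow> z = z'" if "z \<in> ?B" "z' \<in> ?B" for z z'
      using e'(2) that by metis
    show "((S (1, 0) ^^ s) ((S (0, 1) ^^ t) i) = (S (1, 0) ^^ s') ((S (0, 1) ^^ t') i)) =
       ((int s - int s', int t - int t') \<in> hecke_lattice a b d)"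
      using i by (auto simp: pow S_add) (auto simp: S_def inj[OF RB RB] hecke_reduce_eq_iff[OF p(1)])
  qed (use assms perm in auto)
  then show ?thesis by (rule that)
qed

section \<open>Conjugacy of pairs of the same type\<close>

lemma funpow_conj:
  assumes "bij \<pi>"
  shows "((\<pi> \<circ> \<sigma> \<circ> inv' \<pi>) ^^ k) i = \<pi> ((\<sigma> ^^ k) (inv' \<pi> i))"
  using assms by (induction k) (auto simp: bij_is_surj surj_f_inv_f bij_is_inj)

lemma pair_type_conj:
  assumes "pair_type n a b d \<sigma> \<rho>" "\<pi> permutes {1..n}"
  shows "pair_type n a b d (\<pi> \<circ> \<sigma> \<circ> inv' \<pi>) (\<pi> \<circ> \<rho> \<circ> inv' \<pi>)"
proof -
  have H: "\<sigma> permutes {1..n}" "\<rho> permutes {1..n}" "\<sigma> \<circ> \<rho> = \<rho> \<circ> \<sigma>"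
    using assms by (simp_all only: pair_type_def)
  have bij: "bij \<pi>" using assms(2) by (rule permutes_bij)
  have inv: "inv' \<pi> (\<pi> i) = i" "\<pi> (inv' \<pi> i) = i" "\<pi> i = \<pi> j \<longleftrightarrow> i = j" for i j
    using bij by (auto simp: bij_is_inj bij_is_surj surj_f_inv_f inj_eq)
  have "\<sigma> (\<rho> i) = \<rho> (\<sigma> i)" for i using H(3) by (metis comp_apply)
  then have comm: "(\<pi> \<circ> \<sigma> \<circ> inv' \<pi>) \<circ> (\<pi> \<circ> \<rho> \<circ> inv' \<pi>) = (\<pi> \<circ> \<rho> \<circ> inv' \<pi>) \<circ> (\<pi> \<circ> \<sigma> \<circ> inv' \<pi>)"
    by (auto simp: fun_eq_iff inv)
  have perm: "\<pi> \<circ> \<tau> \<circ> inv' \<pi> permutes {1..n}" if "\<tau> permutes {1..n}" for \<tau>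
    using that assms(2) by (intro permutes_compose permutes_inv) auto
  have "inv' \<pi> i \<in> {1..n}" if "i \<in> {1..n}" for i
    using that permutes_in_image[OF permutes_inv[OF assms(2)]] by blast
  then show ?thesis
    using assms(1) comm perm[OF H(1)] perm[OF H(2)]
    by (simp add: pair_type_def funpow_conj[OF bij] inv)
qed

text \<open>For both pairs the point 1 has the same stabilizer, so sending a word applied to 1 to
  the corresponding word of the other pair is a well-defined equivariant bijection.\<close>

lemma pair_type_conjugate:
  assumes t: "pair_type n a b d \<sigma> \<rho>" and t': "pair_type n a b d \<sigma>' \<rho>'" and n: "n \<ge> 1"
  obtains \<pi> where "\<pi> permutes {1..n}" "\<sigma>' = \<pi> \<circ> \<sigma> \<circ> inv' \<pi>" "\<rho>' = \<pi> \<circ> \<rho> \<circ> inv' \<pi>"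
proof -
  have one: "1 \<in> {1..n}" using n by auto
  have p: "\<sigma> permutes {1..n}" "\<rho> permutes {1..n}" "\<sigma>' permutes {1..n}" "\<rho>' permutes {1..n}"
    and comm: "\<sigma> \<circ> \<rho> = \<rho> \<circ> \<sigma>" "\<sigma>' \<circ> \<rho>' = \<rho>' \<circ> \<sigma>'"
    using t t' by (simp_all only: pair_type_def)
  let ?f = "\<lambda>(x, y). (\<sigma> ^^ x) ((\<rho> ^^ y) 1)" and ?f' = "\<lambda>(x, y). (\<sigma>' ^^ x) ((\<rho>' ^^ y) 1)"
  have "?f z = ?f w \<longleftrightarrow> ?f' z = ?f' w" for z w
    unfolding case_prod_unfold by (simp only: pair_type_iff[OF t one] pair_type_iff[OF t' one])
  then obtain h where h: "bij_betw h (range ?f) (range ?f')" and hf: "\<And>z. z \<in> UNIV \<Longrightarrow> h (?f z) = ?f' z"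
    by (rule bij_betw_same_kernel[of UNIV ?f ?f']) blast
  have h: "bij_betw h {1..n} {1..n}"
    using h by (simp only: pair_type_orbit_image[OF t n one] pair_type_orbit_image[OF t' n one])
  \<comment> \<open>The bijection is known only on {1..n}; \<open>permutes\<close> demands the
    identity elsewhere.\<close>
  define \<pi> where "\<pi> i = (if i \<in> {1..n} then h i else i)" for i
  have "bij_betw \<pi> {1..n} {1..n}" using h by (subst bij_betw_cong[of _ _ h]) (auto simp: \<pi>_def)
  then have \<pi>: "\<pi> permutes {1..n}" by (rule bij_imp_permutes) (auto simp: \<pi>_def)
  have in_range: "\<exists>x y. i = ?f (x, y)" if "i \<in> {1..n}" for i
    by (rule pair_type_reach[OF t n one that]) auto
  have \<pi>f: "\<pi> (?f z) = ?f' z" for z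
  proof -
    have "?f z \<in> {1..n}" using pair_type_orbit_image[OF t n one] by blast
    then show ?thesis unfolding \<pi>_def by (simp only: if_True hf UNIV_I)
  qed
  have "\<pi> (\<sigma> i) = \<sigma>' (\<pi> i) \<and> \<pi> (\<rho> i) = \<rho>' (\<pi> i)" for i
  proof (cases "i \<in> {1..n}")
    case True
    then obtain x y where i: "i = ?f (x, y)" using in_range by blast
    have \<sigma>\<rho>: "\<sigma> i = ?f (Suc x, y)" "\<rho> i = ?f (x, Suc y)"
      "\<sigma>' (?f' (x, y)) = ?f' (Suc x, y)" "\<rho>' (?f' (x, y)) = ?f' (x, Suc y)"
      unfolding i using funpow_commute_apply[OF comm(1), of x 1 "(\<rho> ^^ y) 1"]
        funpow_commute_apply[OF comm(2), of x 1 "(\<rho>' ^^ y) 1"]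
      by simp_all
    have "\<pi> i = ?f' (x, y)" unfolding i by (rule \<pi>f)
    then show ?thesis
      by (simp only: \<sigma>\<rho>(1,2) \<pi>f \<sigma>\<rho>(3,4)[symmetric])
  next
    case False
    then show ?thesis unfolding \<pi>_def by (simp only: if_False permutes_not_in[OF p(1) False]
      permutes_not_in[OF p(2) False] permutes_not_in[OF p(3) False] permutes_not_in[OF p(4) False])
  qed
  then have "\<pi> \<circ> \<sigma> = \<sigma>' \<circ> \<pi>" "\<pi> \<circ> \<rho> = \<rho>' \<circ> \<pi>" by (simp_all add: fun_eq_iff)
  then have "\<sigma>' = \<pi> \<circ> \<sigma> \<circ> inv' \<pi>" "\<rho>' = \<pi> \<circ> \<rho> \<circ> inv' \<pi>"
    using permutes_inv_o(1)[OF \<pi>] by (simp_all only: comp_assoc comp_id)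
  with \<pi> show ?thesis by (rule that)
qed

lemma conj_class_eq:
  assumes "pair_type n a b d \<sigma> \<rho>" "n \<ge> 1"
  shows "conj_class n (\<sigma>, \<rho>) = {(\<sigma>', \<rho>'). pair_type n a b d \<sigma>' \<rho>'}"
proof -
  have "conj_class n (\<sigma>, \<rho>) = (\<lambda>\<pi>. (\<pi> \<circ> \<sigma> \<circ> inv' \<pi>, \<pi> \<circ> \<rho> \<circ> inv' \<pi>)) ` {\<pi>. \<pi> permutes {1..n}}"
    by (auto simp: conj_class_def sym_group_carrier sym_group_mult image_iff)
  also have "\<dots> = {(\<sigma>', \<rho>'). pair_type n a b d \<sigma>' \<rho>'}"
  proof (intro equalityI subsetI)
    fix z assume "z \<in> {(\<sigma>', \<rho>'). pair_type n a b d \<sigma>' \<rho>'}"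
    then obtain \<sigma>' \<rho>' where z: "z = (\<sigma>', \<rho>')" and t': "pair_type n a b d \<sigma>' \<rho>'" by blast
    obtain \<pi> where "\<pi> permutes {1..n}" "\<sigma>' = \<pi> \<circ> \<sigma> \<circ> inv' \<pi>" "\<rho>' = \<pi> \<circ> \<rho> \<circ> inv' \<pi>"
      by (rule pair_type_conjugate[OF assms(1) t' assms(2)])
    then show "z \<in> (\<lambda>\<pi>. (\<pi> \<circ> \<sigma> \<circ> inv' \<pi>, \<pi> \<circ> \<rho> \<circ> inv' \<pi>)) ` {\<pi>. \<pi> permutes {1..n}}"
      unfolding z by blast
  qed (use pair_type_conj[OF assms(1)] in auto)
  finally show ?thesis .
qed

text \<open>A conjugacy class is the set of all pairs of one type. A summand depending only on the
  type is therefore insensitive to the representative that is picked, and the sum can be indexed by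
  triples. Both the geometric and the combinatorial operator are evaluated through this
  lemma.\<close>

lemma sum_transitive_classes:
  assumes n: "n \<ge> 1"
    and T: "\<And>a b d \<sigma> \<rho>. pair_type n a b d \<sigma> \<rho> \<Longrightarrow> T \<sigma> \<rho> = U a b d"
  shows "(\<Sum>C\<in>transitive_classes n. let (\<sigma>, \<rho>) = SOME p. p \<in> C in T \<sigma> \<rho>) =
         (\<Sum>(a, b, d)\<in>hecke_index n. U a b d)"
proof -
  let ?K = "\<lambda>(a, b, d). {(\<sigma>, \<rho>). pair_type n a b d \<sigma> \<rho>}"
  have img: "transitive_classes n = ?K ` hecke_index n"
  proof (intro equalityI subsetI)
    fix C assume "C \<in> transitive_classes n"
    then obtain \<sigma> \<rho> where C: "C = conj_class n (\<sigma>, \<rho>)" "(\<sigma>, \<rho>) \<in> transitive_pairs n"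
      by (auto simp: transitive_classes_def)
    obtain a b d where t: "pair_type n a b d \<sigma> \<rho>" by (rule transitive_imp_pair_type[OF C(2) n])
    then have "(a, b, d) \<in> hecke_index n" by (simp only: pair_type_def)
    then show "C \<in> ?K ` hecke_index n"
      unfolding C conj_class_eq[OF t n] by (rule rev_image_eqI) simp
  next
    fix C assume "C \<in> ?K ` hecke_index n"
    then obtain a b d where h: "(a, b, d) \<in> hecke_index n" and C: "C = ?K (a, b, d)" by auto
    obtain \<sigma> \<rho> where t: "pair_type n a b d \<sigma> \<rho>" by (rule ex_pair_type[OF h n])
    have "C = conj_class n (\<sigma>, \<rho>)" unfolding conj_class_eq[OF t n] C by simp
    with pair_type_imp_transitive[OF t n] show "C \<in> transitive_classes n"
      by (simp add: transitive_classes_def)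
  qed
  have inj: "inj_on ?K (hecke_index n)"
  proof (rule inj_onI)
    fix z z' assume z: "z \<in> hecke_index n" "z' \<in> hecke_index n" "?K z = ?K z'"
    obtain a b d a' b' d' where zz: "z = (a, b, d)" "z' = (a', b', d')" by (metis prod_cases3)
    from z have h: "(a, b, d) \<in> hecke_index n" and eq: "?K (a, b, d) = ?K (a', b', d')"
      unfolding zz by blast+
    obtain \<sigma> \<rho> where \<sigma>\<rho>: "pair_type n a b d \<sigma> \<rho>" by (rule ex_pair_type[OF h n])
    then have "(\<sigma>, \<rho>) \<in> ?K (a', b', d')" unfolding eq[symmetric] by simp
    then have "pair_type n a' b' d' \<sigma> \<rho>" by simp
    from pair_type_unique[OF \<sigma>\<rho> this n] show "z = z'" by (simp add: zz)
  qed
  \<comment> \<open>The chosen element is some pair of the given type, which is all that the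
    hypothesis on T asks for.\<close>
  have val: "(let (\<sigma>, \<rho>) = SOME p. p \<in> ?K (a, b, d) in T \<sigma> \<rho>) = U a b d"
    if h: "(a, b, d) \<in> hecke_index n" for a b d
  proof -
    obtain \<sigma> \<rho> where "pair_type n a b d \<sigma> \<rho>" by (rule ex_pair_type[OF h n])
    then have "(\<sigma>, \<rho>) \<in> ?K (a, b, d)" by simp
    then have "(SOME p. p \<in> ?K (a, b, d)) \<in> ?K (a, b, d)" by (rule someI)
    then show ?thesis using T by (auto simp: Let_def split: prod.splits)
  qed
  show ?thesis
    unfolding img sum.reindex[OF inj] by (rule sum.cong) (auto simp: val[simplified])
qed

text \<open>Evaluation at 1 is a bijection onto {1..n}: an element commuting with a transitive
  action is determined by one value, and all values occur because the words in \<sigma> and \<rho>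
  themselves commute with both. This produces the weight 1/n.\<close>

lemma card_pair_centralizer:
  assumes t: "pair_type n a b d \<sigma> \<rho>" and n: "n \<ge> 1"
  shows "card (pair_centralizer n \<sigma> \<rho>) = n"
proof -
  have one: "1 \<in> {1..n}" using n by auto
  have p: "\<sigma> permutes {1..n}" "\<rho> permutes {1..n}" and comm: "\<sigma> \<circ> \<rho> = \<rho> \<circ> \<sigma>"
    using t by (simp_all only: pair_type_def)
  have mem: "\<pi> \<in> pair_centralizer n \<sigma> \<rho> \<longleftrightarrow> \<pi> permutes {1..n} \<and> \<pi> \<circ> \<sigma> = \<sigma> \<circ> \<pi> \<and> \<pi> \<circ> \<rho> = \<rho> \<circ> \<pi>" for \<pi>
    by (auto simp: pair_centralizer_def sym_group_carrier sym_group_mult)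
  have "bij_betw (\<lambda>\<pi>. \<pi> 1) (pair_centralizer n \<sigma> \<rho>) {1..n}"
    unfolding bij_betw_def
  proof
    show "inj_on (\<lambda>\<pi>. \<pi> 1) (pair_centralizer n \<sigma> \<rho>)"
    proof (rule inj_onI, rule ext)
      fix \<pi> \<pi>' i assume H: "\<pi> \<in> pair_centralizer n \<sigma> \<rho>" "\<pi>' \<in> pair_centralizer n \<sigma> \<rho>" "\<pi> 1 = \<pi>' 1"
      show "\<pi> i = \<pi>' i"
      proof (cases "i \<in> {1..n}")
        case True
        then obtain x y where i: "i = (\<sigma> ^^ x) ((\<rho> ^^ y) 1)" using pair_type_reach[OF t n one] by blast
        have "\<theta> i = (\<sigma> ^^ x) ((\<rho> ^^ y) (\<theta> 1))" if "\<theta> \<in> pair_centralizer n \<sigma> \<rho>" for \<theta>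
          using that funpow_commute_apply[of \<sigma> \<theta> x 1] funpow_commute_apply[of \<rho> \<theta> y 1]
          by (simp add: mem i)
        with H show ?thesis by metis
      next
        case False
        with H show ?thesis unfolding mem by (metis permutes_not_in)
      qed
    qed
    show "(\<lambda>\<pi>. \<pi> 1) ` pair_centralizer n \<sigma> \<rho> = {1..n}"
    proof (intro equalityI subsetI)
      fix i assume "i \<in> (\<lambda>\<pi>. \<pi> 1) ` pair_centralizer n \<sigma> \<rho>"
      then obtain \<pi> where "\<pi> permutes {1..n}" "i = \<pi> 1" by (auto simp: mem)
      then show "i \<in> {1..n}" using permutes_in_image one by metis
    next
      fix i assume "i \<in> {1..n}"
      then obtain x y where i: "i = (\<sigma> ^^ x) ((\<rho> ^^ y) 1)" using pair_type_reach[OF t n one] by blast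
      have "\<sigma> ^^ x \<circ> \<rho> ^^ y \<in> pair_centralizer n \<sigma> \<rho>"
      proof -
        have "\<sigma> \<circ> \<rho> ^^ y = \<rho> ^^ y \<circ> \<sigma>" "\<rho> \<circ> \<sigma> ^^ x = \<sigma> ^^ x \<circ> \<rho>"
          using funpow_commute_apply[OF comm, of 1] funpow_commute_apply[OF comm, of _ 1]
          by (simp_all add: fun_eq_iff)
        moreover have "\<sigma> \<circ> \<sigma> ^^ x = \<sigma> ^^ x \<circ> \<sigma>" "\<rho> \<circ> \<rho> ^^ y = \<rho> ^^ y \<circ> \<rho>"
          by (simp_all add: fun_eq_iff funpow_swap1)
        ultimately show ?thesis
          unfolding mem by (metis comp_assoc permutes_compose permutes_funpow p)
      qed
      then show "i \<in> (\<lambda>\<pi>. \<pi> 1) ` pair_centralizer n \<sigma> \<rho>" by (rule rev_image_eqI) (simp add: i)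
    qed
  qed
  from bij_betw_same_card[OF this] show ?thesis by simp
qed

section \<open>Characters of virtual representations\<close>

lemma index_mult_mat_sum:
  fixes A B :: "'a::comm_semiring_1 mat"
  assumes "A \<in> carrier_mat n k" "B \<in> carrier_mat k m" "i < n" "j < m"
  shows "(A * B) $$ (i, j) = (\<Sum>l<k. A $$ (i, l) * B $$ (l, j))"
  using assms by (auto simp: scalar_prod_def lessThan_atLeast0)

lemma rep_trace_mult_commute:
  assumes "A \<in> carrier_mat n m" "B \<in> carrier_mat m n"
  shows "rep_trace (A * B) = rep_trace (B * A)"
proof -
  have "rep_trace (A * B) = (\<Sum>i<n. \<Sum>l<m. A $$ (i, l) * B $$ (l, i))"
    using assms unfolding rep_trace_def
    by (intro sum.cong) (auto simp: index_mult_mat_sum[OF assms] simp del: index_mult_mat(1))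
  also have "\<dots> = (\<Sum>l<m. \<Sum>i<n. B $$ (l, i) * A $$ (i, l))"
    by (subst sum.swap) (simp add: mult.commute)
  also have "\<dots> = rep_trace (B * A)"
    using assms unfolding rep_trace_def
    by (intro sum.cong) (auto simp: index_mult_mat_sum[OF assms(2,1)] simp del: index_mult_mat(1))
  finally show ?thesis .
qed

lemma rep_trace_smult:
  "rep_trace (c \<cdot>\<^sub>m A) = c * rep_trace A" if "A \<in> carrier_mat n n"
  using that by (auto simp: rep_trace_def sum_distrib_left)

lemma rep_trace_conj:
  assumes "S \<in> carrier_mat n n" "A \<in> carrier_mat n n" "B \<in> carrier_mat n n"
    and "invertible_mat S" "S * A = B * S"
  shows "rep_trace A = rep_trace B"
proof -
  obtain T where T: "S * T = 1\<^sub>m (dim_row S)" "T * S = 1\<^sub>m (dim_row T)"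
    using assms(4) by (auto simp: invertible_mat_def inverts_mat_def)
  \<comment> \<open>Invertibility provides T without dimensions; they are read off from the identity
    matrices on the right of the two equations.\<close>
  have Tc: "T \<in> carrier_mat n n"
  proof
    show "dim_col T = n" using arg_cong[OF T(1), of dim_col] assms(1) by simp
    show "dim_row T = n" using arg_cong[OF T(2), of dim_col] assms(1) by simp
  qed
  have "rep_trace A = rep_trace (T * S * A)"
    using T(2) assms(2) Tc by simp
  also have "T * S * A = T * (B * S)"
    using assms Tc by (simp add: assoc_mult_mat[of T n n S n A n])
  also have "rep_trace \<dots> = rep_trace (B * S * T)"
    using assms Tc by (intro rep_trace_mult_commute[of _ n n]) auto
  also have "B * S * T = B"
    using T(1) assms Tc by (simp add: assoc_mult_mat[of B n n S n T n])
  finally show ?thesis .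
qed

lemma is_rep_carrier:
  assumes "is_rep G H V" "x \<in> H" shows "V x \<in> carrier_mat (rep_dim G V) (rep_dim G V)"
  using assms by (auto simp: is_rep_def)

lemma rep_trace_sum:
  assumes "is_rep G H V" "is_rep G H W" "x \<in> H"
  shows "rep_trace (rep_sum G V W x) = rep_trace (V x) + rep_trace (W x)"
proof -
  let ?n = "rep_dim G V" and ?m = "rep_dim G W"
  have c: "V x \<in> carrier_mat ?n ?n" "W x \<in> carrier_mat ?m ?m"
    by (rule is_rep_carrier[OF assms(1,3)], rule is_rep_carrier[OF assms(2,3)])
  have split: "{..<?n + ?m} = {..<?n} \<union> {?n..<?n + ?m}" by auto
  note d = carrier_matD[OF c(1)] carrier_matD[OF c(2)]
  have idx: "rep_sum G V W x $$ (i, i) = (if i < ?n then V x $$ (i, i) else W x $$ (i - ?n, i - ?n))"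
    if "i < ?n + ?m" for i
    using that d by (simp add: rep_sum_def)
  have "rep_trace (rep_sum G V W x) = (\<Sum>i<?n + ?m. rep_sum G V W x $$ (i, i))"
    using d by (simp add: rep_trace_def rep_sum_def)
  also have "\<dots> = (\<Sum>i<?n. rep_sum G V W x $$ (i, i)) + (\<Sum>i\<in>{?n..<?n + ?m}. rep_sum G V W x $$ (i, i))"
    unfolding split by (rule sum.union_disjoint) auto
  also have "(\<Sum>i<?n. rep_sum G V W x $$ (i, i)) = rep_trace (V x)"
    unfolding rep_trace_def d by (intro sum.cong refl) (simp add: idx)
  also have "(\<Sum>i\<in>{?n..<?n + ?m}. rep_sum G V W x $$ (i, i)) = (\<Sum>i<?m. W x $$ (i, i))"
    using sum.shift_bounds_nat_ivl[of "\<lambda>i. rep_sum G V W x $$ (i, i)" 0 ?n ?m]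
    by (simp add: idx add.commute lessThan_atLeast0)
  finally show ?thesis by (simp add: rep_trace_def d)
qed

lemma rep_sum_carrier:
  assumes "is_rep G H V" "is_rep G H W" "x \<in> H"
  shows "rep_sum G V W x \<in> carrier_mat (rep_dim G V + rep_dim G W) (rep_dim G V + rep_dim G W)"
  using is_rep_carrier[OF assms(1,3)] is_rep_carrier[OF assms(2,3)]
  by (auto simp: rep_sum_def)

lemma rep_dim_sum:
  "rep_dim G (rep_sum G V W) = rep_dim G V + rep_dim G W"
  by (simp add: rep_dim_def rep_sum_def)

text \<open>Equivalence is an isomorphism between V + W' and V' + W; comparing traces and moving W
  and W' across gives equal differences.\<close>

lemma virtual_equiv_trace:
  assumes "((V, W), (V', W')) \<in> virtual_equiv G H" "x \<in> H"
  shows "rep_trace (V x) - rep_trace (W x) = rep_trace (V' x) - rep_trace (W' x)"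
proof -
  from assms have r: "is_rep G H V" "is_rep G H W" "is_rep G H V'" "is_rep G H W'"
    and iso: "rep_iso G H (rep_sum G V W') (rep_sum G V' W)"
    by (auto simp: virtual_equiv_def virtual_reps_def)
  from iso obtain S where S: "S \<in> carrier_mat (rep_dim G V + rep_dim G W') (rep_dim G V + rep_dim G W')"
      "invertible_mat S" "S * rep_sum G V W' x = rep_sum G V' W x * S"
    and dim: "rep_dim G V + rep_dim G W' = rep_dim G V' + rep_dim G W"
    using assms(2) by (auto simp: rep_iso_def rep_dim_sum)
  have "rep_trace (rep_sum G V W' x) = rep_trace (rep_sum G V' W x)"
    using rep_trace_conj[OF S(1) _ _ S(2,3)] rep_sum_carrier[OF r(1,4) assms(2)]
      rep_sum_carrier[OF r(3,2) assms(2)] dim by auto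
  then show ?thesis
    using rep_trace_sum[OF r(1,4) assms(2)] rep_trace_sum[OF r(3,2) assms(2)]
    by (simp add: algebra_simps)
qed

text \<open>The definition picks an arbitrary representative; the trace difference is constant on
  the class, so any known representative may be used instead.\<close>

lemma virtual_char_eq:
  assumes "\<xi> \<in> rep_ring G H" "(V, W) \<in> \<xi>" "x \<in> H"
  shows "virtual_char \<xi> x = rep_trace (V x) - rep_trace (W x)"
proof -
  obtain p where p: "\<xi> = virtual_equiv G H `` {p}"
    using assms(1) by (auto simp: rep_ring_def quotient_def)
  obtain V0 W0 where p0: "p = (V0, W0)" by fastforce
  have "(SOME p. p \<in> \<xi>) \<in> \<xi>" using assms(2) by (rule someI)
  moreover obtain V' W' where some: "(SOME p. p \<in> \<xi>) = (V', W')" by fastforce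
  ultimately have "((V0, W0), (V', W')) \<in> virtual_equiv G H" "((V0, W0), (V, W)) \<in> virtual_equiv G H"
    using assms(2) p p0 by auto
  from this[THEN virtual_equiv_trace, OF assms(3)] show ?thesis
    by (simp add: virtual_char_def some)
qed

lemma rep_ring_mem_is_rep:
  assumes "\<xi> \<in> rep_ring G H" "(V, W) \<in> \<xi>"
  shows "is_rep G H V" "is_rep G H W"
  using assms by (auto simp: rep_ring_def quotient_def virtual_equiv_def virtual_reps_def)


section \<open>Traces of cyclically permuted tensor products\<close>

lemma sum_PiE_insert:
  assumes "x \<notin> S"
  shows "(\<Sum>i\<in>PiE (insert x S) T. F i) = (\<Sum>y\<in>T x. \<Sum>i\<in>PiE S T. F (i(x := y)))"
  unfolding PiE_insert_eq
  by (subst sum.reindex[OF inj_combinator[OF assms]]) (simp add: sum.cartesian_product case_prod_unfold)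

text \<open>Later factors stand on the left, so that \<open>A 0\<close> acts first, as when
  following the tensor factors along a cycle.\<close>

fun mat_prod :: "nat \<Rightarrow> (nat \<Rightarrow> complex mat) \<Rightarrow> nat \<Rightarrow> complex mat" where
  "mat_prod D A 0 = 1\<^sub>m D"
| "mat_prod D A (Suc m) = A m * mat_prod D A m"

lemma mat_prod_carrier:
  assumes "\<And>t. t < m \<Longrightarrow> A t \<in> carrier_mat D D"
  shows "mat_prod D A m \<in> carrier_mat D D"
  using assms
proof (induction m)
  case (Suc m)
  then have "A m \<in> carrier_mat D D" "mat_prod D A m \<in> carrier_mat D D" by simp_all
  then show ?case by simp
qed simp

text \<open>Matrix multiplication as a sum over paths: \<open>i t\<close> is the basis index before
  step t, the path starts at the column q, and the last factor ends at the row p.\<close>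

lemma mat_prod_path_sum:
  assumes "\<And>t. t \<le> m \<Longrightarrow> A t \<in> carrier_mat D D" "p < D" "q < D"
  shows "mat_prod D A (Suc m) $$ (p, q) =
    (\<Sum>i\<in>{..m} \<rightarrow>\<^sub>E {..<D}. if i 0 = q then (\<Prod>t<m. A t $$ (i (Suc t), i t)) * A m $$ (p, i m) else 0)"
  using assms
proof (induction m arbitrary: p)
  case 0
  have eq: "{..0::nat} = insert 0 {}" by auto
  have "(\<Sum>i\<in>{..0} \<rightarrow>\<^sub>E {..<D}. if i 0 = q then (\<Prod>t<0. A t $$ (i (Suc t), i t)) * A 0 $$ (p, i 0) else 0)
      = (\<Sum>y<D. if y = q then A 0 $$ (p, y) else 0)"
    unfolding eq by (subst sum_PiE_insert) (simp_all only: PiE_empty_domain empty_iff, simp_all)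
  with 0 show ?case by (simp add: right_mult_one_mat[of _ D D])
next
  case (Suc m)
  have "{..Suc m} = insert (Suc m) {..m}" by auto
  then have "(\<Sum>i\<in>{..Suc m} \<rightarrow>\<^sub>E {..<D}. if i 0 = q
        then (\<Prod>t<Suc m. A t $$ (i (Suc t), i t)) * A (Suc m) $$ (p, i (Suc m)) else 0)
      = (\<Sum>y<D. \<Sum>i\<in>{..m} \<rightarrow>\<^sub>E {..<D}. if i 0 = q
        then (\<Prod>t<m. A t $$ (i (Suc t), i t)) * A m $$ (y, i m) * A (Suc m) $$ (p, y) else 0)"
    by (simp only: sum_PiE_insert[of "Suc m" "{..m}"] atMost_iff) (auto intro!: sum.cong prod.cong)
  also have "\<dots> = (\<Sum>y<D. A (Suc m) $$ (p, y) * mat_prod D A (Suc m) $$ (y, q))"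
    using Suc by (auto simp: sum_distrib_left if_distrib mult_ac cong: if_cong intro!: sum.cong
        simp del: mat_prod.simps)
  also have "\<dots> = mat_prod D A (Suc (Suc m)) $$ (p, q)"
  proof -
    have "A (Suc m) \<in> carrier_mat D D" "mat_prod D A (Suc m) \<in> carrier_mat D D"
      using Suc.prems mat_prod_carrier[of "Suc m" A D] by auto
    from index_mult_mat_sum[OF this Suc.prems(2,3)] show ?thesis by simp
  qed
  finally show ?case ..
qed

text \<open>Taking the trace closes the paths: the last factor has to end at the starting index
  \<open>i 0\<close>. The left side is the trace of operators combined with a cyclic permutation of
  a tensor factors.\<close>

lemma cyclic_trace:
  assumes "\<And>t. t < a \<Longrightarrow> A t \<in> carrier_mat D D" "a > 0"
  shows "(\<Sum>i\<in>{..<a} \<rightarrow>\<^sub>E {..<D}. \<Prod>t<a. A t $$ (i (Suc t mod a), i t)) = rep_trace (mat_prod D A a)"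
proof -
  obtain m where a: "a = Suc m" using assms(2) by (cases a) auto
  have c: "mat_prod D A a \<in> carrier_mat D D" using assms(1) by (rule mat_prod_carrier)
  have "rep_trace (mat_prod D A a) = (\<Sum>p<D. mat_prod D A (Suc m) $$ (p, p))"
    using c by (simp add: rep_trace_def a del: mat_prod.simps)
  also have "\<dots> = (\<Sum>p<D. \<Sum>i\<in>{..m} \<rightarrow>\<^sub>E {..<D}. if i 0 = p
      then (\<Prod>t<m. A t $$ (i (Suc t), i t)) * A m $$ (p, i m) else 0)"
    using assms(1) by (intro sum.cong refl mat_prod_path_sum) (auto simp: a)
  also have "\<dots> = (\<Sum>i\<in>{..m} \<rightarrow>\<^sub>E {..<D}. \<Sum>p<D. if p = i 0
      then (\<Prod>t<m. A t $$ (i (Suc t), i t)) * A m $$ (p, i m) else 0)"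
    by (subst sum.swap) (auto intro!: sum.cong)
  also have "\<dots> = (\<Sum>i\<in>{..m} \<rightarrow>\<^sub>E {..<D}. (\<Prod>t<m. A t $$ (i (Suc t), i t)) * A m $$ (i 0, i m))"
  proof (rule sum.cong)
    fix i assume "i \<in> {..m} \<rightarrow>\<^sub>E {..<D}"
    then have "i 0 \<in> {..<D}" by auto
    then show "(\<Sum>p<D. if p = i 0 then (\<Prod>t<m. A t $$ (i (Suc t), i t)) * A m $$ (p, i m) else 0)
        = (\<Prod>t<m. A t $$ (i (Suc t), i t)) * A m $$ (i 0, i m)"
      by simp
  qed simp
  also have "\<dots> = (\<Sum>i\<in>{..<a} \<rightarrow>\<^sub>E {..<D}. \<Prod>t<a. A t $$ (i (Suc t mod a), i t))"
    by (auto simp: a lessThan_Suc_atMost[symmetric] intro!: sum.cong prod.cong)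
  finally show ?thesis ..
qed

text \<open>Pairs of indices are compared before and after the cyclic shift. Only pairs involving the last
  index, which wraps around, contribute a sign beyond a telescoping square.\<close>

lemma cyclic_shift_inversions:
  fixes f :: "nat \<Rightarrow> nat"
  assumes inj: "inj_on f {..<a}" and "a > 0"
  shows "(-1 :: complex) ^ card {(x, y). x < a \<and> y < a \<and> f x < f y \<and> f (Suc y mod a) < f (Suc x mod a)}
    = (-1) ^ (a - 1)"
proof -
  obtain m where a: "a = Suc m" using assms(2) by (cases a) auto
  let ?n = "\<lambda>x. Suc x mod a"
  let ?P = "{(x, y). x < y \<and> y < a}"
  have finP: "finite ?P" by (rule finite_subset[of _ "{..<a} \<times> {..<a}"]) auto
  have neq: "f x < f y \<longleftrightarrow> \<not> f y < f x" if "x < a" "y < a" "x \<noteq> y" for x y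
    using that inj by (metis inj_onD lessThan_iff linorder_neqE_nat less_asym)
  have nlt: "?n x < a" for x using assms(2) by simp
  have nneq: "?n x \<noteq> ?n y" if "x < a" "y < a" "x \<noteq> y" for x y
    using that by (auto simp: a mod_Suc split: if_splits)
  let ?K = "{(x, y) \<in> ?P. (f x < f y) \<noteq> (f (?n x) < f (?n y))}"
  let ?I = "{(x, y). x < a \<and> y < a \<and> f x < f y \<and> f (?n y) < f (?n x)}"
  \<comment> \<open>An inversion is an unordered pair whose f-order changes under the shift. It may
    be listed by increasing f, as in the claim, or by increasing index, which suits the product
    below.\<close>
  have "bij_betw (\<lambda>(x, y). if x < y then (x, y) else (y, x)) ?I ?K"
  proof (rule bij_betw_byWitness[where f' = "\<lambda>(x, y). if f x < f y then (x, y) else (y, x)"])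
    show "(\<lambda>(x, y). if x < y then (x, y) else (y, x)) ` ?I \<subseteq> ?K"
    proof (rule image_subsetI)
      fix z assume "z \<in> ?I"
      then obtain x y where z: "z = (x, y)" and H: "x < a" "y < a" "f x < f y" "f (?n y) < f (?n x)" by blast
      have "\<not> f y < f x" "\<not> f (?n x) < f (?n y)" using H by linarith+
      moreover have "x \<noteq> y" using H by blast
      ultimately show "(case z of (x, y) \<Rightarrow> if x < y then (x, y) else (y, x)) \<in> ?K"
        using H unfolding z by (cases "x < y") simp_all
    qed
    show "(\<lambda>(x, y). if f x < f y then (x, y) else (y, x)) ` ?K \<subseteq> ?I"
    proof (rule image_subsetI)
      fix z assume "z \<in> ?K"
      then obtain x y where z: "z = (x, y)" and H: "x < y" "y < a" "(f x < f y) \<noteq> (f (?n x) < f (?n y))"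
        by blast
      have "x < a" "x \<noteq> y" using H by simp_all
      note n = neq[OF this(1) H(2) this(2)] neq[OF nlt nlt nneq[OF this(1) H(2) this(2)]]
      show "(case z of (x, y) \<Rightarrow> if f x < f y then (x, y) else (y, x)) \<in> ?I"
        using H n \<open>x < a\<close> unfolding z by (cases "f x < f y") simp_all
    qed
    show "\<forall>z\<in>?I. (case (case z of (x, y) \<Rightarrow> if x < y then (x, y) else (y, x)) of
        (x, y) \<Rightarrow> if f x < f y then (x, y) else (y, x)) = z"
    proof
      fix z assume "z \<in> ?I"
      then obtain x y where z: "z = (x, y)" and H: "f x < f y" by blast
      have "\<not> f y < f x" using H by linarith
      with H show "(case (case z of (x, y) \<Rightarrow> if x < y then (x, y) else (y, x)) of
        (x, y) \<Rightarrow> if f x < f y then (x, y) else (y, x)) = z"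
        unfolding z by (cases "x < y") simp_all
    qed
    show "\<forall>z\<in>?K. (case (case z of (x, y) \<Rightarrow> if f x < f y then (x, y) else (y, x)) of
        (x, y) \<Rightarrow> if x < y then (x, y) else (y, x)) = z"
    proof
      fix z assume "z \<in> ?K"
      then obtain x y where z: "z = (x, y)" and H: "x < y" by blast
      have "\<not> y < x" using H by linarith
      with H show "(case (case z of (x, y) \<Rightarrow> if f x < f y then (x, y) else (y, x)) of
        (x, y) \<Rightarrow> if x < y then (x, y) else (y, x)) = z"
        unfolding z by (cases "f x < f y") simp_all
    qed
  qed
  then have "card ?I = card ?K" by (rule bij_betw_same_card)
  \<comment> \<open>The signs at a pair and at its shift multiply to -1 exactly for the pairs in K;
    hence the parity of K is a product over all pairs, which telescopes except for the index that
    wraps around.\<close>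
  define s :: "nat \<Rightarrow> nat \<Rightarrow> complex" where "s x y = (if f x < f y then 1 else -1)" for x y
  have K: "?K = ?P \<inter> {z. case z of (x, y) \<Rightarrow> (f x < f y) \<noteq> (f (?n x) < f (?n y))}"
    by (simp only: set_eq_iff Int_iff mem_Collect_eq split_paired_all case_prod_conv) simp
  have "(-1 :: complex) ^ card ?K =
      (\<Prod>z\<in>?P. if case z of (x, y) \<Rightarrow> (f x < f y) \<noteq> (f (?n x) < f (?n y)) then -1 else 1)"
    unfolding K prod.If_cases[OF finP] by simp
  also have "\<dots> = (\<Prod>z\<in>?P. (case z of (x, y) \<Rightarrow> s x y) * (case z of (x, y) \<Rightarrow> s (?n x) (?n y)))"
    by (intro prod.cong) (simp_all add: s_def split: prod.split)
  also have "\<dots> = (\<Prod>(x, y)\<in>?P. s x y) * (\<Prod>(x, y)\<in>?P. s (?n x) (?n y))"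
    by (rule prod.distrib)
  also have "(\<Prod>(x, y)\<in>?P. s (?n x) (?n y)) = (-1) ^ m * (\<Prod>(x, y)\<in>?P. s x y)"
  proof -
    \<comment> \<open>Pairs without the last index m are shifted to pairs without 0. A pair (x, m)
      goes to (Suc x, 0), which is in the wrong order; restoring the order costs one sign for each
      of the m = a - 1 such pairs.\<close>
    let ?A = "{(x, y). x < y \<and> y < m}" and ?B = "(\<lambda>x. (x, m)) ` {..<m}"
    let ?A' = "{(x, y). 0 < x \<and> x < y \<and> y < a}" and ?B' = "(\<lambda>x. (0, Suc x)) ` {..<m}"
    have 1: "z \<in> ?P \<longleftrightarrow> z \<in> ?A \<union> ?B" for z
      by (cases z) (auto simp: a image_iff)
    have 2: "z \<in> ?P \<longleftrightarrow> z \<in> ?A' \<union> ?B'" for z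
    proof -
      obtain x y where "z = (x, y)" by fastforce
      then show ?thesis by (cases x; cases y) (auto simp: a image_iff)
    qed
    note P = Set.set_eqI[of ?P "?A \<union> ?B", OF 1] Set.set_eqI[of ?P "?A' \<union> ?B'", OF 2]
    have fin: "finite ?A" "finite ?A'"
      unfolding a by (rule finite_subset[of _ "{..<Suc m} \<times> {..<Suc m}"]; auto)+
    have "(\<Prod>(x, y)\<in>?P. s (?n x) (?n y)) = (\<Prod>(x, y)\<in>?A. s (?n x) (?n y)) * (\<Prod>(x, y)\<in>?B. s (?n x) (?n y))"
      unfolding P(1) by (rule prod.union_disjoint) (use fin in auto)
    also have "(\<Prod>(x, y)\<in>?A. s (?n x) (?n y)) = (\<Prod>(x, y)\<in>?A'. s x y)"
      by (rule prod.reindex_bij_witness[of _ "\<lambda>(x, y). (x - 1, y - 1)" "\<lambda>(x, y). (Suc x, Suc y)"])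
         (auto simp: a)
    also have "(\<Prod>(x, y)\<in>?B. s (?n x) (?n y)) = (\<Prod>x<m. s (Suc x) 0)"
      by (subst prod.reindex) (auto simp: inj_on_def a intro!: prod.cong)
    also have "\<dots> = (\<Prod>x<m. - s 0 (Suc x))"
    proof (rule prod.cong)
      fix x assume "x \<in> {..<m}"
      then show "s (Suc x) 0 = - s 0 (Suc x)"
        using neq[of 0 "Suc x"] unfolding s_def a by (cases "f 0 < f (Suc x)") simp_all
    qed simp
    also have "\<dots> = (-1) ^ m * (\<Prod>x<m. s 0 (Suc x))"
      by (simp add: prod_uminus)
    also have "(\<Prod>x<m. s 0 (Suc x)) = (\<Prod>(x, y)\<in>?B'. s x y)"
      by (subst prod.reindex) (auto simp: inj_on_def)
    also have "(\<Prod>(x, y)\<in>?A'. s x y) * ((-1) ^ m * (\<Prod>(x, y)\<in>?B'. s x y))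
        = (-1) ^ m * ((\<Prod>(x, y)\<in>?A'. s x y) * (\<Prod>(x, y)\<in>?B'. s x y))" by simp
    also have "(\<Prod>(x, y)\<in>?A'. s x y) * (\<Prod>(x, y)\<in>?B'. s x y) = (\<Prod>(x, y)\<in>?P. s x y)"
      unfolding P(2) by (rule prod.union_disjoint[symmetric]) (use fin in auto)
    finally show ?thesis .
  qed
  also have "(\<Prod>(x, y)\<in>?P. s x y) * ((-1) ^ m * (\<Prod>(x, y)\<in>?P. s x y))
      = (-1) ^ m * (\<Prod>(x, y)\<in>?P. s x y * s x y)"
    by (simp add: prod.distrib case_prod_unfold)
  also have "(\<Prod>(x, y)\<in>?P. s x y * s x y) = 1"
    by (intro prod.neutral) (auto simp: s_def)
  finally show ?thesis using \<open>card ?I = card ?K\<close> by (simp add: a)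
qed

section \<open>The power operation at a transitive pair\<close>

lemma pair_type_orbit:
  assumes t: "pair_type n a b d \<sigma> \<rho>" and n: "n \<ge> 1" and i: "i \<in> {1..n}"
  shows "orbit \<sigma> i = (\<lambda>s. (\<sigma> ^^ s) i) ` {..<d}" "card (orbit \<sigma> i) = d"
proof -
  have h: "(a, b, d) \<in> hecke_index n" and iff: "\<And>s s'. (\<sigma> ^^ s) i = (\<sigma> ^^ s') i \<longleftrightarrow> (int s - int s', 0) \<in> hecke_lattice a b d"
    using t i unfolding pair_type_def by (auto, (metis diff_self funpow_0)+)
  note p = hecke_index_pos[OF h n]
  have iff: "(\<sigma> ^^ s) i = (\<sigma> ^^ s') i \<longleftrightarrow> int d dvd int s - int s'" for s s'
    by (simp add: iff mem_hecke_lattice[OF p(1)])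
  have "(\<sigma> ^^ d) i = i" using iff[of d 0] by simp
  from orbit_altdef_bounded[OF this p(2)] show "orbit \<sigma> i = (\<lambda>s. (\<sigma> ^^ s) i) ` {..<d}" by auto
  moreover have "inj_on (\<lambda>s. (\<sigma> ^^ s) i) {..<d}"
    by (auto simp: inj_on_def iff mod_eq_dvd_iff[symmetric] simp flip: zmod_int)
  ultimately show "card (orbit \<sigma> i) = d" by (simp add: card_image)
qed

section \<open>The \<sigma>-cycles of a pair of given type, as permuted by \<rho>\<close>

context
  fixes n a b d :: nat and \<sigma> \<rho> :: "nat \<Rightarrow> nat" and cyc :: "nat \<Rightarrow> nat set" and i0 :: nat
  assumes t: "pair_type n a b d \<sigma> \<rho>" and n: "n \<ge> 1" and i0: "i0 \<in> {1..n}"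
  defines "cyc \<equiv> (\<lambda>t. orbit \<sigma> ((\<rho> ^^ t) i0))"
begin

private lemma perms: "\<sigma> permutes {1..n}" "\<rho> permutes {1..n}" and comm: "\<sigma> \<circ> \<rho> = \<rho> \<circ> \<sigma>"
  and idx: "(a, b, d) \<in> hecke_index n"
  using t by (simp_all only: pair_type_def)

private lemmas ad = hecke_index_pos[OF idx n]

private lemma base_in: "(\<rho> ^^ x) i0 \<in> {1..n}"
  by (simp only: permutes_funpow_in[OF perms(2)] i0)

private lemma mem_cyc: "i \<in> cyc x \<longleftrightarrow> (\<exists>s. i = (\<sigma> ^^ s) ((\<rho> ^^ x) i0))"
proof -
  have "permutation \<sigma>" by (rule permutes_imp_permutation[OF _ perms(1)]) simp
  from orbit_altdef_permutation[OF this] show ?thesis by (auto simp: cyc_def)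
qed

lemma cyc_subset: "cyc x \<subseteq> {1..n}"
proof
  fix i assume "i \<in> cyc x"
  then obtain s where "i = (\<sigma> ^^ s) ((\<rho> ^^ x) i0)" unfolding mem_cyc by blast
  then show "i \<in> {1..n}" by (simp only: permutes_funpow_in[OF perms(1)] base_in)
qed

lemma finite_cyc: "finite (cyc x)"
  using cyc_subset finite_subset by blast

lemma card_cyc: "card (cyc x) = d"
  unfolding cyc_def by (rule pair_type_orbit(2)[OF t n base_in])

lemma cyc_nonempty: "cyc x \<noteq> {}"
  using mem_cyc[of _ x] by blast

lemma Min_cyc: "Min (cyc x) \<in> cyc x"
  using finite_cyc cyc_nonempty by simp

private lemma pair_iff: "(\<sigma> ^^ s) ((\<rho> ^^ x) i0) = (\<sigma> ^^ s') ((\<rho> ^^ x') i0) \<longleftrightarrow>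
   int a dvd int x - int x' \<and> int d dvd int s - int s' + int b * ((int x - int x') div int a)"
  by (simp only: pair_type_iff[OF t i0] mem_hecke_lattice[OF ad(1)])

lemma cyc_disjoint:
  assumes "x < a" "x' < a" "i \<in> cyc x" "i \<in> cyc x'" shows "x = x'"
proof -
  have "int a dvd int x - int x'" using assms(3,4) by (metis mem_cyc pair_iff)
  then show ?thesis using assms(1,2) by (simp add: mod_eq_dvd_iff[symmetric] flip: zmod_int)
qed

lemma inj_on_cyc: "inj_on cyc {..<a}"
proof (rule inj_onI)
  fix x y assume H: "x \<in> {..<a}" "y \<in> {..<a}" "cyc x = cyc y"
  have "Min (cyc x) \<in> cyc y" unfolding H(3) by (rule Min_cyc)
  from cyc_disjoint[OF _ _ Min_cyc this] H(1,2) show "x = y" by simp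
qed

private lemma cyc_range: "cyc x = range (\<lambda>s. (\<sigma> ^^ s) ((\<rho> ^^ x) i0))"
  unfolding Set.set_eq_iff mem_cyc by (simp add: image_iff)

lemma cyc_image: "\<rho> ` cyc x = cyc (Suc x)"
proof -
  have eq: "\<rho> ((\<sigma> ^^ s) ((\<rho> ^^ x) i0)) = (\<sigma> ^^ s) ((\<rho> ^^ Suc x) i0)" for s
    using funpow_commute_apply[OF comm, of s 1] by simp
  show ?thesis unfolding cyc_range by (simp only: image_image eq)
qed

text \<open>After a steps \<rho> agrees with \<open>\<sigma> ^^ b\<close>, so it returns to the
  first cycle, though in general not to the same point of it.\<close>

lemma cyc_period: "cyc a = cyc 0"
proof -
  have A: "(\<sigma> ^^ s) ((\<rho> ^^ a) i0) = (\<sigma> ^^ (s + b)) ((\<rho> ^^ 0) i0)" for s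
    unfolding pair_iff using ad by simp
  have 1: "cyc a \<subseteq> cyc 0" unfolding cyc_range A by (rule image_subsetI) (rule rangeI)
  \<comment> \<open>The exponent d - b plays the role of -b, exponents being natural
    numbers.\<close>
  have B: "(\<sigma> ^^ s) ((\<rho> ^^ 0) i0) = (\<sigma> ^^ (s + (d - b))) ((\<rho> ^^ a) i0)" for s
    unfolding pair_iff using ad by (simp add: of_nat_diff dvd_neg_div)
  have 2: "cyc 0 \<subseteq> cyc a" unfolding cyc_range B by (rule image_subsetI) (rule rangeI)
  from 1 2 show ?thesis by (rule equalityI)
qed

lemma cyc_Suc_mod: "x < a \<Longrightarrow> cyc (Suc x) = cyc (Suc x mod a)"
  using cyc_period by (cases "Suc x = a") auto

private lemma orbit_cyc: "i \<in> cyc x \<Longrightarrow> orbit \<sigma> i = cyc x"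
proof -
  have "permutation \<sigma>" by (rule permutes_imp_permutation[OF _ perms(1)]) simp
  from orbit_cyclic_eq3[OF cyclic_on_orbit'[OF this]] show "i \<in> cyc x \<Longrightarrow> orbit \<sigma> i = cyc x"
    unfolding cyc_def .
qed

lemma cycles_eq: "cycles n \<sigma> = cyc ` {..<a}"
proof (intro equalityI subsetI)
  fix c assume "c \<in> cycles n \<sigma>"
  then obtain i where c: "c = orbit \<sigma> i" "i \<in> {1..n}" by (auto simp: cycles_def)
  obtain s x where sx: "s < d" "x < a" "i = (\<sigma> ^^ s) ((\<rho> ^^ x) i0)"
    by (rule pair_type_reach[OF t n i0 c(2)])
  then have "i \<in> cyc x" unfolding mem_cyc by blast
  then have "orbit \<sigma> i = cyc x" by (rule orbit_cyc)
  with c sx show "c \<in> cyc ` {..<a}" by auto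
next
  fix c assume "c \<in> cyc ` {..<a}"
  then show "c \<in> cycles n \<sigma>" using base_in by (auto simp: cycles_def cyc_def)
qed

lemma rotation_cyc: "\<rho> (Min (cyc x)) = (\<sigma> ^^ rotation \<sigma> \<rho> (cyc x)) (Min (cyc (Suc x)))"
proof -
  have "\<rho> (Min (cyc x)) \<in> cyc (Suc x)" unfolding cyc_image[symmetric] by (rule imageI[OF Min_cyc])
  also have "cyc (Suc x) = orbit \<sigma> (Min (cyc (Suc x)))"
    by (rule orbit_cyc[OF Min_cyc, symmetric])
  finally have "\<exists>r. \<rho> (Min (cyc x)) = (\<sigma> ^^ r) (Min (cyc (Suc x)))"
    by (auto simp: orbit_altdef)
  then show ?thesis unfolding rotation_def cyc_image by (rule LeastI_ex)
qed

text \<open>Following the base point of the first cycle once around, the rotations accumulate to a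
  power of \<sigma> that has to agree with \<open>\<rho> ^^ a\<close>, that is, with
  \<open>\<sigma> ^^ b\<close>. On a cycle of length d this fixes the sum only modulo d.\<close>

lemma sum_rotation:
  "(\<Sum>x<a. rotation \<sigma> \<rho> (cyc x)) mod d = b"
proof -
  have *: "(\<rho> ^^ m) (Min (cyc 0)) = (\<sigma> ^^ (\<Sum>x<m. rotation \<sigma> \<rho> (cyc x))) (Min (cyc m))" for m
  proof (induction m)
    case (Suc m)
    let ?r = "\<Sum>x<m. rotation \<sigma> \<rho> (cyc x)"
    have "(\<rho> ^^ Suc m) (Min (cyc 0)) = \<rho> ((\<sigma> ^^ ?r) (Min (cyc m)))"
      using Suc by simp
    also have "\<dots> = (\<sigma> ^^ ?r) (\<rho> (Min (cyc m)))"
      using funpow_commute_apply[OF comm, of ?r 1] by simp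
    finally show ?case by (simp add: rotation_cyc[of m] funpow_add)
  qed simp
  let ?r = "\<Sum>x<a. rotation \<sigma> \<rho> (cyc x)"
  have M: "Min (cyc 0) \<in> {1..n}" using Min_cyc[of 0] cyc_subset[of 0] by (rule rev_subsetD)
  have "(\<sigma> ^^ 0) ((\<rho> ^^ a) (Min (cyc 0))) = (\<sigma> ^^ ?r) ((\<rho> ^^ 0) (Min (cyc 0)))"
    using *[of a] unfolding cyc_period by simp
  then have "(int 0 - int ?r, int a - int 0) \<in> hecke_lattice a b d"
    unfolding pair_type_iff[OF t M] .
  then have "int d dvd int b - int ?r" using ad by (simp add: mem_hecke_lattice)
  then have "int b mod int d = int ?r mod int d" by (simp add: mod_eq_dvd_iff)
  then have "b mod d = ?r mod d" by (simp only: flip: zmod_int of_nat_eq_iff[where 'a=int])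
  then show ?thesis using ad by simp
qed

text \<open>With all factors odd this is the sign of a cyclic permutation of a letters; the order of
  the base points is an arbitrary injective numbering and does not influence it.\<close>

lemma koszul_sign_odd:
  assumes "odd_cycles n \<sigma> v = cycles n \<sigma>"
  shows "koszul_sign n \<sigma> \<rho> v = (-1) ^ (a - 1)"
proof -
  let ?f = "\<lambda>x. Min (cyc x)"
  have inj: "inj_on ?f {..<a}"
  proof (rule inj_onI)
    fix x y assume H: "x \<in> {..<a}" "y \<in> {..<a}" "?f x = ?f y"
    have "?f x \<in> cyc y" unfolding H(3) by (rule Min_cyc)
    from cyc_disjoint[OF _ _ Min_cyc this] H(1,2) show "x = y" by simp
  qed
  let ?I = "{(x, y). x < a \<and> y < a \<and> ?f x < ?f y \<and> ?f (Suc y mod a) < ?f (Suc x mod a)}"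
  let ?J = "{(c, c'). c \<in> cycles n \<sigma> \<and> c' \<in> cycles n \<sigma> \<and> Min c < Min c' \<and> Min (\<rho> ` c') < Min (\<rho> ` c)}"
  have next_cyc: "Min (\<rho> ` cyc x) = ?f (Suc x mod a)" if "x < a" for x
    by (simp only: cyc_image cyc_Suc_mod[OF that])
  have "?J = (\<lambda>(x, y). (cyc x, cyc y)) ` ?I"
  proof (intro equalityI subsetI)
    fix z assume "z \<in> ?J"
    then obtain x y where xy: "x < a" "y < a" "z = (cyc x, cyc y)" "?f x < ?f y"
      "Min (\<rho> ` cyc y) < Min (\<rho> ` cyc x)" unfolding cycles_eq by blast
    then have "(x, y) \<in> ?I" by (simp add: next_cyc)
    then show "z \<in> (\<lambda>(x, y). (cyc x, cyc y)) ` ?I" by (rule rev_image_eqI) (simp add: xy)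
  next
    fix z assume "z \<in> (\<lambda>(x, y). (cyc x, cyc y)) ` ?I"
    then obtain p where p: "z = (case p of (x, y) \<Rightarrow> (cyc x, cyc y))" "p \<in> ?I" by (rule imageE)
    obtain x y where "p = (x, y)" by (rule prod.exhaust)
    with p show "z \<in> ?J" by (simp add: cycles_eq next_cyc)
  qed
  moreover have "inj_on (\<lambda>(x, y). (cyc x, cyc y)) ?I"
    using inj_on_cyc by (auto simp: inj_on_def)
  ultimately have "card ?J = card ?I" by (simp add: card_image)
  then show ?thesis
    using cyclic_shift_inversions[OF inj ad(1)] unfolding koszul_sign_def assms by simp
qed

lemma card_cycles: "card (cycles n \<sigma>) = a"
  by (simp add: cycles_eq card_image inj_on_cyc)

end

section \<open>Graded models, operators around a cycle, and finiteness of coefficients\<close>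

lemma is_rep_one:
  assumes "is_rep G H V" shows "V \<one>\<^bsub>G\<^esub> = 1\<^sub>m (rep_dim G V)"
  using assms by (simp add: is_rep_def)

lemma is_rep_mult:
  assumes "is_rep G H V" "x \<in> H" "y \<in> H" shows "V (x \<otimes>\<^bsub>G\<^esub> y) = V x * V y"
  using assms by (simp add: is_rep_def)

text \<open>The domain condition provides representatives with the right action of g, but for very
  negative j they may be pairs of positive dimension that cancel. There the coefficient is zero and
  the zero pair is used instead, which makes the dimensions vanish.\<close>

lemma graded_model_exists:
  assumes K: "devoto_tate_K G f" and P: "power_domain G f"
  shows "graded_model G f (SOME R. graded_model G f R)"
proof -
  have z: "rep_dim G zero_rep = 0" "acts_as_scalar G g z zero_rep" for g z
    by (auto simp: rep_dim_def zero_rep_def acts_as_scalar_def)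
  have zc: "(zero_rep, zero_rep) \<in> virtual_class G H zero_rep" for H
  proof -
    have "is_rep G H zero_rep" by (auto simp: is_rep_def rep_dim_def zero_rep_def)
    moreover have "rep_iso G H (rep_sum G zero_rep zero_rep) (rep_sum G zero_rep zero_rep)"
    proof -
      let ?S = "rep_sum G zero_rep zero_rep"
      have S: "?S x \<in> carrier_mat 0 0" for x by (auto simp: rep_sum_def rep_dim_def zero_rep_def)
      have "invertible_mat (1\<^sub>m 0 :: complex mat)"
        by (auto simp: invertible_mat_def inverts_mat_def intro: exI[of _ "1\<^sub>m 0"])
      moreover have "1\<^sub>m 0 * ?S x = ?S x * 1\<^sub>m 0" for x
        using S[of x] by simp
      ultimately show ?thesis
        unfolding rep_iso_def by (auto simp: rep_dim_sum z intro!: bexI[of _ "1\<^sub>m 0"])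
    qed
    ultimately show ?thesis by (simp add: virtual_class_def virtual_equiv_def virtual_reps_def)
  qed
  let ?ok = "\<lambda>g j p. p \<in> f g j \<and> acts_as_scalar G g (rotation_scalar G g j) (fst p) \<and>
      acts_as_scalar G g (rotation_scalar G g j) (snd p)"
  have "\<exists>S. (\<forall>j. ?ok g j (S j)) \<and>
      (\<exists>N. \<forall>j<N. rep_dim G (fst (S j)) = 0 \<and> rep_dim G (snd (S j)) = 0)"
    if g: "g \<in> carrier G" for g
  proof -
    have "\<forall>j. \<exists>p. ?ok g j p"
      using P g unfolding power_domain_def by fastforce
    then obtain S where S: "\<And>j. ?ok g j (S j)" by metis
    obtain N where N: "\<And>j. j < N \<Longrightarrow> f g j = virtual_class G (elem_centralizer G g) zero_rep"
      using K g unfolding devoto_tate_K_def by blast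
    \<comment> \<open>On the zero-dimensional representation every scalar condition holds.\<close>
    have "?ok g j (if j < N then (zero_rep, zero_rep) else S j)" for j
      using S[of j] N[of j] zc z by auto
    moreover have "\<forall>j<N. rep_dim G (fst (if j < N then (zero_rep, zero_rep) else S j)) = 0 \<and>
        rep_dim G (snd (if j < N then (zero_rep, zero_rep) else S j)) = 0"
      using z by simp
    ultimately show ?thesis by (intro exI[of _ "\<lambda>j. if j < N then (zero_rep, zero_rep) else S j"]) blast
  qed
  then obtain R where "\<And>g. g \<in> carrier G \<Longrightarrow> (\<forall>j. ?ok g j (R g j)) \<and>
      (\<exists>N. \<forall>j<N. rep_dim G (fst (R g j)) = 0 \<and> rep_dim G (snd (R g j)) = 0)"
    by metis
  then have "graded_model G f R" by (auto simp: graded_model_def)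
  then show ?thesis by (rule someI[of "graded_model G f"])
qed

text \<open>Since h and k commute, the factors met along the cycle can be collected: every step
  contributes one h, and the rotations add up in the exponents of both z and k. It is applied with k
  the inverse of g.\<close>

lemma mat_prod_rep:
  fixes G :: "'g monoid" (structure)
  assumes "group G" and V: "is_rep G H V" and H: "subgroup H G"
    and h: "h \<in> H" "k \<in> H" "h \<otimes> k = k \<otimes> h" and D: "D = rep_dim G V"
  shows "mat_prod D (\<lambda>t. z ^ r t \<cdot>\<^sub>m V (h \<otimes> k [^] (r t :: nat))) m
    = z ^ (\<Sum>t<m. r t) \<cdot>\<^sub>m V (h [^] m \<otimes> k [^] (\<Sum>t<m. r t))"
proof (induction m)
  interpret group G by fact
  case 0
  show ?case using is_rep_one[OF V] by (auto simp: D intro!: eq_matI)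
next
  case (Suc m)
  interpret group G by fact
  let ?s = "\<Sum>t<m. r t"
  interpret subgroup H G by (rule H)
  have pow: "x [^] (i :: nat) \<in> H" if "x \<in> H" for x i
    using that by (induction i) auto
  have c: "V x \<in> carrier_mat D D" if "x \<in> H" for x
    using is_rep_carrier[OF V that] D by simp
  have car: "h \<in> carrier G" "k \<in> carrier G" using h by (simp_all add: mem_carrier)
  have "k [^] r m \<otimes> h [^] m = h [^] m \<otimes> k [^] r m"
    by (rule group_commutes_pow[OF group_commutes_pow[OF h(3) car, symmetric] car(2)]) (use car in simp)
  then have "h \<otimes> (k [^] r m \<otimes> h [^] m) \<otimes> k [^] ?s = h \<otimes> (h [^] m \<otimes> k [^] r m) \<otimes> k [^] ?s"
    by simp
  then have "h \<otimes> k [^] r m \<otimes> (h [^] m \<otimes> k [^] ?s) = (h \<otimes> h [^] m) \<otimes> (k [^] r m \<otimes> k [^] ?s)"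
    using car by (simp add: m_assoc)
  also have "\<dots> = h [^] Suc m \<otimes> k [^] (r m + ?s)"
    unfolding nat_pow_Suc2[OF car(1)] nat_pow_mult[OF car(2)] ..
  finally have e: "h \<otimes> k [^] r m \<otimes> (h [^] m \<otimes> k [^] ?s) = h [^] Suc m \<otimes> k [^] (r m + ?s)" .
  have "mat_prod D (\<lambda>t. z ^ r t \<cdot>\<^sub>m V (h \<otimes> k [^] r t)) (Suc m)
      = (z ^ r m \<cdot>\<^sub>m V (h \<otimes> k [^] r m)) * (z ^ ?s \<cdot>\<^sub>m V (h [^] m \<otimes> k [^] ?s))"
    using Suc by simp
  also have "\<dots> = (z ^ r m * z ^ ?s) \<cdot>\<^sub>m (V (h \<otimes> k [^] r m) * V (h [^] m \<otimes> k [^] ?s))"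
  proof -
    have c': "V (h \<otimes> k [^] r m) \<in> carrier_mat D D" "V (h [^] m \<otimes> k [^] ?s) \<in> carrier_mat D D"
      using h pow by (auto intro!: c)
    show ?thesis
      unfolding mult_smult_distrib[OF smult_carrier_mat[OF c'(1)] c'(2)] mult_smult_assoc_mat[OF c']
      by (intro eq_matI) (simp_all add: mult_ac)
  qed
  also have "V (h \<otimes> k [^] r m) * V (h [^] m \<otimes> k [^] ?s) = V (h [^] Suc m \<otimes> k [^] (r m + ?s))"
    using h pow by (subst is_rep_mult[OF V, symmetric]) (auto simp: e)
  finally show ?case by (simp add: power_add add.commute)
qed

lemma subgroup_elem_centralizer:
  assumes "group G" "x \<in> carrier G" shows "subgroup (elem_centralizer G x) G"
proof -
  interpret group G by fact
  show ?thesis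
  proof (rule subgroupI)
    show "elem_centralizer G x \<subseteq> carrier G" by (auto simp: elem_centralizer_def)
    show "elem_centralizer G x \<noteq> {}" using assms(2) by (auto simp: elem_centralizer_def)
    fix y assume y: "y \<in> elem_centralizer G x"
    then have "inv\<^bsub>G\<^esub> y \<otimes>\<^bsub>G\<^esub> x = x \<otimes>\<^bsub>G\<^esub> inv\<^bsub>G\<^esub> y"
    proof -
      have c: "y \<in> carrier G" "x \<otimes>\<^bsub>G\<^esub> y = y \<otimes>\<^bsub>G\<^esub> x" using y by (simp_all add: elem_centralizer_def)
      have "inv\<^bsub>G\<^esub> y \<otimes>\<^bsub>G\<^esub> x \<otimes>\<^bsub>G\<^esub> y = inv\<^bsub>G\<^esub> y \<otimes>\<^bsub>G\<^esub> (y \<otimes>\<^bsub>G\<^esub> x)"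
        using c assms(2) by (simp add: m_assoc)
      also have "\<dots> = x" using c(1) assms(2) by (simp add: m_assoc[symmetric])
      finally show ?thesis using c(1) assms(2) by (simp add: inv_solve_right)
    qed
    then show "inv\<^bsub>G\<^esub> y \<in> elem_centralizer G x" using y by (simp add: elem_centralizer_def)
    fix z assume z: "z \<in> elem_centralizer G x"
    have c: "y \<in> carrier G" "z \<in> carrier G" "y \<otimes>\<^bsub>G\<^esub> x = x \<otimes>\<^bsub>G\<^esub> y" "z \<otimes>\<^bsub>G\<^esub> x = x \<otimes>\<^bsub>G\<^esub> z"
      using y z by (simp_all add: elem_centralizer_def)
    have "y \<otimes>\<^bsub>G\<^esub> z \<otimes>\<^bsub>G\<^esub> x = y \<otimes>\<^bsub>G\<^esub> (x \<otimes>\<^bsub>G\<^esub> z)"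
      using c(1,2) assms(2) by (simp add: m_assoc c(4))
    also have "\<dots> = x \<otimes>\<^bsub>G\<^esub> (y \<otimes>\<^bsub>G\<^esub> z)"
      using c(1,2) assms(2) by (simp add: m_assoc[symmetric] c(3))
    finally show "y \<otimes>\<^bsub>G\<^esub> z \<in> elem_centralizer G x" using c by (simp add: elem_centralizer_def)
  qed
qed

text \<open>Meant for c = g^d, whose action is scalar on each coefficient: powers of g^d can be
  traded for numbers.\<close>

lemma rep_scalar_power:
  assumes "group G" and V: "is_rep G H V" and H: "subgroup H G"
    and "u \<in> H" "c \<in> H" and scal: "V c = w \<cdot>\<^sub>m 1\<^sub>m (rep_dim G V)"
  shows "V (u \<otimes>\<^bsub>G\<^esub> c [^]\<^bsub>G\<^esub> (k :: nat)) = w ^ k \<cdot>\<^sub>m V u"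
proof -
  interpret group G by fact
  interpret subgroup H G by fact
  have car: "u \<in> carrier G" "c \<in> carrier G" using assms by (simp_all add: mem_carrier)
  have pow: "c [^]\<^bsub>G\<^esub> (k :: nat) \<in> H" for k
    using assms(5) by (induction k) auto
  have Vc: "V x \<in> carrier_mat (rep_dim G V) (rep_dim G V)" if "x \<in> H" for x
    by (rule is_rep_carrier[OF V that])
  show ?thesis
  proof (induction k)
    case 0
    show ?case using car by (auto intro!: eq_matI)
  next
    case (Suc k)
    have in_H: "u \<otimes>\<^bsub>G\<^esub> c [^]\<^bsub>G\<^esub> k \<in> H" using assms(4) pow by simp
    have "V (u \<otimes>\<^bsub>G\<^esub> c [^]\<^bsub>G\<^esub> Suc k) = V ((u \<otimes>\<^bsub>G\<^esub> c [^]\<^bsub>G\<^esub> k) \<otimes>\<^bsub>G\<^esub> c)"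
      using car by (simp add: m_assoc)
    also have "\<dots> = (w ^ k \<cdot>\<^sub>m V u) * (w \<cdot>\<^sub>m 1\<^sub>m (rep_dim G V))"
      unfolding is_rep_mult[OF V in_H assms(5)] Suc scal ..
    also have "\<dots> = w \<cdot>\<^sub>m ((w ^ k \<cdot>\<^sub>m V u) * 1\<^sub>m (rep_dim G V))"
      by (rule mult_smult_distrib[of _ "rep_dim G V" "rep_dim G V" _ "rep_dim G V"])
         (use Vc[OF assms(4)] in simp_all)
    also have "(w ^ k \<cdot>\<^sub>m V u) * 1\<^sub>m (rep_dim G V) = w ^ k \<cdot>\<^sub>m V u"
      by (rule right_mult_one_mat[of _ "rep_dim G V"]) (use Vc[OF assms(4)] in simp)
    also have "w \<cdot>\<^sub>m (w ^ k \<cdot>\<^sub>m V u) = w ^ Suc k \<cdot>\<^sub>m V u"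
      by (intro eq_matI) simp_all
    finally show ?case .
  qed
qed

text \<open>Degrees that are bounded below and have a prescribed sum are also bounded above, so only
  finitely many degrees, each with a finite basis, can occur on each factor.\<close>

lemma finite_tensor_degree:
  fixes D :: "bool \<Rightarrow> int \<Rightarrow> nat" and x K :: rat
  assumes C: "finite C" and K: "K > 0" and N: "\<And>j \<epsilon>. j < N \<Longrightarrow> D \<epsilon> j = 0"
  shows "finite {v \<in> PiE C (\<lambda>_. {(j, \<epsilon>, i). i < D \<epsilon> j}). (\<Sum>c\<in>C. of_int (fst (v c)) / K) = x}"
proof (rule finite_subset)
  \<comment> \<open>The largest degree a factor can have: the total degree \<open>x * K\<close>
    minus the least possible degree N for each of the other factors.\<close>
  define M where "M = \<lfloor>x * K\<rfloor> - int (card C - 1) * N"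
  let ?B = "(\<Union>j\<in>{N..M}. \<Union>\<epsilon>. (\<lambda>i. (j, \<epsilon>, i)) ` {..<D \<epsilon> j})"
  show "finite (PiE C (\<lambda>_. ?B))" using C by (intro finite_PiE) auto
  show "{v \<in> PiE C (\<lambda>_. {(j, \<epsilon>, i). i < D \<epsilon> j}). (\<Sum>c\<in>C. of_int (fst (v c)) / K) = x} \<subseteq> PiE C (\<lambda>_. ?B)"
  proof
    fix v assume "v \<in> {v \<in> PiE C (\<lambda>_. {(j, \<epsilon>, i). i < D \<epsilon> j}). (\<Sum>c\<in>C. of_int (fst (v c)) / K) = x}"
    then have v: "v \<in> PiE C (\<lambda>_. {(j, \<epsilon>, i). i < D \<epsilon> j})" and s: "(\<Sum>c\<in>C. of_int (fst (v c)) / K) = x"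
      by simp_all
    have "of_int (\<Sum>c\<in>C. fst (v c)) = x * K"
      using s K by (simp add: sum_divide_distrib[symmetric] field_simps)
    then have sum: "(\<Sum>c\<in>C. fst (v c)) = \<lfloor>x * K\<rfloor>" by (metis floor_of_int)
    have ge: "N \<le> fst (v c)" if "c \<in> C" for c
    proof (rule ccontr)
      assume "\<not> N \<le> fst (v c)"
      then have "D \<epsilon> (fst (v c)) = 0" for \<epsilon> using N by simp
      then show False using PiE_mem[OF v that] by (auto split: prod.splits)
    qed
    have "v c \<in> ?B" if c: "c \<in> C" for c
    proof -
      obtain j \<epsilon> i where vc: "v c = (j, \<epsilon>, i)" by (metis prod_cases3)
      have "int (card (C - {c})) * N \<le> (\<Sum>c\<in>C - {c}. fst (v c))"
        using sum_bounded_below[of "C - {c}" N "\<lambda>c. fst (v c)"] ge by simp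
      moreover have "(\<Sum>c\<in>C. fst (v c)) = fst (v c) + (\<Sum>c\<in>C - {c}. fst (v c))"
        by (rule sum.remove[OF C c])
      ultimately have "fst (v c) \<le> M" using sum c C by (simp add: M_def)
      then have "j \<in> {N..M}" using ge[OF c] vc by simp
      moreover have "i < D \<epsilon> j" using PiE_mem[OF v c] by (simp add: vc)
      ultimately show ?thesis unfolding vc by blast
    qed
    then show "v \<in> PiE C (\<lambda>_. ?B)" using v by (intro PiE_I) (auto simp: PiE_def extensional_def)
  qed
qed

text \<open>The cycles form a single \<rho>-orbit, so only basis vectors with one common degree j
  and one common parity contribute to the trace. Their exponent is aj/(dN) with N the order of g^d,
  and they contribute a trace at h^a g^(-b) times the b-th power of e^(2 pi i j/(dN)); these are the
  exponent and the phase produced by \<open>q_subst\<close>.\<close>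

lemma power_operation_transitive:
  fixes G :: "'g monoid"
  assumes G: "group G" and fin: "finite (carrier G)"
    and K: "devoto_tate_K G f" and P: "power_domain G f" and gh: "(g, h) \<in> commuting_pairs G"
    and n: "n \<ge> 1" and t: "pair_type n a b d \<sigma> \<rho>"
  shows "power_operation G n f \<sigma> \<rho> g h x =
    q_subst a b d (tate_series G f (g [^]\<^bsub>G\<^esub> d) (g [^]\<^bsub>G\<^esub> (- int b) \<otimes>\<^bsub>G\<^esub> h [^]\<^bsub>G\<^esub> a)) x"
proof -
  interpret group G by (rule G)
  have g: "g \<in> carrier G" and h: "h \<in> carrier G" and comm: "g \<otimes>\<^bsub>G\<^esub> h = h \<otimes>\<^bsub>G\<^esub> g"
    using gh by (simp_all add: commuting_pairs_def)
  have "(a, b, d) \<in> hecke_index n" using t by (simp only: pair_type_def)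
  note ad = hecke_index_pos[OF this n]
  have one: "1 \<in> {1..n}" using n by simp
  define R where "R = (SOME R. graded_model G f R)"
  have R: "graded_model G f R" unfolding R_def by (rule graded_model_exists[OF K P])
  define gd where "gd = g [^]\<^bsub>G\<^esub> d"
  have gd: "gd \<in> carrier G" using g by (simp add: gd_def)
  define H where "H = elem_centralizer G gd"
  have H: "subgroup H G" unfolding H_def by (rule subgroup_elem_centralizer[OF G gd])
  define N where "N = group.ord G gd"
  have N: "N > 0" unfolding N_def using ord_ge_1[OF fin gd] by simp
  have gH: "g \<in> H" and hH: "h \<in> H"
  proof -
    have "gd \<otimes>\<^bsub>G\<^esub> g = g \<otimes>\<^bsub>G\<^esub> gd" unfolding gd_def by (rule group_commutes_pow[OF refl g g])
    then show "g \<in> H" using g by (simp add: H_def elem_centralizer_def)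
    have "gd \<otimes>\<^bsub>G\<^esub> h = h \<otimes>\<^bsub>G\<^esub> gd" unfolding gd_def by (rule group_commutes_pow[OF comm g h])
    then show "h \<in> H" using h by (simp add: H_def elem_centralizer_def)
  qed
  have gdH: "gd \<in> H" using gd by (simp add: H_def elem_centralizer_def)
  interpret H: subgroup H G by (rule H)
  define k where "k = inv\<^bsub>G\<^esub> g"
  have kH: "k \<in> H" using gH by (simp add: k_def)
  have k: "k \<in> carrier G" using g by (simp add: k_def)
  have hk: "h \<otimes>\<^bsub>G\<^esub> k = k \<otimes>\<^bsub>G\<^esub> h"
  proof -
    have "k \<otimes>\<^bsub>G\<^esub> h \<otimes>\<^bsub>G\<^esub> g = k \<otimes>\<^bsub>G\<^esub> (g \<otimes>\<^bsub>G\<^esub> h)" using g h k by (simp add: m_assoc comm)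
    also have "\<dots> = h" using g h by (simp add: k_def m_assoc[symmetric])
    finally have "k \<otimes>\<^bsub>G\<^esub> h = h \<otimes>\<^bsub>G\<^esub> inv\<^bsub>G\<^esub> g" using g h k inv_solve_right[of "k \<otimes>\<^bsub>G\<^esub> h" h g] by simp
    then show ?thesis by (simp add: k_def)
  qed
  define y where "y = h [^]\<^bsub>G\<^esub> a \<otimes>\<^bsub>G\<^esub> k [^]\<^bsub>G\<^esub> b"
  have y_eq: "g [^]\<^bsub>G\<^esub> (- int b) \<otimes>\<^bsub>G\<^esub> h [^]\<^bsub>G\<^esub> a = y"
  proof -
    have "g [^]\<^bsub>G\<^esub> (- int b) = k [^]\<^bsub>G\<^esub> b"
      using g by (simp add: int_pow_neg_int nat_pow_inv k_def)
    moreover have "k [^]\<^bsub>G\<^esub> b \<otimes>\<^bsub>G\<^esub> h [^]\<^bsub>G\<^esub> a = h [^]\<^bsub>G\<^esub> a \<otimes>\<^bsub>G\<^esub> k [^]\<^bsub>G\<^esub> b"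
      by (rule group_commutes_pow[OF group_commutes_pow[OF hk h k, symmetric] k]) (use h in simp)
    ultimately show ?thesis by (simp add: y_def)
  qed
  have powH: "z [^]\<^bsub>G\<^esub> (i :: nat) \<in> H" if "z \<in> H" for z i
    using that by (induction i) simp_all
  have yH: "y \<in> H" using powH[OF hH] powH[OF kH] by (simp add: y_def)
  define V where "V \<epsilon> j = graded_part \<epsilon> (R gd j)" for \<epsilon> j
  define D where "D \<epsilon> j = rep_dim G (V \<epsilon> j)" for \<epsilon> j
  have Rj: "R gd j \<in> f gd j" "acts_as_scalar G gd (rotation_scalar G gd j) (V \<epsilon> j)" for j \<epsilon>
    using R gd by (auto simp: graded_model_def V_def graded_part_def)
  have fj: "f gd j \<in> rep_ring G H" for j using K gd by (simp add: devoto_tate_K_def H_def)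
  have Vrep: "is_rep G H (V \<epsilon> j)" for \<epsilon> j
    using rep_ring_mem_is_rep[OF fj[of j], of "fst (R gd j)" "snd (R gd j)"] Rj(1)[of j]
    by (simp add: V_def graded_part_def)
  define cyc where "cyc = (\<lambda>t. orbit \<sigma> ((\<rho> ^^ t) 1))"
  have cyc_eq: "orbit \<sigma> ((\<rho> ^^ u) 1) = cyc u" for u by (simp only: cyc_def)
  note cy = cycles_eq[OF t n one, unfolded cyc_eq] inj_on_cyc[OF t n one, unfolded cyc_eq]
    card_cyc[OF t n one, unfolded cyc_eq] cyc_image[OF t n one, unfolded cyc_eq]
    cyc_Suc_mod[OF t n one, unfolded cyc_eq] sum_rotation[OF t n one, unfolded cyc_eq]
    card_cycles[OF t n one]
  let ?C = "cycles n \<sigma>"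
  have finC: "finite ?C" by (simp add: cycles_def)
  define r where "r u = rotation \<sigma> \<rho> (cyc u)" for u
  define B where "B = {(j, \<epsilon>, i). i < D \<epsilon> j}"
  have cardC: "card c = d" if "c \<in> ?C" for c using that by (auto simp: cy(1,3))
  have basis: "tensor_basis G n R g \<sigma> = PiE ?C (\<lambda>_. B)"
    unfolding tensor_basis_def B_def D_def V_def gd_def by (rule PiE_cong) (simp add: cardC)
  have expo: "tensor_exponent G n g \<sigma> v = (\<Sum>c\<in>?C. of_int (fst (v c)) / of_nat (d * N))" for v
    unfolding tensor_exponent_def N_def gd_def by (rule sum.cong) (simp_all add: cardC)
  define X where "X = {v \<in> PiE ?C (\<lambda>_. B). (\<Sum>c\<in>?C. of_int (fst (v c)) / of_nat (d * N)) = x}"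
  have finX: "finite X"
  proof -
    obtain M where "\<And>j. j < M \<Longrightarrow> rep_dim G (fst (R gd j)) = 0 \<and> rep_dim G (snd (R gd j)) = 0"
      using R gd unfolding graded_model_def by blast
    then have "D \<epsilon> j = 0" if "j < M" for \<epsilon> j using that by (simp add: D_def V_def graded_part_def)
    from finite_tensor_degree[OF finC _ this, where K = "of_nat (d * N)" and x = x] show ?thesis
      using ad N by (simp add: X_def B_def)
  qed
  \<comment> \<open>The scalar part of the generator of Z/d on the coefficient j. Its d-th power is
    the scalar by which g^d acts.\<close>
  define z where "z j = cis (2 * pi * of_int j / of_nat (d * N))" for j
  define A where "A \<epsilon> j u = z j ^ r u \<cdot>\<^sub>m V \<epsilon> j (h \<otimes>\<^bsub>G\<^esub> k [^]\<^bsub>G\<^esub> r u)" for \<epsilon> j u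
  have act: "factor_action G R g \<sigma> h \<rho> (cyc u) j \<epsilon> = A \<epsilon> j u" for u j \<epsilon>
    unfolding factor_action_def Let_def cy(3) A_def z_def V_def r_def k_def N_def gd_def by (rule refl)
  define wt where "wt v = (\<Prod>u<a. let (j, \<epsilon>, i) = v (cyc u); (j', \<epsilon>', i') = v (cyc (Suc u mod a))
        in if j' = j \<and> \<epsilon>' = \<epsilon> then A \<epsilon> j u $$ (i', i) else 0)" for v
  \<comment> \<open>The sign in the graded trace times the sign of permuting odd factors.\<close>
  define sg where "sg v = (-1 :: complex) ^ card (odd_cycles n \<sigma> v) * koszul_sign n \<sigma> \<rho> v" for v
  have pm: "power_matrix G n R g \<sigma> h \<rho> v v = koszul_sign n \<sigma> \<rho> v * wt v" for v
  proof -
    have "(\<Prod>c\<in>?C. let (j, \<epsilon>, i) = v c; (j', \<epsilon>', i') = v (\<rho> ` c)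
        in if j' = j \<and> \<epsilon>' = \<epsilon> then index_mat (factor_action G R g \<sigma> h \<rho> c j \<epsilon>) (i', i) else 0) = wt v"
      unfolding cy(1) prod.reindex[OF cy(2)] wt_def comp_def
      by (rule prod.cong) (simp_all only: act cy(4) cy(5) lessThan_iff)
    then show ?thesis by (simp add: power_matrix_def)
  qed
  have lhs: "power_operation G n f \<sigma> \<rho> g h x = (\<Sum>v\<in>X. sg v * wt v)"
    unfolding power_operation_def Let_def R_def[symmetric] pm basis expo X_def[symmetric] sg_def
    by (simp only: mult.assoc)
  define e where "e = inv_into {..<a} cyc"
  have e: "e (cyc u) = u" if "u < a" for u
    using inv_into_f_f[OF cy(2)] that by (simp add: e_def)
  have eC: "e c < a" "cyc (e c) = c" if "c \<in> ?C" for c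
    using that e by (auto simp: cy(1))
  have cycC: "cyc u \<in> ?C" if "u < a" for u using that by (simp add: cy(1))
  \<comment> \<open>The basis vectors of common degree j and parity \<epsilon>; e numbers the cycles
    in the order in which \<rho> visits them, so that i becomes a closed path as in
    \<open>cyclic_trace\<close>.\<close>
  define w where "w \<epsilon> j i = (\<lambda>c\<in>?C. (j :: int, \<epsilon> :: bool, (i :: nat \<Rightarrow> nat) (e c)))" for \<epsilon> j i
  have w_cyc: "w \<epsilon> j i (cyc u) = (j, \<epsilon>, i u)" if "u < a" for \<epsilon> j i u
    using that by (simp add: w_def cycC e)
  define I where "I \<epsilon> j = ({..<a} \<rightarrow>\<^sub>E {..<D \<epsilon> j})" for \<epsilon> j
  have suc: "Suc u mod a < a" for u using ad by simp
  have wt_w: "wt (w \<epsilon> j i) = (\<Prod>u<a. A \<epsilon> j u $$ (i (Suc u mod a), i u))" for \<epsilon> j i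
    unfolding wt_def by (rule prod.cong) (simp_all add: w_cyc suc)
  \<comment> \<open>One vanishing factor kills the product, so nonzero weight forces degree and
    parity to agree on consecutive cycles, hence on all of them. The exponent is then a times that
    of a single factor.\<close>
  have wt_nz: "\<exists>\<epsilon> j. v \<in> w \<epsilon> j ` I \<epsilon> j \<and> of_nat a * of_int j / of_nat (d * N) = x"
    if v: "v \<in> X" and nz: "wt v \<noteq> 0" for v
  proof -
    have step: "fst (v (cyc (Suc u mod a))) = fst (v (cyc u)) \<and>
        fst (snd (v (cyc (Suc u mod a)))) = fst (snd (v (cyc u)))" if "u < a" for u
    proof (rule ccontr)
      assume "\<not> ?thesis"
      then have "(let (j, \<epsilon>, i) = v (cyc u); (j', \<epsilon>', i') = v (cyc (Suc u mod a))
        in if j' = j \<and> \<epsilon>' = \<epsilon> then A \<epsilon> j u $$ (i', i) else 0) = 0"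
        by (auto simp: Let_def split: prod.splits)
      then have "wt v = 0" unfolding wt_def using that by (intro prod_zero) auto
      with nz show False by simp
    qed
    define j where "j = fst (v (cyc 0))"
    define \<epsilon> where "\<epsilon> = fst (snd (v (cyc 0)))"
    have hom: "fst (v (cyc u)) = j \<and> fst (snd (v (cyc u))) = \<epsilon>" if "u < a" for u
      using that
    proof (induction u)
      case (Suc u)
      then show ?case using step[of u] by simp
    qed (simp add: j_def \<epsilon>_def)
    define i where "i = (\<lambda>u\<in>{..<a}. snd (snd (v (cyc u))))"
    have vP: "v \<in> PiE ?C (\<lambda>_. B)" and vx: "(\<Sum>c\<in>?C. of_int (fst (v c)) / of_nat (d * N)) = x"
      using v by (simp_all add: X_def)
    have vc: "v (cyc u) = (j, \<epsilon>, i u)" if "u < a" for u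
      using hom[OF that] that by (simp add: i_def prod_eq_iff)
    have "v c = w \<epsilon> j i c" for c
    proof (cases "c \<in> ?C")
      case True
      from vc[OF eC(1)[OF True]] w_cyc[OF eC(1)[OF True]] show ?thesis by (simp add: eC(2)[OF True])
    next
      case False
      then show ?thesis using PiE_arb[OF vP False] by (simp add: w_def)
    qed
    then have vw: "v = w \<epsilon> j i" by blast
    have iI: "i \<in> I \<epsilon> j"
      unfolding I_def
    proof (rule PiE_I)
      fix u assume "u \<in> {..<a}"
      then have u: "u < a" by simp
      from PiE_mem[OF vP cycC[OF u]] show "i u \<in> {..<D \<epsilon> j}" by (simp add: vc[OF u] B_def)
    qed (simp add: i_def)
    have "(\<Sum>c\<in>?C. of_int (fst (v c)) / of_nat (d * N)) = (\<Sum>c\<in>?C. of_int j / (of_nat (d * N) :: rat))"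
    proof (rule sum.cong)
      fix c assume "c \<in> ?C"
      then show "of_int (fst (v c)) / of_nat (d * N) = of_int j / (of_nat (d * N) :: rat)"
        using hom[OF eC(1)] by (simp add: eC(2))
    qed simp
    then have "of_nat a * of_int j / of_nat (d * N) = x"
      using vx by (simp add: cy(7))
    then show ?thesis using iI unfolding vw by (intro exI[of _ \<epsilon>] exI[of _ j] conjI imageI)
  qed
  have wX: "w \<epsilon> j ` I \<epsilon> j \<subseteq> X" if jx: "of_nat a * of_int j / of_nat (d * N) = x" for \<epsilon> j
  proof (rule image_subsetI)
    fix i assume i: "i \<in> I \<epsilon> j"
    have "w \<epsilon> j i \<in> PiE ?C (\<lambda>_. B)"
    proof (rule PiE_I)
      fix c assume c: "c \<in> ?C"
      have "i (e c) \<in> {..<D \<epsilon> j}" using PiE_mem[OF i[unfolded I_def]] eC(1)[OF c] by simp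
      then show "w \<epsilon> j i c \<in> B" using c by (simp add: w_def B_def)
    qed (simp add: w_def)
    moreover have "(\<Sum>c\<in>?C. of_int (fst (w \<epsilon> j i c)) / of_nat (d * N)) = x"
      using jx by (simp add: w_def cy(7))
    ultimately show "w \<epsilon> j i \<in> X" by (simp add: X_def)
  qed
  have w_inj: "inj_on (w \<epsilon> j) (I \<epsilon> j)" for \<epsilon> j
  proof (rule inj_onI)
    fix i i' assume i: "i \<in> I \<epsilon> j" "i' \<in> I \<epsilon> j" and eq: "w \<epsilon> j i = w \<epsilon> j i'"
    show "i = i'"
    proof (rule PiE_ext[OF i[unfolded I_def]])
      fix u assume "u \<in> {..<a}"
      then show "i u = i' u" using w_cyc[of u \<epsilon> j i] w_cyc[of u \<epsilon> j i'] eq by simp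
    qed
  qed
  define s where "s \<epsilon> = (if \<epsilon> then -1 else 1 :: complex)" for \<epsilon>
  \<comment> \<open>On the odd part (-1)^a and (-1)^(a-1) combine to -1 for every a; on the even
    part both signs are trivial.\<close>
  have sg_w: "sg (w \<epsilon> j i) = s \<epsilon>" for \<epsilon> j i
  proof (cases \<epsilon>)
    case True
    then have odd: "odd_cycles n \<sigma> (w \<epsilon> j i) = ?C" by (auto simp: odd_cycles_def w_def)
    have "sg (w \<epsilon> j i) = (-1) ^ a * (-1) ^ (a - 1)"
      unfolding sg_def koszul_sign_odd[OF t n one odd] odd cy(7) ..
    also have "\<dots> = -1" using ad(1) by (cases a) (simp_all flip: power_mult_distrib)
    finally show ?thesis using True by (simp add: s_def)
  next
    case False
    then have "odd_cycles n \<sigma> (w \<epsilon> j i) = {}" by (auto simp: odd_cycles_def w_def)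
    then show ?thesis using False by (simp add: sg_def koszul_sign_def s_def)
  qed
  have part: "(\<Sum>v\<in>w \<epsilon> j ` I \<epsilon> j. sg v * wt v) = s \<epsilon> * z j ^ b * rep_trace (V \<epsilon> j y)" for \<epsilon> j
  proof -
    define S where "S = (\<Sum>u<a. r u)"
    have S: "S mod d = b" using cy(6) by (simp add: S_def r_def)
    define u where "u = h [^]\<^bsub>G\<^esub> a \<otimes>\<^bsub>G\<^esub> k [^]\<^bsub>G\<^esub> S"
    have uH: "u \<in> H" using powH[OF hH] powH[OF kH] by (simp add: u_def)
    have Ac: "A \<epsilon> j u \<in> carrier_mat (D \<epsilon> j) (D \<epsilon> j)" for u
      using is_rep_carrier[OF Vrep, of "h \<otimes>\<^bsub>G\<^esub> k [^]\<^bsub>G\<^esub> r u" \<epsilon> j] hH powH[OF kH, of "r u"]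
      by (simp add: A_def D_def)
    have "(\<Sum>v\<in>w \<epsilon> j ` I \<epsilon> j. sg v * wt v) = (\<Sum>i\<in>I \<epsilon> j. s \<epsilon> * (\<Prod>u<a. A \<epsilon> j u $$ (i (Suc u mod a), i u)))"
      unfolding sum.reindex[OF w_inj] comp_def sg_w wt_w ..
    also have "\<dots> = s \<epsilon> * rep_trace (mat_prod (D \<epsilon> j) (A \<epsilon> j) a)"
      unfolding sum_distrib_left[symmetric] I_def cyclic_trace[OF Ac ad(1)] ..
    also have "mat_prod (D \<epsilon> j) (A \<epsilon> j) a = z j ^ S \<cdot>\<^sub>m V \<epsilon> j u"
      unfolding A_def S_def u_def by (rule mat_prod_rep[OF G Vrep H hH kH hk]) (simp add: D_def)
    also have "rep_trace (z j ^ S \<cdot>\<^sub>m V \<epsilon> j u) = z j ^ S * rep_trace (V \<epsilon> j u)"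
      by (rule rep_trace_smult[OF is_rep_carrier[OF Vrep uH]])
    finally have L: "(\<Sum>v\<in>w \<epsilon> j ` I \<epsilon> j. sg v * wt v) = s \<epsilon> * (z j ^ S * rep_trace (V \<epsilon> j u))" .
    \<comment> \<open>Write S = b + d (S div d). The surplus power of the inverse of g is a power of
      the inverse of g^d; multiplying by the matching power of g^d turns u into y and introduces a
      scalar.\<close>
    have "V \<epsilon> j y = (z j ^ d) ^ (S div d) \<cdot>\<^sub>m V \<epsilon> j u"
    proof -
      have "k [^]\<^bsub>G\<^esub> S = k [^]\<^bsub>G\<^esub> b \<otimes>\<^bsub>G\<^esub> k [^]\<^bsub>G\<^esub> (d * (S div d))"
        unfolding nat_pow_mult[OF k] S[symmetric] by simp
      moreover have "gd [^]\<^bsub>G\<^esub> (S div d) = g [^]\<^bsub>G\<^esub> (d * (S div d))"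
        unfolding gd_def by (rule nat_pow_pow[OF g])
      ultimately have "k [^]\<^bsub>G\<^esub> S \<otimes>\<^bsub>G\<^esub> gd [^]\<^bsub>G\<^esub> (S div d) = k [^]\<^bsub>G\<^esub> b \<otimes>\<^bsub>G\<^esub>
          (k [^]\<^bsub>G\<^esub> (d * (S div d)) \<otimes>\<^bsub>G\<^esub> g [^]\<^bsub>G\<^esub> (d * (S div d)))"
        using k g by (simp add: m_assoc)
      also have "k [^]\<^bsub>G\<^esub> (d * (S div d)) \<otimes>\<^bsub>G\<^esub> g [^]\<^bsub>G\<^esub> (d * (S div d)) = \<one>\<^bsub>G\<^esub>"
        using g by (simp add: k_def nat_pow_inv)
      finally have u_y: "u \<otimes>\<^bsub>G\<^esub> gd [^]\<^bsub>G\<^esub> (S div d) = y"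
        using h k gd by (simp add: u_def y_def m_assoc)
      have "V \<epsilon> j gd = (z j ^ d) \<cdot>\<^sub>m 1\<^sub>m (rep_dim G (V \<epsilon> j))"
      proof -
        have "z j ^ d = rotation_scalar G gd j"
          using ad(2) N by (simp add: z_def Complex.DeMoivre rotation_scalar_def N_def[symmetric] field_simps)
        then show ?thesis using Rj(2)[of j \<epsilon>] by (simp add: acts_as_scalar_def)
      qed
      from rep_scalar_power[OF G Vrep H uH gdH this, of "S div d"] show ?thesis
        unfolding u_y .
    qed
    then have tr: "rep_trace (V \<epsilon> j y) = (z j ^ d) ^ (S div d) * rep_trace (V \<epsilon> j u)"
      by (simp only: rep_trace_smult[OF is_rep_carrier[OF Vrep uH]])
    \<comment> \<open>The same surplus in the exponent of z, so that the two discrepancies between S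
      and b cancel.\<close>
    have zS: "z j ^ S = z j ^ b * (z j ^ d) ^ (S div d)"
      using S by (metis add.commute mult_div_mod_eq power_add power_mult)
    show ?thesis unfolding L tr zS by (simp only: mult_ac)
  qed
  \<comment> \<open>The exponent from which \<open>q_subst\<close> takes the coefficient at
    x.\<close>
  define Y where "Y = x * of_nat d / of_nat a"
  show ?thesis
  proof (cases "\<exists>j. of_nat a * of_int j / of_nat (d * N) = x")
    \<comment> \<open>No homogeneous vector has exponent x, and on the other side Y is not a
      multiple of 1/N: both coefficients vanish.\<close>
    case False
    have "sg v * wt v = 0" if "v \<in> X" for v
    proof (rule ccontr)
      assume "sg v * wt v \<noteq> 0"
      then have "wt v \<noteq> 0" by simp
      from wt_nz[OF that this] False show False by blast
    qed
    then have "(\<Sum>v\<in>X. sg v * wt v) = 0" by (intro sum.neutral) simp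
    moreover have "Y * of_nat N \<notin> \<int>"
    proof
      assume "Y * of_nat N \<in> \<int>"
      then obtain j where "Y * of_nat N = of_int j" by (auto elim: Ints_cases)
      then have "of_nat a * of_int j / of_nat (d * N) = x"
        using ad N by (simp add: Y_def field_simps)
      with False show False by blast
    qed
    ultimately show ?thesis
      unfolding lhs q_subst_def tate_series_def q_series_def Let_def
      by (simp add: Y_def gd_def N_def)
  next
    case True
    then obtain j where j: "of_nat a * of_int j / of_nat (d * N) = x" by blast
    \<comment> \<open>The exponent determines the degree, so only the two parities remain to be
      summed.\<close>
    have j_unique: "j' = j" if "of_nat a * of_int j' / of_nat (d * N) = x" for j'
    proof -
      have "of_nat a * of_int j' / of_nat (d * N) = of_nat a * of_int j / (of_nat (d * N) :: rat)"
        using that j by simp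
      then have "of_nat a * of_int j' = of_nat a * (of_int j :: rat)" using ad N by (simp add: divide_cancel_right)
      then show ?thesis using ad by simp
    qed
    have "(\<Sum>v\<in>X. sg v * wt v) = (\<Sum>v\<in>w False j ` I False j \<union> w True j ` I True j. sg v * wt v)"
    proof (rule sum.mono_neutral_right[OF finX])
      show "w False j ` I False j \<union> w True j ` I True j \<subseteq> X" using wX[OF j] by blast
      show "\<forall>v\<in>X - (w False j ` I False j \<union> w True j ` I True j). sg v * wt v = 0"
      proof
        fix v assume v: "v \<in> X - (w False j ` I False j \<union> w True j ` I True j)"
        have "wt v = 0"
        proof (rule ccontr)
          assume nz: "wt v \<noteq> 0"
          have "v \<in> X" using v by simp
          from wt_nz[OF this nz] obtain \<epsilon> j' where *: "v \<in> w \<epsilon> j' ` I \<epsilon> j'"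
            "of_nat a * of_int j' / of_nat (d * N) = x"
            by (elim exE conjE)
          with v j_unique[OF *(2)] show False by (cases \<epsilon>) simp_all
        qed
        then show "sg v * wt v = 0" by simp
      qed
    qed
    also have "\<dots> = (\<Sum>v\<in>w False j ` I False j. sg v * wt v) + (\<Sum>v\<in>w True j ` I True j. sg v * wt v)"
    proof (rule sum.union_disjoint)
      show "finite (w False j ` I False j)" "finite (w True j ` I True j)"
        using finite_subset[OF wX[OF j] finX] by blast+
      have "w False j i \<noteq> w True j i'" for i i'
        using w_cyc[OF ad(1), of False j i] w_cyc[OF ad(1), of True j i'] by (metis prod.inject)
      then show "w False j ` I False j \<inter> w True j ` I True j = {}" by blast
    qed
    also have "\<dots> = z j ^ b * (rep_trace (V False j y) - rep_trace (V True j y))"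
      unfolding part by (simp add: s_def algebra_simps)
    \<comment> \<open>The even part minus the odd part of the model is a representative of the
      coefficient, so this difference is its character.\<close>
    also have "rep_trace (V False j y) - rep_trace (V True j y) = virtual_char (f gd j) y"
      using virtual_char_eq[OF fj, of "fst (R gd j)" "snd (R gd j)" j y] Rj(1)[of j] yH
      by (simp add: V_def graded_part_def)
    finally have L: "(\<Sum>v\<in>X. sg v * wt v) = z j ^ b * virtual_char (f gd j) y" .
    have Y: "Y = of_int j / of_nat N" using j ad N by (simp add: Y_def field_simps)
    then have YN: "Y * of_nat N = of_int j" using N by simp
    have "q_power Y (of_nat b / of_nat d) = z j ^ b"
    proof -
      have "q_power Y (of_nat b / of_nat d) = exp (\<i> * of_real (2 * pi * (of_int j / of_nat N) * (of_nat b / of_nat d)))"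
        unfolding q_power_def Y by (simp add: of_rat_divide mult_ac)
      also have "\<dots> = cis (2 * pi * (of_int j / of_nat N) * (of_nat b / of_nat d))" by (simp only: cis_conv_exp)
      also have "\<dots> = z j ^ b"
        unfolding z_def Complex.DeMoivre by (simp add: field_simps)
      finally show ?thesis .
    qed
    then show ?thesis
      unfolding lhs L q_subst_def tate_series_def q_series_def Let_def y_eq gd_def[symmetric] N_def[symmetric]
        Y_def[symmetric] YN by simp
  qed
qed

section \<open>Tori and their coverings\<close>

lemma openin_torus:
  "openin (torus \<Lambda>) U \<longleftrightarrow> U \<subseteq> range (torus_point \<Lambda>) \<and> open {z. torus_point \<Lambda> z \<in> U}"
  unfolding torus_def topology_inverse'[OF istopology_torus] ..

lemma topspace_torus: "topspace (torus \<Lambda>) = range (torus_point \<Lambda>)"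
proof (rule equalityI)
  show "topspace (torus \<Lambda>) \<subseteq> range (torus_point \<Lambda>)"
    using openin_topspace[of "torus \<Lambda>"] by (simp only: openin_torus)
  have "openin (torus \<Lambda>) (range (torus_point \<Lambda>))" by (simp add: openin_torus)
  then show "range (torus_point \<Lambda>) \<subseteq> topspace (torus \<Lambda>)" by (rule openin_subset)
qed

lemma continuous_torus_point: "continuous_map euclidean (torus \<Lambda>) (torus_point \<Lambda>)"
  by (simp add: continuous_map_def topspace_torus openin_torus)

lemma continuous_map_from_torus:
  assumes "continuous_map euclidean X (\<lambda>z. f (torus_point \<Lambda> z))"
  shows "continuous_map (torus \<Lambda>) X f"
  unfolding continuous_map_def
proof (intro conjI allI impI funcsetI)
  fix y assume "y \<in> topspace (torus \<Lambda>)"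
  then show "f y \<in> topspace X"
    using assms by (auto simp: topspace_torus continuous_map_def)
next
  fix U assume "openin X U"
  with assms have "open {z. f (torus_point \<Lambda> z) \<in> U}" by (simp add: continuous_map_def)
  then show "openin (torus \<Lambda>) {y \<in> topspace (torus \<Lambda>). f y \<in> U}"
    by (simp add: openin_torus topspace_torus)
qed

section \<open>Lattices in the complex plane and their tori\<close>

locale complex_lattice =
  fixes \<Lambda> :: "complex set"
  assumes basis: "\<exists>w1 w2. lattice_basis \<Lambda> w1 w2"
begin

lemma zero_mem: "0 \<in> \<Lambda>"
  using basis by (auto simp: lattice_basis_def lattice_span_def intro!: exI[of _ 0])

lemma diff_mem: "x \<in> \<Lambda> \<Longrightarrow> y \<in> \<Lambda> \<Longrightarrow> x - y \<in> \<Lambda>"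
proof -
  assume "x \<in> \<Lambda>" "y \<in> \<Lambda>"
  then obtain w1 w2 j k j' k' where L: "\<Lambda> = lattice_span w1 w2"
    and "x = of_int j * w1 + of_int k * w2" "y = of_int j' * w1 + of_int k' * w2"
    using basis by (auto simp: lattice_basis_def lattice_span_def)
  then have "x - y = of_int (j - j') * w1 + of_int (k - k') * w2" by (simp add: algebra_simps)
  then show ?thesis unfolding L lattice_span_def by blast
qed

lemma uminus_mem: "x \<in> \<Lambda> \<Longrightarrow> - x \<in> \<Lambda>"
  using diff_mem[OF zero_mem] by simp

lemma add_mem: "x \<in> \<Lambda> \<Longrightarrow> y \<in> \<Lambda> \<Longrightarrow> x + y \<in> \<Lambda>"
  using diff_mem[OF _ uminus_mem] by fastforce

lemma torus_point_eq_iff: "torus_point \<Lambda> z = torus_point \<Lambda> z' \<longleftrightarrow> z - z' \<in> \<Lambda>"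
proof
  assume "torus_point \<Lambda> z = torus_point \<Lambda> z'"
  then have "z + 0 \<in> (\<lambda>w. z' + w) ` \<Lambda>" using zero_mem unfolding torus_point_def by blast
  then show "z - z' \<in> \<Lambda>" by auto
next
  have sub: "torus_point \<Lambda> z \<subseteq> torus_point \<Lambda> z'" if "z - z' \<in> \<Lambda>" for z z'
  proof
    fix x assume "x \<in> torus_point \<Lambda> z"
    then obtain w where "w \<in> \<Lambda>" "x = z' + ((z - z') + w)" by (auto simp: torus_point_def)
    then show "x \<in> torus_point \<Lambda> z'" using add_mem[OF that] unfolding torus_point_def by blast
  qed
  assume "z - z' \<in> \<Lambda>"
  moreover from this have "z' - z \<in> \<Lambda>" using uminus_mem by fastforce
  ultimately show "torus_point \<Lambda> z = torus_point \<Lambda> z'" using sub by blast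
qed

text \<open>For w = j w1 + k w2 the cross products of w with w1 and w2 are integer multiples of the
  area A of the parallelogram of the basis. If w is short, both are smaller than A in absolute
  value, so j = k = 0.\<close>

lemma discrete:
  obtains \<delta> where "\<delta> > 0" "\<And>w. w \<in> \<Lambda> \<Longrightarrow> cmod w < \<delta> \<Longrightarrow> w = 0"
proof -
  obtain w1 w2 where A: "Im (cnj w1 * w2) \<noteq> 0" and L: "\<Lambda> = lattice_span w1 w2"
    using basis by (auto simp: lattice_basis_def)
  define A where "A = \<bar>Im (cnj w1 * w2)\<bar>"
  have pos: "A > 0" "w1 \<noteq> 0" "w2 \<noteq> 0" using A by (auto simp: A_def)
  define \<delta> where "\<delta> = min (A / cmod w1) (A / cmod w2)"
  have "w = 0" if w: "w \<in> \<Lambda>" "cmod w < \<delta>" for w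
  proof -
    obtain j k where jk: "w = of_int j * w1 + of_int k * w2" using w L by (auto simp: lattice_span_def)
    have "\<bar>Im (cnj w1 * w)\<bar> \<le> cmod w1 * cmod w" "\<bar>Im (cnj w2 * w)\<bar> \<le> cmod w2 * cmod w"
      using abs_Im_le_cmod[of "cnj w1 * w"] abs_Im_le_cmod[of "cnj w2 * w"] by (simp_all add: norm_mult)
    moreover have "cmod w1 * cmod w < A" "cmod w2 * cmod w < A"
      using w(2) pos by (auto simp: \<delta>_def field_simps)
    moreover have "Im (cnj w1 * w) = of_int k * Im (cnj w1 * w2)" "Im (cnj w2 * w) = - of_int j * Im (cnj w1 * w2)"
      by (simp_all add: jk algebra_simps)
    ultimately have "\<bar>of_int k\<bar> * A < 1 * A" "\<bar>of_int j\<bar> * A < 1 * A"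
      by (simp_all add: A_def abs_mult)
    then have "\<bar>of_int k :: real\<bar> < 1" "\<bar>of_int j :: real\<bar> < 1"
      using pos(1) mult_less_cancel_right_pos by blast+
    then have "k = 0" "j = 0" by linarith+
    then show ?thesis by (simp add: jk)
  qed
  moreover have "\<delta> > 0" using pos by (simp add: \<delta>_def)
  ultimately show ?thesis by (intro that[of \<delta>]) auto
qed

lemma openin_torus_image:
  assumes "open S" shows "openin (torus \<Lambda>) (torus_point \<Lambda> ` S)"
proof -
  \<comment> \<open>The saturation of S is the union of its lattice translates, which is
    open.\<close>
  have "{z. torus_point \<Lambda> z \<in> torus_point \<Lambda> ` S} = (\<Union>w\<in>\<Lambda>. (\<lambda>x. w + x) ` S)"
  proof (intro Set.set_eqI iffI)
    fix z assume "z \<in> {z. torus_point \<Lambda> z \<in> torus_point \<Lambda> ` S}"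
    then obtain s where "s \<in> S" "z - s \<in> \<Lambda>" by (auto simp: torus_point_eq_iff)
    then show "z \<in> (\<Union>w\<in>\<Lambda>. (\<lambda>x. w + x) ` S)" by (intro UN_I[of "z - s"] image_eqI[of _ _ s]) auto
  next
    fix z assume "z \<in> (\<Union>w\<in>\<Lambda>. (\<lambda>x. w + x) ` S)"
    then obtain w s where "w \<in> \<Lambda>" "s \<in> S" "z = w + s" by blast
    then show "z \<in> {z. torus_point \<Lambda> z \<in> torus_point \<Lambda> ` S}"
      by (auto simp: image_iff torus_point_eq_iff intro!: bexI[of _ s])
  qed
  then show ?thesis
    unfolding openin_torus using open_translation[OF assms] by auto
qed

lemma torus_mult_point:
  assumes "complex_lattice \<Lambda>'" "(\<lambda>z. m * z) ` \<Lambda>' \<subseteq> \<Lambda>"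
  shows "torus_mult \<Lambda> m (torus_point \<Lambda>' z) = torus_point \<Lambda> (m * z)"
proof -
  have "torus_point \<Lambda> (m * x) = torus_point \<Lambda> (m * z)" if x: "x \<in> torus_point \<Lambda>' z" for x
  proof -
    obtain w where "w \<in> \<Lambda>'" "x = z + w" using x by (auto simp: torus_point_def)
    then show ?thesis using assms(2) by (auto simp: torus_point_eq_iff algebra_simps)
  qed
  moreover have "torus_point \<Lambda>' z \<noteq> {}"
    using complex_lattice.zero_mem[OF assms(1)] by (auto simp: torus_point_def)
  moreover have "torus_mult \<Lambda> m (torus_point \<Lambda>' z) = (\<Union>x\<in>torus_point \<Lambda>' z. torus_point \<Lambda> (m * z))"
    unfolding torus_mult_def by (rule SUP_cong[OF refl]) (rule calculation(1))
  ultimately show ?thesis by simp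
qed

lemma continuous_torus_mult:
  assumes "complex_lattice \<Lambda>'" "(\<lambda>z. m * z) ` \<Lambda>' \<subseteq> \<Lambda>"
  shows "continuous_map (torus \<Lambda>') (torus \<Lambda>) (torus_mult \<Lambda> m)"
proof (rule continuous_map_from_torus)
  have "continuous_map euclidean euclidean (\<lambda>z. m * z)"
    by (simp add: continuous_intros)
  from continuous_map_compose[OF this continuous_torus_point]
  show "continuous_map euclidean (torus \<Lambda>) (\<lambda>z. torus_mult \<Lambda> m (torus_point \<Lambda>' z))"
    by (simp add: torus_mult_point[OF assms] comp_def)
qed

end

text \<open>Instead of lifting p to the plane, compare it at each time with the straight candidates
  starting at \<mu>/m, for \<mu> in \<Lambda>. The set of candidates that agree with p is locally
  constant because \<Lambda> is discrete, hence the same at 0 and at 1.\<close>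

lemma torus_path_lift:
  assumes L: "complex_lattice \<Lambda>" and L': "complex_lattice \<Lambda>'"
    and m: "m \<noteq> 0" "(\<lambda>z. m * z) ` \<Lambda>' \<subseteq> \<Lambda>"
    and p: "pathin (torus \<Lambda>') p" "p 0 = torus_point \<Lambda>' z0"
    and cover: "\<And>t. t \<in> {0..1} \<Longrightarrow> torus_mult \<Lambda> m (p t) = torus_point \<Lambda> (of_real t * w)"
  shows "p 1 = torus_point \<Lambda>' (z0 + w / m)"
proof -
  interpret L: complex_lattice \<Lambda> by (rule L)
  interpret L': complex_lattice \<Lambda>' by (rule L')
  obtain \<delta> where \<delta>: "\<delta> > 0" "\<And>w. w \<in> \<Lambda> \<Longrightarrow> cmod w < \<delta> \<Longrightarrow> w = 0" by (rule L.discrete, rule that)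
  define q where "q \<mu> t = torus_point \<Lambda>' ((\<mu> + of_real t * w) / m)" for \<mu> :: complex and t :: real
  \<comment> \<open>A set rather than a single \<mu>, as \<mu> is determined only modulo m
    \<Lambda>'.\<close>
  define f where "f t = {\<mu> \<in> \<Lambda>. p t = q \<mu> t}" for t
  have pc: "continuous_map (top_of_set {0..1}) (torus \<Lambda>') p" using p(1) by (simp add: pathin_def)
  have pt: "\<And>t. t \<in> {0..1} \<Longrightarrow> p t \<in> range (torus_point \<Lambda>')"
    using continuous_map_image_subset_topspace[OF pc] by (auto simp: topspace_torus)
  have lift: "m * z - of_real t * w \<in> \<Lambda>" if "t \<in> {0..1}" "p t = torus_point \<Lambda>' z" for t z
    using cover[OF that(1)] by (simp add: that(2) L.torus_mult_point[OF L' m(2)] L.torus_point_eq_iff)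
  have qeq: "torus_point \<Lambda>' z = q (m * z - of_real t * w) t" for z t using m(1) by (simp add: q_def)
  have nonempty: "f t \<noteq> {}" if t: "t \<in> {0..1}" for t
  proof -
    obtain z where "p t = torus_point \<Lambda>' z" using pt[OF t] by blast
    then have "m * z - of_real t * w \<in> f t" using lift[OF t] qeq[of z t] by (simp add: f_def)
    then show ?thesis by blast
  qed
  have qq: "q \<mu> t = q \<mu>' t \<longleftrightarrow> (\<mu> - \<mu>') / m \<in> \<Lambda>'" for \<mu> \<mu>' t
    by (simp add: q_def L'.torus_point_eq_iff diff_divide_distrib[symmetric])
  have f_eq: "f t = {\<mu>' \<in> \<Lambda>. (\<mu> - \<mu>') / m \<in> \<Lambda>'}" if "\<mu> \<in> f t" for \<mu> t
    using that by (auto simp: f_def qq)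
  have "f constant_on {0..1}"
  proof (rule locally_constant_imp_constant)
    show "connected {0..1::real}" by simp
    fix t0 :: real assume t0: "t0 \<in> {0..1}"
    obtain \<mu> where lam: "\<mu> \<in> f t0" using nonempty[OF t0] by blast
    \<comment> \<open>One half of \<delta> bounds m (z - c), the other half the change of t w, so
      that two candidates at nearby times differ by less than \<delta>.\<close>
    define \<epsilon> where "\<epsilon> = \<delta> / 2 / cmod m"
    have e: "\<epsilon> > 0" using \<delta>(1) m(1) by (simp add: \<epsilon>_def)
    define c where "c = (\<mu> + of_real t0 * w) / m"
    let ?U = "torus_point \<Lambda>' ` ball c \<epsilon>"
    have "openin (top_of_set {0..1}) {t \<in> topspace (top_of_set {0..1}). p t \<in> ?U}"
      by (rule openin_continuous_map_preimage[OF pc L'.openin_torus_image]) simp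
    then have "openin (top_of_set {0..1}) {t \<in> {0..1}. p t \<in> ?U}"
      by (simp only: topspace_euclidean_subtopology)
    moreover have "openin (top_of_set {0..1}) ({0..1} \<inter> {t. cmod (of_real (t - t0) * w) < \<delta> / 2})"
      by (intro openin_open_Int open_Collect_less continuous_intros)
    ultimately have op: "openin (top_of_set {0..1})
        ({t \<in> {0..1}. p t \<in> ?U} \<inter> ({0..1} \<inter> {t. cmod (of_real (t - t0) * w) < \<delta> / 2}))" (is "openin _ ?W")
      by (rule openin_Int)
    have "p t0 = torus_point \<Lambda>' c" using lam by (simp add: f_def q_def c_def)
    then have "p t0 \<in> ?U" using e by simp
    then have tW: "t0 \<in> ?W" using t0 \<delta>(1) by simp
    have fW: "f t = f t0" if t: "t \<in> ?W" for t
    proof -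
      have t1: "t \<in> {0..1}" "cmod (of_real (t - t0) * w) < \<delta> / 2" using t by auto
      obtain z where z: "z \<in> ball c \<epsilon>" "p t = torus_point \<Lambda>' z" using t by blast
      let ?mu = "m * z - of_real t * w"
      have mu: "?mu \<in> \<Lambda>" by (rule lift[OF t1(1) z(2)])
      have "\<mu> \<in> \<Lambda>" using lam by (simp add: f_def)
      have "?mu - \<mu> = m * (z - c) - of_real (t - t0) * w"
        using m(1) by (simp add: c_def field_simps)
      then have "cmod (?mu - \<mu>) \<le> cmod (m * (z - c)) + cmod (of_real (t - t0) * w)"
        by (metis norm_triangle_ineq4)
      moreover have "cmod (m * (z - c)) < \<delta> / 2"
      proof -
        have "cmod (z - c) < \<delta> / 2 / cmod m"
          using z(1) by (simp add: \<epsilon>_def dist_norm norm_minus_commute)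
        then show ?thesis using m(1) by (simp add: norm_mult pos_less_divide_eq mult_ac)
      qed
      ultimately have "cmod (?mu - \<mu>) < \<delta>" using t1(2) by linarith
      \<comment> \<open>A lattice vector shorter than \<delta> is zero: the old candidate is still
        valid at time t.\<close>
      from \<delta>(2)[OF L.diff_mem[OF mu \<open>\<mu> \<in> \<Lambda>\<close>] this] have eq: "?mu = \<mu>" by simp
      have "p t = q \<mu> t" unfolding z(2) eq[symmetric] by (rule qeq)
      with \<open>\<mu> \<in> \<Lambda>\<close> have "\<mu> \<in> f t" by (simp add: f_def)
      from f_eq[OF this] f_eq[OF lam] show ?thesis by simp
    qed
    show "\<exists>T. openin (top_of_set {0..1}) T \<and> t0 \<in> T \<and> (\<forall>x\<in>T. f x = f t0)"
      using op tW fW by blast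
  qed
  then obtain c where "\<And>t. t \<in> {0..1} \<Longrightarrow> f t = c" unfolding constant_on_def by blast
  then have "f 0 = f 1" by simp
  moreover have "m * z0 \<in> f 0"
    using lift[of 0 z0] qeq[of z0 0] p(2) by (simp add: f_def)
  ultimately have "m * z0 \<in> f 1" by simp
  then have "p 1 = torus_point \<Lambda>' ((m * z0 + w) / m)" by (simp add: f_def q_def)
  also have "(m * z0 + w) / m = z0 + w / m" using m(1) by (simp add: field_simps)
  finally show ?thesis .
qed

text \<open>Transport along a loop of period w moves every point of the fibre by the same
  translation w/m, by uniqueness of lifts. Words in the monodromy therefore act as
  translations.\<close>

lemma covering_monodromy_translation:
  assumes L: "complex_lattice \<Lambda>" and L': "complex_lattice \<Lambda>'"
    and mono: "covering_monodromy n \<Lambda>' \<Lambda> m w1 w2 \<sigma> \<rho>"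
    and perm: "\<sigma> permutes {1..n}" "\<rho> permutes {1..n}"
  obtains l where "inj_on l {1..n}" "\<forall>i\<in>{1..n}. l i \<in> range (torus_point \<Lambda>')"
    "\<forall>i\<in>{1..n}. \<forall>z. l i = torus_point \<Lambda>' z \<longrightarrow>
       (\<forall>s t. l ((\<sigma> ^^ s) ((\<rho> ^^ t) i)) = torus_point \<Lambda>' (z + (of_nat s * w1 + of_nat t * w2) / m))"
proof -
  obtain l where m: "m \<noteq> 0" "(\<lambda>z. m * z) ` \<Lambda>' \<subseteq> \<Lambda>"
    and l: "bij_betw l {1..n} {y \<in> topspace (torus \<Lambda>'). torus_mult \<Lambda> m y = torus_point \<Lambda> 0}"
    and path: "\<forall>i\<in>{1..n}. \<forall>(w, \<pi>)\<in>{(w1, \<sigma>), (w2, \<rho>)}.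
           \<exists>p. pathin (torus \<Lambda>') p \<and> p 0 = l i \<and> p 1 = l (\<pi> i) \<and>
               (\<forall>t\<in>{0..1}. torus_mult \<Lambda> m (p t) = torus_point \<Lambda> (of_real t * w))"
    using mono unfolding covering_monodromy_def by blast
  have step: "l (\<pi> i) = torus_point \<Lambda>' (z + w / m)"
    if i: "i \<in> {1..n}" and z: "l i = torus_point \<Lambda>' z" and w: "(w, \<pi>) \<in> {(w1, \<sigma>), (w2, \<rho>)}" for i z w \<pi>
  proof -
    obtain p where p: "pathin (torus \<Lambda>') p" "p 0 = l i" "p 1 = l (\<pi> i)"
      "\<And>t. t \<in> {0..1} \<Longrightarrow> torus_mult \<Lambda> m (p t) = torus_point \<Lambda> (of_real t * w)"
      using bspec[OF bspec[OF path i] w] by auto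
    show ?thesis
      using torus_path_lift[OF L L' m p(1) _ p(4), of z] p(2,3) z by simp
  qed
  have pow: "l ((\<pi> ^^ s) i) = torus_point \<Lambda>' (z + of_nat s * w / m)"
    if "i \<in> {1..n}" "l i = torus_point \<Lambda>' z" "(w, \<pi>) \<in> {(w1, \<sigma>), (w2, \<rho>)}" for i z w \<pi> s
  proof (induction s)
    case (Suc s)
    have "\<pi> permutes {1..n}" using that(3) perm by auto
    from permutes_funpow_in[OF this] that(1) have "(\<pi> ^^ s) i \<in> {1..n}" by simp
    from step[OF this Suc that(3)] show ?case by (simp add: algebra_simps add_divide_distrib)
  qed (use that in simp)
  show ?thesis
  proof (rule that[of l])
    show "inj_on l {1..n}" using l by (simp only: bij_betw_def)
    show "\<forall>i\<in>{1..n}. l i \<in> range (torus_point \<Lambda>')"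
    proof
      fix i assume "i \<in> {1..n}"
      from bij_betw_apply[OF l this] show "l i \<in> range (torus_point \<Lambda>')" by (simp add: topspace_torus)
    qed
    show "\<forall>i\<in>{1..n}. \<forall>z. l i = torus_point \<Lambda>' z \<longrightarrow>
       (\<forall>s t. l ((\<sigma> ^^ s) ((\<rho> ^^ t) i)) = torus_point \<Lambda>' (z + (of_nat s * w1 + of_nat t * w2) / m))"
    proof (intro ballI allI impI)
      fix i s t z assume i: "i \<in> {1..n}" "l i = torus_point \<Lambda>' z"
      have A: "l ((\<rho> ^^ t) i) = torus_point \<Lambda>' (z + of_nat t * w2 / m)"
        by (rule pow[OF i]) simp
      have B: "(\<rho> ^^ t) i \<in> {1..n}" by (simp only: permutes_funpow_in[OF perm(2)] i(1))
      have "l ((\<sigma> ^^ s) ((\<rho> ^^ t) i)) = torus_point \<Lambda>' (z + of_nat t * w2 / m + of_nat s * w1 / m)"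
        by (rule pow[OF B A]) simp
      moreover have "z + of_nat t * w2 / m + of_nat s * w1 / m = z + (of_nat s * w1 + of_nat t * w2) / m"
        by (simp add: add_divide_distrib)
      ultimately show "l ((\<sigma> ^^ s) ((\<rho> ^^ t) i)) = torus_point \<Lambda>' (z + (of_nat s * w1 + of_nat t * w2) / m)" by simp
    qed
  qed
qed

text \<open>A word fixes the point labelled 1 exactly when the corresponding translation lies in
  \<Lambda>', the labelling being injective. So m \<Lambda>' is the stabilizer lattice, and it is
  the same for every covering with monodromy of this type.\<close>

lemma covering_lattice:
  assumes L: "complex_lattice \<Lambda>" and L': "complex_lattice \<Lambda>'"
    and mono: "covering_monodromy n \<Lambda>' \<Lambda> m w1 w2 \<sigma> \<rho>"
    and type: "pair_type n a b d \<sigma> \<rho>" and n: "n \<ge> 1" and span: "\<Lambda> = lattice_span w1 w2"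
  shows "(\<lambda>z. m * z) ` \<Lambda>' = {of_int x * w1 + of_int y * w2 | x y. (x, y) \<in> hecke_lattice a b d}"
proof -
  interpret L': complex_lattice \<Lambda>' by (rule L')
  have perm: "\<sigma> permutes {1..n}" "\<rho> permutes {1..n}" using type by (simp_all only: pair_type_def)
  have m: "m \<noteq> 0" "(\<lambda>z. m * z) ` \<Lambda>' \<subseteq> \<Lambda>" using mono by (simp_all add: covering_monodromy_def)
  obtain l where l: "inj_on l {1..n}" "\<forall>i\<in>{1..n}. l i \<in> range (torus_point \<Lambda>')"
    "\<forall>i\<in>{1..n}. \<forall>z. l i = torus_point \<Lambda>' z \<longrightarrow>
       (\<forall>s t. l ((\<sigma> ^^ s) ((\<rho> ^^ t) i)) = torus_point \<Lambda>' (z + (of_nat s * w1 + of_nat t * w2) / m))"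
    by (rule covering_monodromy_translation[OF L L' mono perm])
  have one: "1 \<in> {1..n}" using n by simp
  obtain z where z: "l 1 = torus_point \<Lambda>' z" using bspec[OF l(2) one] by blast
  have iff: "(of_int x * w1 + of_int y * w2) / m \<in> \<Lambda>' \<longleftrightarrow> (x, y) \<in> hecke_lattice a b d" for x y
  proof -
    \<comment> \<open>Positive and negative parts, to express an integer vector by two words with
      natural exponents.\<close>
    define s t s' t' where "s = nat x" "t = nat y" "s' = nat (- x)" "t' = nat (- y)"
    have xy: "x = int s - int s'" "y = int t - int t'" by (simp_all add: s_t_s'_t'_def)
    have in1: "(\<sigma> ^^ s) ((\<rho> ^^ t) 1) \<in> {1..n}" "(\<sigma> ^^ s') ((\<rho> ^^ t') 1) \<in> {1..n}"
      by (simp_all only: permutes_funpow_in[OF perm(1)] permutes_funpow_in[OF perm(2)] one)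
    have "(x, y) \<in> hecke_lattice a b d \<longleftrightarrow> (\<sigma> ^^ s) ((\<rho> ^^ t) 1) = (\<sigma> ^^ s') ((\<rho> ^^ t') 1)"
      unfolding xy by (rule pair_type_iff[OF type one, symmetric])
    also have "\<dots> \<longleftrightarrow> l ((\<sigma> ^^ s) ((\<rho> ^^ t) 1)) = l ((\<sigma> ^^ s') ((\<rho> ^^ t') 1))"
      using inj_on_eq_iff[OF l(1) in1] by simp
    also have "\<dots> \<longleftrightarrow> (of_nat s * w1 + of_nat t * w2) / m - (of_nat s' * w1 + of_nat t' * w2) / m \<in> \<Lambda>'"
      unfolding l(3)[rule_format, OF one z] L'.torus_point_eq_iff by simp
    also have "(of_nat s * w1 + of_nat t * w2) / m - (of_nat s' * w1 + of_nat t' * w2) / m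
        = (of_int x * w1 + of_int y * w2) / m"
      unfolding xy by (simp add: diff_divide_distrib[symmetric] algebra_simps)
    finally show ?thesis by simp
  qed
  show ?thesis
  proof (intro equalityI subsetI)
    fix v assume v: "v \<in> (\<lambda>z. m * z) ` \<Lambda>'"
    then obtain x y where xy: "v = of_int x * w1 + of_int y * w2"
      using m(2) span by (auto simp: lattice_span_def)
    have "v / m \<in> \<Lambda>'" using v m(1) by auto
    then show "v \<in> {of_int x * w1 + of_int y * w2 | x y. (x, y) \<in> hecke_lattice a b d}"
      using xy iff by blast
  next
    fix v assume "v \<in> {of_int x * w1 + of_int y * w2 | x y. (x, y) \<in> hecke_lattice a b d}"
    then obtain x y where v: "v = of_int x * w1 + of_int y * w2" "(x, y) \<in> hecke_lattice a b d" by blast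
    then have "v / m \<in> \<Lambda>'" using iff by blast
    then show "v \<in> (\<lambda>z. m * z) ` \<Lambda>'" using m(1) by (intro image_eqI[of _ _ "v / m"]) simp_all
  qed
qed

section \<open>Maps between principal bundles\<close>

locale bundle_over = group G for G :: "'g monoid" (structure) +
  fixes X :: "'p topology" and B :: "'b topology" and p :: "'p \<Rightarrow> 'b" and r :: "'p \<Rightarrow> 'g \<Rightarrow> 'p"
  assumes principal: "principal_bundle G X B p r"
begin

lemma proj_continuous: "continuous_map X B p"
  using principal by (simp add: principal_bundle_def)

lemma proj_in: "x \<in> topspace X \<Longrightarrow> p x \<in> topspace B"
  using continuous_map_image_subset_topspace[OF proj_continuous] by blast

lemma act_continuous: "\<gamma> \<in> carrier G \<Longrightarrow> continuous_map X X (\<lambda>x. r x \<gamma>)"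
  using principal by (simp add: principal_bundle_def)

lemma act_in: "x \<in> topspace X \<Longrightarrow> \<gamma> \<in> carrier G \<Longrightarrow> r x \<gamma> \<in> topspace X"
  using continuous_map_image_subset_topspace[OF act_continuous] by blast

lemma act_one: "x \<in> topspace X \<Longrightarrow> r x \<one> = x"
  and act_proj: "x \<in> topspace X \<Longrightarrow> \<gamma> \<in> carrier G \<Longrightarrow> p (r x \<gamma>) = p x"
  and act_mult: "x \<in> topspace X \<Longrightarrow> \<gamma> \<in> carrier G \<Longrightarrow> \<delta> \<in> carrier G \<Longrightarrow> r x (\<gamma> \<otimes> \<delta>) = r (r x \<gamma>) \<delta>"
  using principal by (simp_all add: principal_bundle_def)

text \<open>The homeomorphism is restated through its slices with fixed group coordinate; later
  arguments then work with open sets of the base and of the total space without the product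
  topology.\<close>

lemma trivialization:
  assumes "b \<in> topspace B"
  obtains U k where "openin B U" "b \<in> U" "k ` (U \<times> carrier G) = {x \<in> topspace X. p x \<in> U}"
    "inj_on k (U \<times> carrier G)"
    "\<And>u \<gamma>. u \<in> U \<Longrightarrow> \<gamma> \<in> carrier G \<Longrightarrow> p (k (u, \<gamma>)) = u"
    "\<And>u \<gamma> \<delta>. u \<in> U \<Longrightarrow> \<gamma> \<in> carrier G \<Longrightarrow> \<delta> \<in> carrier G \<Longrightarrow> k (u, \<gamma> \<otimes> \<delta>) = r (k (u, \<gamma>)) \<delta>"
    "\<And>V \<gamma>. openin X V \<Longrightarrow> \<gamma> \<in> carrier G \<Longrightarrow> openin B {u \<in> U. k (u, \<gamma>) \<in> V}"
    "\<And>\<gamma>. \<gamma> \<in> carrier G \<Longrightarrow> openin X (k ` (U \<times> {\<gamma>}))"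
proof -
  from principal have "\<forall>b\<in>topspace B. \<exists>U k. openin B U \<and> b \<in> U \<and>
        homeomorphic_map (prod_topology (subtopology B U) (discrete_topology (carrier G)))
                         (subtopology X {x \<in> topspace X. p x \<in> U}) k \<and>
        (\<forall>u\<in>U. \<forall>\<gamma>\<in>carrier G. p (k (u, \<gamma>)) = u \<and>
           (\<forall>\<delta>\<in>carrier G. k (u, \<gamma> \<otimes> \<delta>) = r (k (u, \<gamma>)) \<delta>))"
    unfolding principal_bundle_def by (elim conjE)
  from bspec[OF this assms] obtain U k where U: "openin B U" "b \<in> U"
    and hom: "homeomorphic_map (prod_topology (subtopology B U) (discrete_topology (carrier G)))
                         (subtopology X {x \<in> topspace X. p x \<in> U}) k"
    and k: "\<forall>u\<in>U. \<forall>\<gamma>\<in>carrier G. p (k (u, \<gamma>)) = u \<and>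
           (\<forall>\<delta>\<in>carrier G. k (u, \<gamma> \<otimes> \<delta>) = r (k (u, \<gamma>)) \<delta>)"
    by (elim exE conjE)
  let ?P = "prod_topology (subtopology B U) (discrete_topology (carrier G))"
  let ?XU = "{x \<in> topspace X. p x \<in> U}"
  have UB: "U \<subseteq> topspace B" by (rule openin_subset[OF U(1)])
  have top: "topspace ?P = U \<times> carrier G" using UB by (simp add: Int_absorb1)
  have openXU: "openin X ?XU" by (rule openin_continuous_map_preimage[OF proj_continuous U(1)])
  have topX: "topspace (subtopology X ?XU) = ?XU" by (simp add: Int_absorb1)
  show ?thesis
  proof (rule that[of U k])
    show "k ` (U \<times> carrier G) = ?XU"
      using homeomorphic_imp_surjective_map[OF hom] unfolding top topX .
    show "inj_on k (U \<times> carrier G)"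
      using homeomorphic_imp_injective_map[OF hom] unfolding top .
    show "p (k (u, \<gamma>)) = u" if "u \<in> U" "\<gamma> \<in> carrier G" for u \<gamma> using k that by blast
    show "k (u, \<gamma> \<otimes> \<delta>) = r (k (u, \<gamma>)) \<delta>" if "u \<in> U" "\<gamma> \<in> carrier G" "\<delta> \<in> carrier G" for u \<gamma> \<delta>
      using k that by blast
    show "openin B {u \<in> U. k (u, \<gamma>) \<in> V}" if V: "openin X V" and \<gamma>: "\<gamma> \<in> carrier G" for V \<gamma>
    proof -
      have "continuous_map (subtopology B U) ?P (\<lambda>u. (u, \<gamma>))"
        by (intro continuous_map_pairedI) (simp_all add: \<gamma>)
      moreover have "continuous_map ?P X k"
        using homeomorphic_imp_continuous_map[OF hom] by (simp add: continuous_map_in_subtopology)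
      ultimately have "continuous_map (subtopology B U) X (k \<circ> (\<lambda>u. (u, \<gamma>)))"
        by (rule continuous_map_compose)
      from openin_continuous_map_preimage[OF this V]
      have "openin (subtopology B U) {u \<in> U. k (u, \<gamma>) \<in> V}"
        using UB by (simp add: Int_absorb1 comp_def)
      then show ?thesis by (rule openin_trans_full[OF _ U(1)])
    qed
    show "openin X (k ` (U \<times> {\<gamma>}))" if \<gamma>: "\<gamma> \<in> carrier G" for \<gamma>
    proof -
      have "openin ?P (U \<times> {\<gamma>})"
        unfolding openin_prod_Times_iff using \<gamma> U(1) openin_subtopology_refl[of B U] UB by simp
      then have "openin (subtopology X ?XU) (k ` (U \<times> {\<gamma>}))"
        using homeomorphic_imp_open_map[OF hom] by (simp add: open_map_def)
      then show ?thesis by (rule openin_trans_full[OF _ openXU])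
    qed
  qed (fact U)+
qed

lemma proj_surj:
  assumes "b \<in> topspace B" obtains x where "x \<in> topspace X" "p x = b"
proof -
  obtain U k where U: "b \<in> U" "k ` (U \<times> carrier G) = {x \<in> topspace X. p x \<in> U}"
    "\<And>u \<gamma>. u \<in> U \<Longrightarrow> \<gamma> \<in> carrier G \<Longrightarrow> p (k (u, \<gamma>)) = u"
    by (rule trivialization[OF assms], rule that)
  have "k (b, \<one>) \<in> k ` (U \<times> carrier G)" using U(1) by simp
  then have "k (b, \<one>) \<in> topspace X" unfolding U(2) by simp
  with U(3)[OF U(1) one_closed] show ?thesis using that by blast
qed

lemma fibre_transitive:
  assumes "x \<in> topspace X" "y \<in> topspace X" "p x = p y"
  obtains \<gamma> where "\<gamma> \<in> carrier G" "y = r x \<gamma>"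
proof -
  obtain U k where U: "p x \<in> U" "k ` (U \<times> carrier G) = {x \<in> topspace X. p x \<in> U}"
    "\<And>u \<gamma>. u \<in> U \<Longrightarrow> \<gamma> \<in> carrier G \<Longrightarrow> p (k (u, \<gamma>)) = u"
    "\<And>u \<gamma> \<delta>. u \<in> U \<Longrightarrow> \<gamma> \<in> carrier G \<Longrightarrow> \<delta> \<in> carrier G \<Longrightarrow> k (u, \<gamma> \<otimes> \<delta>) = r (k (u, \<gamma>)) \<delta>"
    by (rule trivialization[OF proj_in[OF assms(1)]], rule that)
  have "x \<in> k ` (U \<times> carrier G)" "y \<in> k ` (U \<times> carrier G)"
    unfolding U(2) using assms U(1) by simp_all
  then obtain u \<gamma> u' \<delta> where x: "u \<in> U" "\<gamma> \<in> carrier G" "x = k (u, \<gamma>)"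
    and y: "u' \<in> U" "\<delta> \<in> carrier G" "y = k (u', \<delta>)" by auto
  have "u' = u" using assms(3) U(3) x y by metis
  moreover have "\<gamma> \<otimes> (inv \<gamma> \<otimes> \<delta>) = \<delta>" using x(2) y(2) by (simp add: m_assoc[symmetric])
  ultimately have "y = r x (inv \<gamma> \<otimes> \<delta>)"
    using U(4)[OF x(1,2), of "inv \<gamma> \<otimes> \<delta>"] x y by simp
  then show ?thesis by (rule that[rotated]) (use x y in simp)
qed

lemma act_free:
  assumes "x \<in> topspace X" "\<gamma> \<in> carrier G" "r x \<gamma> = x" shows "\<gamma> = \<one>"
proof -
  obtain U k where U: "p x \<in> U" "k ` (U \<times> carrier G) = {x \<in> topspace X. p x \<in> U}"
    "inj_on k (U \<times> carrier G)"
    "\<And>u \<gamma>. u \<in> U \<Longrightarrow> \<gamma> \<in> carrier G \<Longrightarrow> p (k (u, \<gamma>)) = u"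
    "\<And>u \<gamma> \<delta>. u \<in> U \<Longrightarrow> \<gamma> \<in> carrier G \<Longrightarrow> \<delta> \<in> carrier G \<Longrightarrow> k (u, \<gamma> \<otimes> \<delta>) = r (k (u, \<gamma>)) \<delta>"
    by (rule trivialization[OF proj_in[OF assms(1)]], rule that)
  have "x \<in> k ` (U \<times> carrier G)" unfolding U(2) using assms U(1) by simp
  then obtain u \<delta> where x: "u \<in> U" "\<delta> \<in> carrier G" "x = k (u, \<delta>)" by auto
  have "k (u, \<delta> \<otimes> \<gamma>) = k (u, \<delta>)" using U(5)[OF x(1,2) assms(2)] x(3) assms(3) by simp
  then have "(u, \<delta> \<otimes> \<gamma>) = (u, \<delta>)"
    by (rule inj_onD[OF U(3)]) (use x assms(2) in simp_all)
  then show ?thesis using x(2) assms(2) by simp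
qed

lemma proj_open: "openin X V \<Longrightarrow> openin B (p ` V)"
proof (subst openin_subopen, intro ballI)
  fix b assume V: "openin X V" and "b \<in> p ` V"
  then obtain x where x: "x \<in> V" "b = p x" by blast
  have xX: "x \<in> topspace X" using openin_subset[OF V] x(1) by blast
  obtain U k where U: "openin B U" "p x \<in> U" "k ` (U \<times> carrier G) = {x \<in> topspace X. p x \<in> U}"
    "\<And>u \<gamma>. u \<in> U \<Longrightarrow> \<gamma> \<in> carrier G \<Longrightarrow> p (k (u, \<gamma>)) = u"
    "\<And>V \<gamma>. openin X V \<Longrightarrow> \<gamma> \<in> carrier G \<Longrightarrow> openin B {u \<in> U. k (u, \<gamma>) \<in> V}"
    by (rule trivialization[OF proj_in[OF xX]], rule that)
  have "x \<in> k ` (U \<times> carrier G)" unfolding U(3) using xX U(2) by simp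
  then obtain u \<gamma> where u: "u \<in> U" "\<gamma> \<in> carrier G" "x = k (u, \<gamma>)" by auto
  have "{u \<in> U. k (u, \<gamma>) \<in> V} \<subseteq> p ` V"
  proof
    fix v assume v: "v \<in> {u \<in> U. k (u, \<gamma>) \<in> V}"
    then have "v = p (k (v, \<gamma>))" using U(4) u(2) by simp
    then show "v \<in> p ` V" using v by blast
  qed
  moreover have "b \<in> {u \<in> U. k (u, \<gamma>) \<in> V}" using x u U(4)[OF u(1,2)] by simp
  ultimately show "\<exists>T. openin B T \<and> b \<in> T \<and> T \<subseteq> p ` V" using U(5)[OF V u(2)] by blast
qed

text \<open>A slice of a local trivialization with fixed group coordinate.\<close>

lemma sheet:
  assumes x: "x \<in> topspace X" obtains S where "openin X S" "x \<in> S" "inj_on p S"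
proof -
  obtain U k where U: "p x \<in> U" "k ` (U \<times> carrier G) = {x \<in> topspace X. p x \<in> U}"
    "\<And>u \<gamma>. u \<in> U \<Longrightarrow> \<gamma> \<in> carrier G \<Longrightarrow> p (k (u, \<gamma>)) = u"
    "\<And>\<gamma>. \<gamma> \<in> carrier G \<Longrightarrow> openin X (k ` (U \<times> {\<gamma>}))"
    by (rule trivialization[OF proj_in[OF x]], rule that)
  have "x \<in> k ` (U \<times> carrier G)" unfolding U(2) using x U(1) by simp
  then obtain u \<gamma> where u: "u \<in> U" "\<gamma> \<in> carrier G" "x = k (u, \<gamma>)" by auto
  have "inj_on p (k ` (U \<times> {\<gamma>}))"
  proof (rule inj_onI)
    fix y z assume "y \<in> k ` (U \<times> {\<gamma>})" "z \<in> k ` (U \<times> {\<gamma>})" "p y = p z"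
    then obtain v w where "v \<in> U" "w \<in> U" "y = k (v, \<gamma>)" "z = k (w, \<gamma>)" "p y = p z" by auto
    then show "y = z" using U(3)[of v \<gamma>] U(3)[of w \<gamma>] u(2) by simp
  qed
  with U(4)[OF u(2)] u show ?thesis using that by blast
qed

end

text \<open>Two points of a fibre of X differ by some \<gamma>; if their images agree, equivariance
  makes \<gamma> fix a point of Y, where the action is free.\<close>

lemma principal_map_unique:
  fixes G :: "'g monoid"
  assumes X: "bundle_over G X B p r" and Y: "bundle_over G Y C q s"
    and \<psi>: "\<And>x. x \<in> topspace X \<Longrightarrow> \<psi> x \<in> topspace Y"
      "\<And>x \<gamma>. x \<in> topspace X \<Longrightarrow> \<gamma> \<in> carrier G \<Longrightarrow> \<psi> (r x \<gamma>) = s (\<psi> x) \<gamma>"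
    and xy: "x \<in> topspace X" "y \<in> topspace X" "p x = p y" "\<psi> x = \<psi> y"
  shows "x = y"
proof -
  interpret X: bundle_over G X B p r by (rule X)
  interpret Y: bundle_over G Y C q s by (rule Y)
  obtain \<gamma> where \<gamma>: "\<gamma> \<in> carrier G" "y = r x \<gamma>" by (rule X.fibre_transitive[OF xy(1-3)])
  have "s (\<psi> x) \<gamma> = \<psi> x" using \<psi>(2)[OF xy(1) \<gamma>(1)] xy(4) \<gamma>(2) by simp
  from Y.act_free[OF \<psi>(1)[OF xy(1)] \<gamma>(1) this] show ?thesis using \<gamma>(2) X.act_one[OF xy(1)] by simp
qed

text \<open>Continuity of the lift is local: near a point it is the inverse of the projection restricted to a
  sheet, because the map to \<open>Y\<close> separates the points of each fibre.\<close>

lemma principal_lift: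
  fixes G :: "'g monoid"
  assumes X: "bundle_over G X B p r" and X': "bundle_over G X' B' p' r'" and Y: "bundle_over G Y C q s"
    and \<phi>: "continuous_map B' B \<phi>"
    and \<psi>: "continuous_map X Y \<psi>" "\<And>x. x \<in> topspace X \<Longrightarrow> q (\<psi> x) = \<beta> (p x)"
      "\<And>x \<gamma>. x \<in> topspace X \<Longrightarrow> \<gamma> \<in> carrier G \<Longrightarrow> \<psi> (r x \<gamma>) = s (\<psi> x) \<gamma>"
    and \<psi>': "continuous_map X' Y \<psi>'" "\<And>x. x \<in> topspace X' \<Longrightarrow> q (\<psi>' x) = \<beta> (\<phi> (p' x))"
      "\<And>x \<gamma>. x \<in> topspace X' \<Longrightarrow> \<gamma> \<in> carrier G \<Longrightarrow> \<psi>' (r' x \<gamma>) = s (\<psi>' x) \<gamma>"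
  obtains \<kappa> where "continuous_map X' X \<kappa>" "\<forall>x\<in>topspace X'. p (\<kappa> x) = \<phi> (p' x)"
    "\<forall>x\<in>topspace X'. \<psi> (\<kappa> x) = \<psi>' x"
    "\<forall>x\<in>topspace X'. \<forall>\<gamma>\<in>carrier G. \<kappa> (r' x \<gamma>) = r (\<kappa> x) \<gamma>"
proof -
  interpret X: bundle_over G X B p r by (rule X)
  interpret X': bundle_over G X' B' p' r' by (rule X')
  interpret Y: bundle_over G Y C q s by (rule Y)
  have \<psi>Y: "\<psi> x \<in> topspace Y" if "x \<in> topspace X" for x
    using continuous_map_image_subset_topspace[OF \<psi>(1)] that by blast
  have \<psi>'Y: "\<psi>' x \<in> topspace Y" if "x \<in> topspace X'" for x
    using continuous_map_image_subset_topspace[OF \<psi>'(1)] that by blast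
  have \<phi>B: "\<phi> b \<in> topspace B" if "b \<in> topspace B'" for b
    using continuous_map_image_subset_topspace[OF \<phi>] that by blast
  have unique: "x = y" if xy: "x \<in> topspace X" "y \<in> topspace X" "p x = p y" "\<psi> x = \<psi> y" for x y
    by (rule principal_map_unique[where \<psi> = \<psi> and s = s and r = r, OF X Y \<psi>Y \<psi>(3) xy])
  \<comment> \<open>Any point over the right base point has the correct image up to the action, and
    moving it by that group element corrects the image without changing the projection.\<close>
  have ex: "\<exists>x. x \<in> topspace X \<and> p x = \<phi> (p' x') \<and> \<psi> x = \<psi>' x'" if x': "x' \<in> topspace X'" for x'
  proof -
    obtain x where x: "x \<in> topspace X" "p x = \<phi> (p' x')"
      by (rule X.proj_surj[OF \<phi>B[OF X'.proj_in[OF x']]])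
    have "q (\<psi> x) = q (\<psi>' x')" using \<psi>(2)[OF x(1)] \<psi>'(2)[OF x'] x(2) by simp
    then obtain \<gamma> where \<gamma>: "\<gamma> \<in> carrier G" "\<psi>' x' = s (\<psi> x) \<gamma>"
      by (rule Y.fibre_transitive[OF \<psi>Y[OF x(1)] \<psi>'Y[OF x']])
    have "r x \<gamma> \<in> topspace X" "p (r x \<gamma>) = \<phi> (p' x')" "\<psi> (r x \<gamma>) = \<psi>' x'"
      using X.act_in[OF x(1) \<gamma>(1)] X.act_proj[OF x(1) \<gamma>(1)] \<psi>(3)[OF x(1) \<gamma>(1)] x(2) \<gamma>(2) by simp_all
    then show ?thesis by blast
  qed
  define \<kappa> where "\<kappa> x' = (SOME x. x \<in> topspace X \<and> p x = \<phi> (p' x') \<and> \<psi> x = \<psi>' x')" for x'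
  have \<kappa>: "\<kappa> x' \<in> topspace X" "p (\<kappa> x') = \<phi> (p' x')" "\<psi> (\<kappa> x') = \<psi>' x'" if "x' \<in> topspace X'" for x'
    using someI_ex[OF ex[OF that]] unfolding \<kappa>_def by blast+
  show ?thesis
  proof (rule that[of \<kappa>])
    show "continuous_map X' X \<kappa>"
      unfolding continuous_map_def
    proof (intro conjI allI impI funcsetI)
      fix V assume V: "openin X V"
      show "openin X' {x' \<in> topspace X'. \<kappa> x' \<in> V}"
      proof (subst openin_subopen, intro ballI)
        fix x0 assume "x0 \<in> {x' \<in> topspace X'. \<kappa> x' \<in> V}"
        then have x0: "x0 \<in> topspace X'" "\<kappa> x0 \<in> V" by simp_all
        obtain S where S: "openin Y S" "\<psi>' x0 \<in> S" "inj_on q S" by (rule Y.sheet[OF \<psi>'Y[OF x0(1)]])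
        define W where "W = V \<inter> {x \<in> topspace X. \<psi> x \<in> S}"
        have W: "openin X W" unfolding W_def
          by (rule openin_Int[OF V openin_continuous_map_preimage[OF \<psi>(1) S(1)]])
        have cont: "continuous_map X' B (\<phi> \<circ> p')"
          by (rule continuous_map_compose[OF X'.proj_continuous \<phi>])
        \<comment> \<open>Over T there is a point x of W above \<open>\<phi> (p' x')\<close>. Its
          image and \<psi>' x' both lie in the sheet S and have the same projection, so they are
          equal; separation of fibres then gives x = \<kappa> x'.\<close>
        define T where "T = {x' \<in> topspace X'. (\<phi> \<circ> p') x' \<in> p ` W} \<inter> {x' \<in> topspace X'. \<psi>' x' \<in> S}"
        have "openin X' T" unfolding T_def
          by (rule openin_Int[OF openin_continuous_map_preimage[OF cont X.proj_open[OF W]]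
                openin_continuous_map_preimage[OF \<psi>'(1) S(1)]])
        moreover have "x0 \<in> T"
        proof -
          have "\<kappa> x0 \<in> W" using \<kappa>[OF x0(1)] x0(2) S(2) by (simp add: W_def)
          then have "\<phi> (p' x0) \<in> p ` W" using \<kappa>(2)[OF x0(1)] by (metis imageI)
          then show ?thesis using x0 S(2) by (simp add: T_def)
        qed
        moreover have "T \<subseteq> {x' \<in> topspace X'. \<kappa> x' \<in> V}"
        proof
          fix x' assume "x' \<in> T"
          then have x': "x' \<in> topspace X'" "\<psi>' x' \<in> S" and "\<phi> (p' x') \<in> p ` W" by (simp_all add: T_def)
          then obtain x where x: "x \<in> W" "p x = \<phi> (p' x')" by (metis imageE)
          have xX: "x \<in> topspace X" "\<psi> x \<in> S" "x \<in> V" using x(1) by (simp_all add: W_def)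
          have "q (\<psi> x) = q (\<psi>' x')" using \<psi>(2)[OF xX(1)] \<psi>'(2)[OF x'(1)] x(2) by simp
          from inj_onD[OF S(3) this xX(2) x'(2)] have "\<psi> x = \<psi> (\<kappa> x')" using \<kappa>(3)[OF x'(1)] by simp
          with unique[OF xX(1) \<kappa>(1)[OF x'(1)]] x(2) \<kappa>(2)[OF x'(1)] have "x = \<kappa> x'" by simp
          with xX(3) x'(1) show "x' \<in> {x' \<in> topspace X'. \<kappa> x' \<in> V}" by simp
        qed
        ultimately show "\<exists>T. openin X' T \<and> x0 \<in> T \<and> T \<subseteq> {x' \<in> topspace X'. \<kappa> x' \<in> V}" by blast
      qed
    qed (rule \<kappa>(1))
    show "\<forall>x\<in>topspace X'. p (\<kappa> x) = \<phi> (p' x)" "\<forall>x\<in>topspace X'. \<psi> (\<kappa> x) = \<psi>' x"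
      using \<kappa>(2,3) by simp_all
    show "\<forall>x\<in>topspace X'. \<forall>\<gamma>\<in>carrier G. \<kappa> (r' x \<gamma>) = r (\<kappa> x) \<gamma>"
    proof (intro ballI)
      fix x' \<gamma> assume x': "x' \<in> topspace X'" and \<gamma>: "\<gamma> \<in> carrier G"
      note x'\<gamma> = X'.act_in[OF x' \<gamma>]
      show "\<kappa> (r' x' \<gamma>) = r (\<kappa> x') \<gamma>"
      proof (rule unique[OF \<kappa>(1)[OF x'\<gamma>] X.act_in[OF \<kappa>(1)[OF x'] \<gamma>]])
        show "p (\<kappa> (r' x' \<gamma>)) = p (r (\<kappa> x') \<gamma>)"
          by (simp only: \<kappa>(2)[OF x'\<gamma>] X.act_proj[OF \<kappa>(1)[OF x'] \<gamma>] \<kappa>(2)[OF x'] X'.act_proj[OF x' \<gamma>])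
        show "\<psi> (\<kappa> (r' x' \<gamma>)) = \<psi> (r (\<kappa> x') \<gamma>)"
          by (simp only: \<kappa>(3)[OF x'\<gamma>] \<psi>(3)[OF \<kappa>(1)[OF x'] \<gamma>] \<kappa>(3)[OF x'] \<psi>'(3)[OF x' \<gamma>])
      qed
    qed
  qed
qed

section \<open>Pullbacks along isogenies\<close>

lemma elliptic_bundleD:
  fixes G :: "'g monoid"
  assumes "group G" "elliptic_bundle G P"
  shows "complex_lattice (base_lattice P)"
    "bundle_over G (total_space P) (torus (base_lattice P)) (bundle_proj P) (bundle_act P)"
  using assms by (simp_all add: elliptic_bundle_def complex_lattice_def bundle_over_def bundle_over_axioms_def)

lemma bundle_map_topspace:
  assumes "bundle_map G m Q P \<psi>" "x \<in> topspace (total_space Q)"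
  shows "\<psi> x \<in> topspace (total_space P)"
proof -
  have "continuous_map (total_space Q) (total_space P) \<psi>" using assms(1) by (simp add: bundle_map_def)
  from continuous_map_image_subset_topspace[OF this] assms(2) show ?thesis by blast
qed

text \<open>Cellularity is a condition on the image alone, so precomposition with any bundle map
  preserves it.\<close>

lemma classifying_maps_pullback:
  assumes G: "group G" and Q: "elliptic_bundle G Q" and \<psi>: "bundle_map G m Q P \<psi>"
    and c: "c \<in> classifying_maps G D P"
  shows "restrict (c \<circ> \<psi>) (topspace (total_space Q)) \<in> classifying_maps G D Q"
proof -
  interpret Q: bundle_over G "total_space Q" "torus (base_lattice Q)" "bundle_proj Q" "bundle_act Q"
    by (rule elliptic_bundleD[OF G Q])
  note top = bundle_map_topspace[OF \<psi>]
  have \<psi>': "continuous_map (total_space Q) (total_space P) \<psi>"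
    "\<And>x \<gamma>. x \<in> topspace (total_space Q) \<Longrightarrow> \<gamma> \<in> carrier G \<Longrightarrow> \<psi> (bundle_act Q x \<gamma>) = bundle_act P (\<psi> x) \<gamma>"
    using \<psi> by (simp_all add: bundle_map_def)
  have c': "continuous_map (total_space P) (EG D) c"
     "\<And>x \<gamma>. x \<in> topspace (total_space P) \<Longrightarrow> \<gamma> \<in> carrier G \<Longrightarrow> c (bundle_act P x \<gamma>) = EG_act D (c x) \<gamma>"
     "c ` topspace (total_space P) \<subseteq> skeleton (EG_cells D) 2"
    using c by (simp_all add: classifying_maps_def)
  have "continuous_map (total_space Q) (EG D) (restrict (c \<circ> \<psi>) (topspace (total_space Q)))"
    by (rule continuous_map_eq[OF continuous_map_compose[OF \<psi>'(1) c'(1)]]) simp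
  moreover have "(restrict (c \<circ> \<psi>) (topspace (total_space Q))) ` topspace (total_space Q) \<subseteq> skeleton (EG_cells D) 2"
  proof (rule image_subsetI)
    fix x assume x: "x \<in> topspace (total_space Q)"
    show "restrict (c \<circ> \<psi>) (topspace (total_space Q)) x \<in> skeleton (EG_cells D) 2"
      using subsetD[OF c'(3) imageI[OF top[OF x]]] x by simp
  qed
  moreover have "restrict (c \<circ> \<psi>) (topspace (total_space Q)) (bundle_act Q x \<gamma>)
      = EG_act D (restrict (c \<circ> \<psi>) (topspace (total_space Q)) x) \<gamma>"
    if "x \<in> topspace (total_space Q)" "\<gamma> \<in> carrier G" for x \<gamma>
    using Q.act_in[OF that] that by (simp add: \<psi>'(2)[OF that] c'(2)[OF top[OF that(1)] that(2)])
  ultimately show ?thesis by (simp add: classifying_maps_def)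
qed

text \<open>On the base, multiplication by m' factors as m'/m followed by m. A bundle map identifies
  its source with a pullback of its target, so the factorisation lifts to total spaces.\<close>

lemma bundle_map_factor:
  fixes G :: "'g monoid"
  assumes G: "group G" and P: "elliptic_bundle G P" and Q: "elliptic_bundle G Q" and Q': "elliptic_bundle G Q'"
    and \<psi>: "bundle_map G m Q P \<psi>" and \<psi>': "bundle_map G m' Q' P \<psi>'"
    and m: "m \<noteq> 0" and sub: "(\<lambda>z. m' / m * z) ` base_lattice Q' \<subseteq> base_lattice Q"
  obtains \<kappa> where "bundle_map G (m' / m) Q' Q \<kappa>" "\<forall>x\<in>topspace (total_space Q'). \<psi> (\<kappa> x) = \<psi>' x"
proof -
  interpret LP: complex_lattice "base_lattice P" by (rule elliptic_bundleD[OF G P])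
  interpret LQ: complex_lattice "base_lattice Q" by (rule elliptic_bundleD[OF G Q])
  interpret LQ': complex_lattice "base_lattice Q'" by (rule elliptic_bundleD[OF G Q'])
  note bQ = elliptic_bundleD(2)[OF G Q] and bQ' = elliptic_bundleD(2)[OF G Q'] and bP = elliptic_bundleD(2)[OF G P]
  interpret bQ': bundle_over G "total_space Q'" "torus (base_lattice Q')" "bundle_proj Q'" "bundle_act Q'"
    by (rule bQ')
  have 1: "(\<lambda>z. m * z) ` base_lattice Q \<subseteq> base_lattice P" "(\<lambda>z. m' * z) ` base_lattice Q' \<subseteq> base_lattice P"
    "continuous_map (total_space Q) (total_space P) \<psi>" "continuous_map (total_space Q') (total_space P) \<psi>'"
    using \<psi> \<psi>' by (simp_all add: bundle_map_def)
  have 2: "bundle_proj P (\<psi> x) = torus_mult (base_lattice P) m (bundle_proj Q x)"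
     "\<gamma> \<in> carrier G \<Longrightarrow> \<psi> (bundle_act Q x \<gamma>) = bundle_act P (\<psi> x) \<gamma>" if "x \<in> topspace (total_space Q)" for x \<gamma>
    using \<psi> that by (simp_all add: bundle_map_def)
  have 3: "bundle_proj P (\<psi>' x) = torus_mult (base_lattice P) m (torus_mult (base_lattice Q) (m' / m) (bundle_proj Q' x))"
    if x: "x \<in> topspace (total_space Q')" for x
  proof -
    obtain z where z: "bundle_proj Q' x = torus_point (base_lattice Q') z"
      using bQ'.proj_in[OF x] by (auto simp: topspace_torus)
    have "bundle_proj P (\<psi>' x) = torus_mult (base_lattice P) m' (bundle_proj Q' x)"
      using \<psi>' x by (simp add: bundle_map_def)
    then show ?thesis
      using m by (simp add: z LP.torus_mult_point[OF LQ'.complex_lattice_axioms 1(2)]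
        LQ.torus_mult_point[OF LQ'.complex_lattice_axioms sub] LP.torus_mult_point[OF LQ.complex_lattice_axioms 1(1)])
  qed
  have 4: "\<psi>' (bundle_act Q' x \<gamma>) = bundle_act P (\<psi>' x) \<gamma>"
    if "x \<in> topspace (total_space Q')" "\<gamma> \<in> carrier G" for x \<gamma>
    using \<psi>' that by (simp add: bundle_map_def)
  obtain \<kappa> where \<kappa>: "continuous_map (total_space Q') (total_space Q) \<kappa>"
    "\<forall>x\<in>topspace (total_space Q'). bundle_proj Q (\<kappa> x) = torus_mult (base_lattice Q) (m' / m) (bundle_proj Q' x)"
    "\<forall>x\<in>topspace (total_space Q'). \<psi> (\<kappa> x) = \<psi>' x"
    "\<forall>x\<in>topspace (total_space Q'). \<forall>\<gamma>\<in>carrier G. \<kappa> (bundle_act Q' x \<gamma>) = bundle_act Q (\<kappa> x) \<gamma>"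
    by (rule principal_lift[where \<beta> = "torus_mult (base_lattice P) m" and \<psi> = \<psi> and \<psi>' = \<psi>',
          OF bQ bQ' bP LQ.continuous_torus_mult[OF LQ'.complex_lattice_axioms sub] 1(3) 2 1(4) 3 4])
  have "bundle_map G (m' / m) Q' Q \<kappa>"
    unfolding bundle_map_def
  proof (intro conjI ballI sub \<kappa>(1))
    fix x assume x: "x \<in> topspace (total_space Q')"
    show "bundle_proj Q (\<kappa> x) = torus_mult (base_lattice Q) (m' / m) (bundle_proj Q' x)"
      by (rule bspec[OF \<kappa>(2) x])
    show "\<kappa> (bundle_act Q' x \<gamma>) = bundle_act Q (\<kappa> x) \<gamma>" if "\<gamma> \<in> carrier G" for \<gamma>
      by (rule bspec[OF bspec[OF \<kappa>(4) x] that])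
  qed
  then show ?thesis using \<kappa>(3) by (rule that)
qed

text \<open>If m and m' carry the two lattices to the same sublattice, each bundle map factors
  through the other. The factors are mutually inverse isomorphisms over P, and compatibility of the
  section with isomorphisms makes the two pushforwards equal.\<close>

lemma pushforward_pullback_unique:
  fixes G :: "'g monoid" and P Q Q' :: "((complex \<times> 'g) set, 'g) pbundle"
  assumes G: "group G" and F: "elliptic_section G D \<alpha> F"
    and P: "elliptic_bundle G P" and Q: "elliptic_bundle G Q" and Q': "elliptic_bundle G Q'"
    and \<psi>: "bundle_map G m Q P \<psi>" and \<psi>': "bundle_map G m' Q' P \<psi>'"
    and m: "m \<noteq> 0" "m' \<noteq> 0" and L: "(\<lambda>z. m * z) ` base_lattice Q = (\<lambda>z. m' * z) ` base_lattice Q'"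
  shows "pushforward G D Q P \<psi> (F Q) = pushforward G D Q' P \<psi>' (F Q')"
proof -
  have sub: "(\<lambda>z. k' / k * z) ` \<Lambda>' = \<Lambda>" if "(\<lambda>z. k * z) ` \<Lambda> = (\<lambda>z. k' * z) ` \<Lambda>'" "k \<noteq> 0"
    for k k' :: complex and \<Lambda> \<Lambda>'
  proof -
    have "(\<lambda>z. k' / k * z) ` \<Lambda>' = (\<lambda>z. z / k) ` ((\<lambda>z. k' * z) ` \<Lambda>')" by (simp add: image_image)
    also have "\<dots> = (\<lambda>z. z / k) ` ((\<lambda>z. k * z) ` \<Lambda>)" by (simp only: that(1))
    also have "\<dots> = \<Lambda>" using that(2) by (simp add: image_image)
    finally show ?thesis .
  qed
  have s1: "(\<lambda>z. m' / m * z) ` base_lattice Q' = base_lattice Q" by (rule sub[OF L m(1)])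
  have s2: "(\<lambda>z. m / m' * z) ` base_lattice Q = base_lattice Q'" by (rule sub[OF L[symmetric] m(2)])
  obtain \<kappa> where \<kappa>: "bundle_map G (m' / m) Q' Q \<kappa>"
    "\<forall>x\<in>topspace (total_space Q'). \<psi> (\<kappa> x) = \<psi>' x"
    by (rule bundle_map_factor[OF G P Q Q' \<psi> \<psi>' m(1) equalityD1[OF s1]])
  obtain \<kappa>' where \<kappa>': "bundle_map G (m / m') Q Q' \<kappa>'"
    "\<forall>x\<in>topspace (total_space Q). \<psi>' (\<kappa>' x) = \<psi> x"
    by (rule bundle_map_factor[OF G P Q' Q \<psi>' \<psi> m(2) equalityD1[OF s2]])
  note \<kappa>\<psi> = bspec[OF \<kappa>(2)] bspec[OF \<kappa>'(2)]
  note bQ = elliptic_bundleD[OF G Q] and bQ' = elliptic_bundleD[OF G Q'] and bP = elliptic_bundleD(2)[OF G P]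
  \<comment> \<open>The composite covers the identity, because u' u = 1, and does not alter f. Since
    f separates the points of a fibre, the composite is the identity.\<close>
  have inverse: "\<theta>' (\<theta> x) = x"
    if bA: "complex_lattice (base_lattice A)"
        "bundle_over G (total_space A) (torus (base_lattice A)) (bundle_proj A) (bundle_act A)"
      and bB: "complex_lattice (base_lattice B)"
      and \<theta>: "bundle_map G u A B \<theta>" and \<theta>': "bundle_map G u' B A \<theta>'" and uu: "u' * u = 1"
      and f: "bundle_map G k A P f" "\<And>x. x \<in> topspace (total_space A) \<Longrightarrow> f (\<theta>' (\<theta> x)) = f x"
      and x: "x \<in> topspace (total_space A)"
    for A B \<theta> \<theta>' u u' k f x
  proof (rule principal_map_unique[OF bA(2) bP])
    have \<theta>x: "\<theta> x \<in> topspace (total_space B)" by (rule bundle_map_topspace[OF \<theta> x])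
    show "\<theta>' (\<theta> x) \<in> topspace (total_space A)" by (rule bundle_map_topspace[OF \<theta>' \<theta>x])
    show "f (\<theta>' (\<theta> x)) = f x" by (rule f(2)[OF x])
    obtain z where z: "bundle_proj A x = torus_point (base_lattice A) z"
      using bundle_over.proj_in[OF bA(2) x] by (auto simp: topspace_torus)
    have l: "(\<lambda>z. u * z) ` base_lattice A \<subseteq> base_lattice B" "(\<lambda>z. u' * z) ` base_lattice B \<subseteq> base_lattice A"
      using \<theta> \<theta>' by (simp_all add: bundle_map_def)
    have "bundle_proj A (\<theta>' (\<theta> x)) = torus_mult (base_lattice A) u' (bundle_proj B (\<theta> x))"
      using \<theta>' \<theta>x by (simp add: bundle_map_def)
    also have "bundle_proj B (\<theta> x) = torus_mult (base_lattice B) u (bundle_proj A x)"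
      using \<theta> x by (simp add: bundle_map_def)
    also have "torus_mult (base_lattice A) u' \<dots> = torus_point (base_lattice A) (u' * u * z)"
      by (simp add: z complex_lattice.torus_mult_point[OF bB bA(1) l(1)]
        complex_lattice.torus_mult_point[OF bA(1) bB l(2)] mult.assoc)
    finally show "bundle_proj A (\<theta>' (\<theta> x)) = bundle_proj A x" by (simp add: z uu)
    show "f y \<in> topspace (total_space P)" if "y \<in> topspace (total_space A)" for y
      by (rule bundle_map_topspace[OF f(1) that])
    show "f (bundle_act A y \<gamma>) = bundle_act P (f y) \<gamma>" if "y \<in> topspace (total_space A)" "\<gamma> \<in> carrier G" for y \<gamma>
      using f(1) that by (simp add: bundle_map_def)
  qed (rule x)
  have "\<kappa>' (\<kappa> x) = x" if x: "x \<in> topspace (total_space Q')" for x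
    by (rule inverse[OF bQ' bQ(1) \<kappa>(1) \<kappa>'(1) _ \<psi>' _ x])
       (use m in \<open>simp_all add: \<kappa>\<psi>(2)[OF bundle_map_topspace[OF \<kappa>(1)]] \<kappa>\<psi>(1)\<close>)
  moreover have "\<kappa> (\<kappa>' x) = x" if x: "x \<in> topspace (total_space Q)" for x
    by (rule inverse[OF bQ bQ'(1) \<kappa>'(1) \<kappa>(1) _ \<psi> _ x])
       (use m in \<open>simp_all add: \<kappa>\<psi>(1)[OF bundle_map_topspace[OF \<kappa>'(1)]] \<kappa>\<psi>(2)\<close>)
  moreover have "continuous_map (total_space Q') (total_space Q) \<kappa>" "continuous_map (total_space Q) (total_space Q') \<kappa>'"
    using \<kappa>(1) \<kappa>'(1) by (simp_all add: bundle_map_def)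
  ultimately have "homeomorphic_maps (total_space Q') (total_space Q) \<kappa> \<kappa>'"
    by (simp add: homeomorphic_maps_def)
  then have "homeomorphic_map (total_space Q') (total_space Q) \<kappa>"
    by (rule homeomorphic_maps_imp_map)
  then have "bundle_iso G (m' / m) Q' Q \<kappa>"
    using \<kappa>(1) m s1 by (simp add: bundle_iso_def)
  \<comment> \<open>The only use of the section property: invariance under the isomorphism
    \<kappa>.\<close>
  then have FQ: "F Q = pushforward G D Q' Q \<kappa> (F Q')"
    using F Q Q' unfolding elliptic_section_def by blast
  show ?thesis
  proof
    fix c
    show "pushforward G D Q P \<psi> (F Q) c = pushforward G D Q' P \<psi>' (F Q') c"
    proof (cases "c \<in> classifying_maps G D P")
      case True
      have "restrict (restrict (c \<circ> \<psi>) (topspace (total_space Q)) \<circ> \<kappa>) (topspace (total_space Q'))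
          = restrict (c \<circ> \<psi>') (topspace (total_space Q'))"
        by (rule restrict_ext) (simp add: \<kappa>\<psi>(1) bundle_map_topspace[OF \<kappa>(1)])
      then show ?thesis
        using True classifying_maps_pullback[OF G Q \<psi> True] by (simp add: FQ pushforward_def)
    qed (simp add: pushforward_def)
  qed
qed

section \<open>Twisted bundles\<close>

lemma (in group) int_pow_commutes:
  assumes "x \<in> carrier G" "y \<in> carrier G" "x \<otimes> y = y \<otimes> x"
  shows "x \<otimes> y [^] (m :: int) = y [^] m \<otimes> x"
proof -
  have nat: "x \<otimes> y [^] (i :: nat) = y [^] i \<otimes> x" for i
    by (rule group_commutes_pow[OF assms(3)[symmetric] assms(2,1), symmetric])
  have c: "y [^] (i :: nat) \<in> carrier G" for i using assms(2) by simp
  show ?thesis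
  proof (cases m rule: int_cases2)
    case (nonneg i)
    then show ?thesis using nat[of i] by (simp add: int_pow_int)
  next
    case (nonpos i)
    have "y [^] i \<otimes> x = x \<otimes> y [^] i" by (rule nat[symmetric])
    then have "x = inv (y [^] i) \<otimes> (x \<otimes> y [^] i)"
      using inv_solve_left[of x "y [^] i" "x \<otimes> y [^] i"] assms c by simp
    then have "x = (inv (y [^] i) \<otimes> x) \<otimes> y [^] i" using assms c by (simp add: m_assoc)
    then have "inv (y [^] i) \<otimes> x = x \<otimes> inv (y [^] i)"
      using inv_solve_right[of "inv (y [^] i) \<otimes> x" x "y [^] i"] assms c by simp
    then show ?thesis using assms(2) by (simp add: nonpos int_pow_neg_int)
  qed
qed

locale twisted = group G for G :: "'g monoid" (structure) +
  fixes g h :: 'g and \<tau> :: complex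
  assumes comm: "(g, h) \<in> commuting_pairs G" and \<tau>: "Im \<tau> > 0"
begin

abbreviation "T \<equiv> twist_class G g h \<tau>"
abbreviation "\<Lambda> \<equiv> lattice_span \<tau> 1"
abbreviation "P \<equiv> twisted_bundle G g h \<tau>"

definition w :: "int \<Rightarrow> int \<Rightarrow> complex" where "w k m = of_int m * \<tau> - of_int k"
definition act :: "int \<Rightarrow> int \<Rightarrow> 'g" where "act k m = g [^] k \<otimes> h [^] m"

lemma g: "g \<in> carrier G" and h: "h \<in> carrier G" and gh: "g \<otimes> h = h \<otimes> g"
  using comm by (simp_all add: commuting_pairs_def)

lemma act_in: "act k m \<in> carrier G"
  using g h by (simp add: act_def)

lemma act_0: "act 0 0 = \<one>"
  by (simp add: act_def)

text \<open>The holonomy is a homomorphism on Z^2 because g and h commute.\<close>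

lemma act_add: "act k m \<otimes> act k' m' = act (k + k') (m + m')"
proof -
  have c: "g [^] i \<in> carrier G" "h [^] i \<in> carrier G" for i :: int using g h by simp_all
  have "h \<otimes> g [^] k' = g [^] k' \<otimes> h" by (rule int_pow_commutes[OF h g gh[symmetric]])
  then have "h [^] m \<otimes> g [^] k' = g [^] k' \<otimes> h [^] m"
    by (rule int_pow_commutes[OF c(1) h, symmetric, OF sym])
  then have "g [^] k \<otimes> (h [^] m \<otimes> g [^] k') \<otimes> h [^] m' = g [^] k \<otimes> (g [^] k' \<otimes> h [^] m) \<otimes> h [^] m'"
    by simp
  then have "act k m \<otimes> act k' m' = (g [^] k \<otimes> g [^] k') \<otimes> (h [^] m \<otimes> h [^] m')"
    using c by (simp add: act_def m_assoc)
  then show ?thesis unfolding act_def int_pow_mult[OF g] int_pow_mult[OF h] .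
qed

lemma w_add: "w (k + k') (m + m') = w k m + w k' m'"
  by (simp add: w_def algebra_simps)

lemma w_0: "w 0 0 = 0"
  by (simp add: w_def)

lemma w_minus: "w (- k) (- m) = - w k m"
  by (simp add: w_def)

lemma range_w: "\<Lambda> = {w k m | k m. True}"
proof -
  have "x \<in> \<Lambda> \<longleftrightarrow> x \<in> {w k m | k m. True}" for x
  proof
    assume "x \<in> \<Lambda>"
    then obtain j k where "x = of_int j * \<tau> + of_int k * 1" unfolding lattice_span_def by blast
    then have "x = w (- k) j" by (simp add: w_def)
    then show "x \<in> {w k m | k m. True}" by blast
  next
    assume "x \<in> {w k m | k m. True}"
    then obtain k m where "x = w k m" by blast
    then have "x = of_int m * \<tau> + of_int (- k) * 1" by (simp add: w_def)
    then show "x \<in> \<Lambda>" unfolding lattice_span_def by blast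
  qed
  then show ?thesis by (rule Set.set_eqI)
qed

lemma class_eq: "T (z, \<gamma>) = {(z - w k m, act k m \<otimes> \<gamma>) | k m. True}"
  by (simp add: twist_class_def w_def act_def)

lemma class_self: "\<gamma> \<in> carrier G \<Longrightarrow> (z, \<gamma>) \<in> T (z, \<gamma>)"
  unfolding class_eq by (auto simp: act_0 w_0 intro!: exI[of _ 0])

lemma class_shift:
  assumes "\<gamma> \<in> carrier G" shows "T (z - w k m, act k m \<otimes> \<gamma>) = T (z, \<gamma>)"
proof -
  have "T (z - w k m, act k m \<otimes> \<gamma>) \<subseteq> T (z, \<gamma>)" if "\<gamma> \<in> carrier G" for z k m \<gamma>
  proof
    fix x assume "x \<in> T (z - w k m, act k m \<otimes> \<gamma>)"
    then obtain k' m' where x: "x = (z - w k m - w k' m', act k' m' \<otimes> (act k m \<otimes> \<gamma>))"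
      unfolding class_eq by blast
    have "x = (z - w (k' + k) (m' + m), act (k' + k) (m' + m) \<otimes> \<gamma>)"
      unfolding x w_add act_add[symmetric] using that act_in by (simp add: m_assoc)
    then show "x \<in> T (z, \<gamma>)" unfolding class_eq by blast
  qed
  \<comment> \<open>The reverse inclusion is the same one, applied to the shift by (-k, -m).\<close>
  from this[OF assms, of z k m] this[of "act k m \<otimes> \<gamma>" "z - w k m" "- k" "- m"] assms
  have "T (z - w k m, act k m \<otimes> \<gamma>) \<subseteq> T (z, \<gamma>)"
    "T (z - w k m - w (- k) (- m), act (- k) (- m) \<otimes> (act k m \<otimes> \<gamma>)) \<subseteq> T (z - w k m, act k m \<otimes> \<gamma>)"
    using act_in by simp_all
  moreover have "act (- k) (- m) \<otimes> (act k m \<otimes> \<gamma>) = \<gamma>"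
    using assms act_in act_add[of "- k" "- m" k m] by (simp add: m_assoc[symmetric] act_0)
  ultimately show ?thesis by (simp add: w_minus)
qed

lemma class_eq_iff:
  assumes "\<gamma> \<in> carrier G" "\<gamma>' \<in> carrier G"
  shows "T (z, \<gamma>) = T (z', \<gamma>') \<longleftrightarrow> (\<exists>k m. z' = z - w k m \<and> \<gamma>' = act k m \<otimes> \<gamma>)"
proof
  assume "T (z, \<gamma>) = T (z', \<gamma>')"
  then have "(z', \<gamma>') \<in> T (z, \<gamma>)" using class_self[OF assms(2)] by simp
  then show "\<exists>k m. z' = z - w k m \<and> \<gamma>' = act k m \<otimes> \<gamma>" unfolding class_eq by blast
qed (use class_shift[OF assms(1)] in auto)

lemma lattice: "lattice_basis \<Lambda> (-1) \<tau>" "complex_lattice \<Lambda>"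
proof -
  have "lattice_span \<tau> 1 = lattice_span (-1) \<tau>"
  proof -
    have "x \<in> lattice_span \<tau> 1 \<longleftrightarrow> x \<in> lattice_span (-1) \<tau>" for x
    proof
      assume "x \<in> lattice_span \<tau> 1"
      then obtain j k where "x = of_int j * \<tau> + of_int k * 1" unfolding lattice_span_def by blast
      then have "x = of_int (- k) * (-1) + of_int j * \<tau>" by simp
      then show "x \<in> lattice_span (-1) \<tau>" unfolding lattice_span_def by blast
    next
      assume "x \<in> lattice_span (-1) \<tau>"
      then obtain j k where "x = of_int j * (-1) + of_int k * \<tau>" unfolding lattice_span_def by blast
      then have "x = of_int k * \<tau> + of_int (- j) * 1" by simp
      then show "x \<in> lattice_span \<tau> 1" unfolding lattice_span_def by blast
    qed
    then show ?thesis by (rule Set.set_eqI)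
  qed
  then show "lattice_basis \<Lambda> (-1) \<tau>" using \<tau> by (simp add: lattice_basis_def)
  then show "complex_lattice \<Lambda>" unfolding complex_lattice_def by blast
qed

sublocale L: complex_lattice \<Lambda> by (rule lattice)

section \<open>The quotient topology and the principal bundle structure\<close>

lemma openin_total:
  "openin (total_space P) U \<longleftrightarrow> U \<subseteq> T ` (UNIV \<times> carrier G) \<and> (\<forall>\<gamma>\<in>carrier G. open {z. T (z, \<gamma>) \<in> U})"
  by (simp add: twisted_bundle_def topology_inverse'[OF istopology_twisted])

lemma topspace_total: "topspace (total_space P) = T ` (UNIV \<times> carrier G)"
proof (rule equalityI)
  show "topspace (total_space P) \<subseteq> T ` (UNIV \<times> carrier G)"
    using openin_topspace[of "total_space P"] by (simp only: openin_total)
  have "{z. T (z, \<gamma>) \<in> T ` (UNIV \<times> carrier G)} = UNIV" if "\<gamma> \<in> carrier G" for \<gamma>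
    using that by blast
  then have "openin (total_space P) (T ` (UNIV \<times> carrier G))" unfolding openin_total by simp
  then show "T ` (UNIV \<times> carrier G) \<subseteq> topspace (total_space P)" by (rule openin_subset)
qed

lemma class_in: "\<gamma> \<in> carrier G \<Longrightarrow> T (z, \<gamma>) \<in> topspace (total_space P)"
  unfolding topspace_total by simp

lemma total_cases:
  assumes "x \<in> topspace (total_space P)"
  obtains z \<gamma> where "\<gamma> \<in> carrier G" "x = T (z, \<gamma>)"
  using assms unfolding topspace_total by auto

lemma continuous_class:
  assumes "\<gamma> \<in> carrier G" shows "continuous_map euclidean (total_space P) (\<lambda>z. T (z, \<gamma>))"
  using assms by (simp add: continuous_map_def class_in openin_total)

lemma continuous_from_total:
  assumes "\<And>\<gamma>. \<gamma> \<in> carrier G \<Longrightarrow> continuous_map euclidean Y (\<lambda>z. f (T (z, \<gamma>)))"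
  shows "continuous_map (total_space P) Y f"
  unfolding continuous_map_def
proof (intro conjI allI impI funcsetI)
  fix x assume "x \<in> topspace (total_space P)"
  then obtain z \<gamma> where x: "\<gamma> \<in> carrier G" "x = T (z, \<gamma>)" by (rule total_cases)
  show "f x \<in> topspace Y"
    using continuous_map_image_subset_topspace[OF assms[OF x(1)]] unfolding x(2) by auto
next
  fix U assume U: "openin Y U"
  have "open {z. T (z, \<gamma>) \<in> {x \<in> topspace (total_space P). f x \<in> U}}" if \<gamma>: "\<gamma> \<in> carrier G" for \<gamma>
    using openin_continuous_map_preimage[OF assms[OF \<gamma>] U] by (simp add: class_in[OF \<gamma>])
  then show "openin (total_space P) {x \<in> topspace (total_space P). f x \<in> U}"
    unfolding openin_total by (auto simp: topspace_total)
qed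

lemma base_twisted: "base_lattice P = \<Lambda>"
  by (simp add: twisted_bundle_def)

lemma proj_class: "bundle_proj P (T (z, \<gamma>)) = torus_point \<Lambda> z"
proof -
  have "x \<in> fst ` T (z, \<gamma>) \<longleftrightarrow> x \<in> torus_point \<Lambda> z" for x
  proof
    assume "x \<in> fst ` T (z, \<gamma>)"
    then obtain k m where "x = z - w k m" unfolding class_eq by auto
    then have "x = z + w (- k) (- m)" by (simp add: w_minus)
    then show "x \<in> torus_point \<Lambda> z" unfolding torus_point_def range_w by blast
  next
    assume "x \<in> torus_point \<Lambda> z"
    then obtain k m where "x = z + w k m" unfolding torus_point_def range_w by blast
    then have "x = fst (z - w (- k) (- m), act (- k) (- m) \<otimes> \<gamma>)" by (simp add: w_minus)
    then show "x \<in> fst ` T (z, \<gamma>)" unfolding class_eq by blast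
  qed
  then have "fst ` T (z, \<gamma>) = torus_point \<Lambda> z" by (rule Set.set_eqI)
  then show ?thesis by (simp add: twisted_bundle_def)
qed

lemma act_class:
  assumes "\<gamma> \<in> carrier G" "\<delta> \<in> carrier G"
  shows "bundle_act P (T (z, \<gamma>)) \<delta> = T (z, \<gamma> \<otimes> \<delta>)"
proof -
  have "(\<lambda>(z, \<gamma>). (z, \<gamma> \<otimes> \<delta>)) ` T (z, \<gamma>) = {(z - w k m, act k m \<otimes> \<gamma> \<otimes> \<delta>) | k m. True}"
    unfolding class_eq by (force simp: image_iff)
  also have "\<dots> = T (z, \<gamma> \<otimes> \<delta>)" unfolding class_eq using assms act_in by (simp add: m_assoc)
  finally show ?thesis by (simp add: twisted_bundle_def)
qed

lemma continuous_discrete_product: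
  assumes "\<And>s. s \<in> S \<Longrightarrow> continuous_map A Y (\<lambda>x. f (x, s))"
  shows "continuous_map (prod_topology A (discrete_topology S)) Y f"
  unfolding continuous_map_def
proof (intro conjI allI impI funcsetI)
  fix q assume "q \<in> topspace (prod_topology A (discrete_topology S))"
  then obtain x s where "q = (x, s)" "x \<in> topspace A" "s \<in> S" by auto
  then show "f q \<in> topspace Y" using assms[of s] by (auto simp: continuous_map_def)
next
  fix U assume U: "openin Y U"
  have "{q \<in> topspace (prod_topology A (discrete_topology S)). f q \<in> U}
      = (\<Union>s\<in>S. {x \<in> topspace A. f (x, s) \<in> U} \<times> {s})" by auto
  moreover have "openin (prod_topology A (discrete_topology S)) ({x \<in> topspace A. f (x, s) \<in> U} \<times> {s})"
    if "s \<in> S" for s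
    unfolding openin_prod_Times_iff using openin_continuous_map_preimage[OF assms[OF that] U] that by simp
  ultimately show "openin (prod_topology A (discrete_topology S))
      {q \<in> topspace (prod_topology A (discrete_topology S)). f q \<in> U}"
    by (simp only:) (rule openin_Union, blast)
qed

text \<open>A small ball in the plane maps injectively to the torus; the inverse s lifts its image
  back to the ball, and (u, \<gamma>) goes to the class of (s u, \<gamma>).\<close>

lemma local_trivialization:
  assumes b: "b \<in> topspace (torus \<Lambda>)"
  shows "\<exists>U k. openin (torus \<Lambda>) U \<and> b \<in> U \<and>
        homeomorphic_map (prod_topology (subtopology (torus \<Lambda>) U) (discrete_topology (carrier G)))
                         (subtopology (total_space P) {x \<in> topspace (total_space P). bundle_proj P x \<in> U}) k \<and>
        (\<forall>u\<in>U. \<forall>\<gamma>\<in>carrier G. bundle_proj P (k (u, \<gamma>)) = u \<and>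
           (\<forall>\<delta>\<in>carrier G. k (u, \<gamma> \<otimes> \<delta>) = bundle_act P (k (u, \<gamma>)) \<delta>))"
proof -
  obtain z0 where z0: "b = torus_point \<Lambda> z0" using b by (auto simp: topspace_torus)
  obtain e where e: "e > 0" "\<And>w. w \<in> \<Lambda> \<Longrightarrow> cmod w < e \<Longrightarrow> w = 0" by (rule L.discrete, rule that)
  \<comment> \<open>Two points of this ball differ by less than e, hence by no nonzero lattice
    vector.\<close>
  define S where "S = ball z0 (e / 2)"
  have S: "open S" "z0 \<in> S" using e(1) by (simp_all add: S_def)
  let ?U = "torus_point \<Lambda> ` S"
  have U: "openin (torus \<Lambda>) ?U" "?U \<subseteq> topspace (torus \<Lambda>)"
    using L.openin_torus_image[OF S(1)] by (simp_all add: openin_subset)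
  have inj: "z = z'" if zz: "z \<in> S" "z' \<in> S" "torus_point \<Lambda> z = torus_point \<Lambda> z'" for z z'
  proof -
    have "cmod (z - z') < e" using zz(1,2) dist_triangle_half_r[of z0 z e z'] by (simp add: S_def dist_norm[symmetric])
    with e(2)[of "z - z'"] zz(3) show ?thesis by (simp add: L.torus_point_eq_iff)
  qed
  define s where "s = inv_into S (torus_point \<Lambda>)"
  have s: "s (torus_point \<Lambda> z) = z" if "z \<in> S" for z
    unfolding s_def by (rule inv_into_f_f[OF _ that]) (rule inj_onI, rule inj)
  have sU: "s u \<in> S" "torus_point \<Lambda> (s u) = u" if "u \<in> ?U" for u
    using that s by auto
  define k where "k = (\<lambda>(u, \<gamma>). T (s u, \<gamma>))"
  let ?A = "subtopology (torus \<Lambda>) ?U"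
  let ?Pr = "prod_topology ?A (discrete_topology (carrier G))"
  let ?V = "{x \<in> topspace (total_space P). bundle_proj P x \<in> ?U}"
  have topA: "topspace ?A = ?U" using U(2) by (simp add: Int_absorb1)
  have top: "topspace ?Pr = ?U \<times> carrier G" using topA by simp
  have topV: "topspace (subtopology (total_space P) ?V) = ?V" by (simp add: Int_absorb1)
  have kc: "continuous_map ?Pr (total_space P) k"
  proof (rule continuous_discrete_product)
    fix \<gamma> assume \<gamma>: "\<gamma> \<in> carrier G"
    show "continuous_map ?A (total_space P) (\<lambda>u. k (u, \<gamma>))"
      unfolding continuous_map_def
    proof (intro conjI allI impI funcsetI)
      show "k (u, \<gamma>) \<in> topspace (total_space P)" for u by (simp add: k_def class_in[OF \<gamma>])
      fix W assume "openin (total_space P) W"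
      then have "open {z. T (z, \<gamma>) \<in> W}" using \<gamma> by (simp add: openin_total)
      then have "openin (torus \<Lambda>) (torus_point \<Lambda> ` (S \<inter> {z. T (z, \<gamma>) \<in> W}))"
        by (intro L.openin_torus_image open_Int S(1))
      moreover have "torus_point \<Lambda> ` (S \<inter> {z. T (z, \<gamma>) \<in> W}) = {u \<in> topspace ?A. k (u, \<gamma>) \<in> W}"
        unfolding topA by (auto simp: k_def s)
      ultimately show "openin ?A {u \<in> topspace ?A. k (u, \<gamma>) \<in> W}"
        unfolding topA using openin_open_subtopology[OF U(1)] by auto
    qed
  qed
  have pk: "bundle_proj P (k (u, \<gamma>)) = u" if "u \<in> ?U" for u \<gamma>
    using sU(2)[OF that] by (simp add: k_def proj_class)
  have img: "k ` (?U \<times> carrier G) = ?V"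
  proof (intro equalityI subsetI)
    fix x assume "x \<in> k ` (?U \<times> carrier G)"
    then obtain u \<gamma> where "u \<in> ?U" "\<gamma> \<in> carrier G" "x = k (u, \<gamma>)" by auto
    then show "x \<in> ?V" using pk[of u \<gamma>] class_in[of \<gamma> "s u"] by (simp add: k_def)
  next
    fix x assume x: "x \<in> ?V"
    then obtain z \<gamma> where z: "\<gamma> \<in> carrier G" "x = T (z, \<gamma>)" using total_cases[of x] by blast
    with x obtain z' where z': "z' \<in> S" "torus_point \<Lambda> z = torus_point \<Lambda> z'" by (auto simp: proj_class)
    then have "z - z' \<in> \<Lambda>" by (simp add: L.torus_point_eq_iff)
    then obtain i m where "z - z' = w i m" unfolding range_w by blast
    from this[symmetric] have "z' = z - w i m" by simp
    \<comment> \<open>Any class over the ball has a representative whose first coordinate lies in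
      it, at the price of the holonomy of the translation.\<close>
    then have "x = T (z', act i m \<otimes> \<gamma>)" using z class_shift[OF z(1)] by simp
    also have "\<dots> = k (torus_point \<Lambda> z', act i m \<otimes> \<gamma>)" by (simp add: k_def s[OF z'(1)])
    finally show "x \<in> k ` (?U \<times> carrier G)" using z'(1) act_in z(1) by simp
  qed
  have kinj: "inj_on k (?U \<times> carrier G)"
  proof (rule inj_onI)
    fix x y assume "x \<in> ?U \<times> carrier G" "y \<in> ?U \<times> carrier G" and eq: "k x = k y"
    then obtain u \<gamma> v \<delta> where x: "x = (u, \<gamma>)" "u \<in> ?U" "\<gamma> \<in> carrier G" and y: "y = (v, \<delta>)" "v \<in> ?U" "\<delta> \<in> carrier G"
      by auto
    have uv: "u = v" using pk[OF x(2), of \<gamma>] pk[OF y(2), of \<delta>] eq x(1) y(1) by simp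
    then have "T (s u, \<gamma>) = T (s u, \<delta>)" using eq x y by (simp add: k_def)
    then obtain i m where im: "s u = s u - w i m" "\<delta> = act i m \<otimes> \<gamma>"
      unfolding class_eq_iff[OF x(3) y(3)] by blast
    \<comment> \<open>Since Im \<tau> > 0, the numbers \<tau> and 1 are independent and w i m = 0
      forces i = m = 0; the group coordinates then agree.\<close>
    have wz: "w i m = 0" using im(1) by (simp add: algebra_simps)
    have "of_int m * Im \<tau> = 0" using arg_cong[OF wz, of Im] by (simp add: w_def)
    then have "m = 0" using \<tau> by simp
    moreover have "i = 0" using wz \<open>m = 0\<close> by (simp add: w_def)
    ultimately show "x = y" using im(2) x y uv by (simp add: act_0)
  qed
  have kopen: "open_map ?Pr (subtopology (total_space P) ?V) k"
    unfolding open_map_def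
  proof (intro allI impI)
    fix W assume W: "openin ?Pr W"
    have WU: "W \<subseteq> ?U \<times> carrier G" using openin_subset[OF W] unfolding top .
    have slice: "open {z \<in> S. (torus_point \<Lambda> z, \<gamma>) \<in> W}" if \<gamma>: "\<gamma> \<in> carrier G" for \<gamma>
    proof -
      have "continuous_map (top_of_set S) ?A (torus_point \<Lambda>)"
        using continuous_map_from_subtopology[OF continuous_torus_point]
        by (simp add: continuous_map_in_subtopology)
      then have "continuous_map (top_of_set S) ?Pr (\<lambda>z. (torus_point \<Lambda> z, \<gamma>))"
        by (intro continuous_map_pairedI) (simp_all add: \<gamma>)
      from openin_continuous_map_preimage[OF this W] show ?thesis
        using S(1) openin_open_eq[OF S(1)] by simp
    qed
    have "open {z. T (z, \<delta>) \<in> k ` W}" if \<delta>: "\<delta> \<in> carrier G" for \<delta>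
    proof -
      \<comment> \<open>The preimage is made of lattice translates of the slices of W, each
        translate using the slice at the group element shifted by its holonomy.\<close>
      have "{z. T (z, \<delta>) \<in> k ` W} =
          (\<Union>i. \<Union>m. (\<lambda>z. w i m + z) ` {z \<in> S. (torus_point \<Lambda> z, act i m \<otimes> \<delta>) \<in> W})"
      proof (intro equalityI subsetI)
        fix z assume "z \<in> {z. T (z, \<delta>) \<in> k ` W}"
        then obtain u \<gamma> where u: "(u, \<gamma>) \<in> W" "T (z, \<delta>) = k (u, \<gamma>)" by auto
        have uU: "u \<in> ?U" "\<gamma> \<in> carrier G" using u(1) WU by auto
        have "T (z, \<delta>) = T (s u, \<gamma>)" using u(2) by (simp add: k_def)
        then obtain i m where im: "s u = z - w i m" "\<gamma> = act i m \<otimes> \<delta>"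
          unfolding class_eq_iff[OF \<delta> uU(2)] by blast
        have "z = w i m + s u" using im(1) by simp
        moreover have "s u \<in> {z \<in> S. (torus_point \<Lambda> z, act i m \<otimes> \<delta>) \<in> W}"
          using sU[OF uU(1)] u(1) im(2) by simp
        ultimately show "z \<in> (\<Union>i. \<Union>m. (\<lambda>z. w i m + z) ` {z \<in> S. (torus_point \<Lambda> z, act i m \<otimes> \<delta>) \<in> W})"
          by blast
      next
        fix z assume "z \<in> (\<Union>i. \<Union>m. (\<lambda>z. w i m + z) ` {z \<in> S. (torus_point \<Lambda> z, act i m \<otimes> \<delta>) \<in> W})"
        then obtain i m z' where z: "z = w i m + z'" "z' \<in> S" "(torus_point \<Lambda> z', act i m \<otimes> \<delta>) \<in> W" by blast
        have "T (z, \<delta>) = T (z', act i m \<otimes> \<delta>)" using class_shift[OF \<delta>, of z i m] z(1) by simp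
        also have "\<dots> = k (torus_point \<Lambda> z', act i m \<otimes> \<delta>)" by (simp add: k_def s[OF z(2)])
        finally have "T (z, \<delta>) \<in> k ` W" using z(3) by (metis imageI)
        then show "z \<in> {z. T (z, \<delta>) \<in> k ` W}" by simp
      qed
      also have "open \<dots>"
        by (intro open_UN ballI open_translation slice) (simp add: act_in \<delta>)
      finally show ?thesis .
    qed
    moreover have sub: "k ` W \<subseteq> ?V" using image_mono[OF WU, of k] unfolding img .
    ultimately have "openin (total_space P) (k ` W)"
      unfolding openin_total using topspace_total by blast
    then show "openin (subtopology (total_space P) ?V) (k ` W)"
      using sub unfolding openin_subtopology by (intro exI[of _ "k ` W"]) auto
  qed
  have "homeomorphic_map ?Pr (subtopology (total_space P) ?V) k"
  proof (rule bijective_open_imp_homeomorphic_map[OF _ kopen])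
    show "continuous_map ?Pr (subtopology (total_space P) ?V) k"
      unfolding continuous_map_in_subtopology top using kc img by (simp add: image_subset_iff_funcset[symmetric])
    show "k ` topspace ?Pr = topspace (subtopology (total_space P) ?V)" unfolding top topV by (rule img)
    show "inj_on k (topspace ?Pr)" unfolding top by (rule kinj)
  qed
  moreover have "b \<in> ?U" using S(2) z0 by simp
  moreover have "k (u, \<gamma> \<otimes> \<delta>) = bundle_act P (k (u, \<gamma>)) \<delta>" if "\<gamma> \<in> carrier G" "\<delta> \<in> carrier G" for u \<gamma> \<delta>
    using act_class[OF that, of "s u"] by (simp add: k_def)
  ultimately show ?thesis using U(1) pk by (intro exI[of _ ?U] exI[of _ k]) blast
qed

lemma elliptic_twisted: "elliptic_bundle G P"
  unfolding elliptic_bundle_def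
proof
  show "\<exists>w1 w2. lattice_basis (base_lattice P) w1 w2" unfolding base_twisted using lattice(1) by blast
  show "principal_bundle G (total_space P) (torus (base_lattice P)) (bundle_proj P) (bundle_act P)"
    unfolding principal_bundle_def base_twisted
  proof (intro conjI ballI)
    show "continuous_map (total_space P) (torus \<Lambda>) (bundle_proj P)"
      by (rule continuous_from_total) (simp add: proj_class continuous_torus_point)
    show "continuous_map (total_space P) (total_space P) (\<lambda>x. bundle_act P x \<gamma>)" if \<gamma>: "\<gamma> \<in> carrier G" for \<gamma>
      by (rule continuous_from_total) (simp add: act_class \<gamma> continuous_class)
    fix x assume "x \<in> topspace (total_space P)"
    then obtain z \<delta> where x: "\<delta> \<in> carrier G" "x = T (z, \<delta>)" by (rule total_cases)
    show "bundle_act P x \<one> = x" using x by (simp add: act_class)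
    fix \<gamma> assume \<gamma>: "\<gamma> \<in> carrier G"
    show "bundle_proj P (bundle_act P x \<gamma>) = bundle_proj P x" using x \<gamma> by (simp add: act_class proj_class)
    fix \<delta>' assume "\<delta>' \<in> carrier G"
    then show "bundle_act P x (\<gamma> \<otimes> \<delta>') = bundle_act P (bundle_act P x \<gamma>) \<delta>'"
      using x \<gamma> by (simp add: act_class m_assoc)
  qed (rule local_trivialization)
qed

end

lemma commuting_pairs_hecke:
  fixes G :: "'g monoid" and a b d :: nat
  assumes "group G" "(g, h) \<in> commuting_pairs G"
  shows "(g [^]\<^bsub>G\<^esub> d, g [^]\<^bsub>G\<^esub> (- int b) \<otimes>\<^bsub>G\<^esub> h [^]\<^bsub>G\<^esub> a) \<in> commuting_pairs G"
proof -
  interpret group G by fact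
  have gh: "g \<in> carrier G" "h \<in> carrier G" "g \<otimes>\<^bsub>G\<^esub> h = h \<otimes>\<^bsub>G\<^esub> g"
    using assms(2) by (simp_all add: commuting_pairs_def)
  let ?y = "g [^]\<^bsub>G\<^esub> (- int b) \<otimes>\<^bsub>G\<^esub> h [^]\<^bsub>G\<^esub> a"
  have c: "g [^]\<^bsub>G\<^esub> (- int b) \<in> carrier G" "h [^]\<^bsub>G\<^esub> a \<in> carrier G" using gh by simp_all
  have 1: "g \<otimes>\<^bsub>G\<^esub> g [^]\<^bsub>G\<^esub> (- int b) = g [^]\<^bsub>G\<^esub> (- int b) \<otimes>\<^bsub>G\<^esub> g"
    by (rule int_pow_commutes[OF gh(1,1) refl])
  have 2: "g \<otimes>\<^bsub>G\<^esub> h [^]\<^bsub>G\<^esub> a = h [^]\<^bsub>G\<^esub> a \<otimes>\<^bsub>G\<^esub> g"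
    by (rule group_commutes_pow[OF gh(3)[symmetric] gh(2,1), symmetric])
  have "g \<otimes>\<^bsub>G\<^esub> ?y = (g \<otimes>\<^bsub>G\<^esub> g [^]\<^bsub>G\<^esub> (- int b)) \<otimes>\<^bsub>G\<^esub> h [^]\<^bsub>G\<^esub> a"
    by (rule m_assoc[OF gh(1) c, symmetric])
  also have "\<dots> = g [^]\<^bsub>G\<^esub> (- int b) \<otimes>\<^bsub>G\<^esub> (g \<otimes>\<^bsub>G\<^esub> h [^]\<^bsub>G\<^esub> a)"
    unfolding 1 by (rule m_assoc[OF c(1) gh(1) c(2)])
  also have "\<dots> = ?y \<otimes>\<^bsub>G\<^esub> g" unfolding 2 by (rule m_assoc[OF c gh(1), symmetric])
  finally have "g [^]\<^bsub>G\<^esub> d \<otimes>\<^bsub>G\<^esub> ?y = ?y \<otimes>\<^bsub>G\<^esub> g [^]\<^bsub>G\<^esub> d"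
    by (rule group_commutes_pow[OF _ gh(1)]) (use c in simp)
  then show ?thesis using gh(1) c by (simp add: commuting_pairs_def)
qed

section \<open>The isogenies of the Hecke sum\<close>

context twisted
begin

context
  fixes a b d n :: nat
  assumes idx: "(a, b, d) \<in> hecke_index n" and n: "n \<ge> 1"
begin

private lemmas pos = hecke_index_pos[OF idx n]

abbreviation "\<tau>' \<equiv> (of_nat a * \<tau> + of_nat b) / of_nat d"
abbreviation "g' \<equiv> g [^] d"
abbreviation "h' \<equiv> g [^] (- int b) \<otimes> h [^] a"
abbreviation "P' \<equiv> twisted_bundle G g' h' \<tau>'"
abbreviation "\<Lambda>' \<equiv> lattice_span \<tau>' 1"

lemma twisted_source: "twisted G g' h' \<tau>'"
proof
  show "(g', h') \<in> commuting_pairs G" by (rule commuting_pairs_hecke[OF is_group comm])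
  show "Im \<tau>' > 0" using \<tau> pos by (simp add: Im_divide_of_nat)
qed

interpretation S: twisted G g' h' \<tau>' by (rule twisted_source)

text \<open>Multiplying m\<tau>' - k by d gives m(a\<tau> + b) - dk; as (1,0) stands for -1, the
  summand +b appears as -b in the first coordinate.\<close>

lemma source_w: "of_nat d * S.w k m = w (int d * k - int b * m) (int a * m)"
  unfolding S.w_def w_def using pos by (simp add: field_simps)

text \<open>The holonomy of the source involves the same exponents as its lattice in
  \<open>source_w\<close>. This match is what makes multiplication by d well defined on classes, and
  it explains the pair (g^d, g^(-b) h^a).\<close>

lemma source_act: "S.act k m = act (int d * k - int b * m) (int a * m)"
proof -
  have c: "g [^] (- int b) \<in> carrier G" "h [^] int a \<in> carrier G" using g h by simp_all
  have "g \<otimes> h [^] int a = h [^] int a \<otimes> g" by (rule int_pow_commutes[OF g h gh])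
  then have cc: "g [^] (- int b) \<otimes> h [^] int a = h [^] int a \<otimes> g [^] (- int b)"
    using int_pow_commutes[OF c(2) g] by simp
  have "g' [^] k = g [^] (int d * k)" by (simp only: int_pow_int[symmetric] int_pow_pow[OF g])
  moreover have "h' [^] m = g [^] (- int b * m) \<otimes> h [^] (int a * m)"
    unfolding int_pow_int[of G h a, symmetric] int_pow_mult_distrib[OF cc c]
    by (simp only: int_pow_pow[OF g] int_pow_pow[OF h])
  ultimately have "S.act k m = act (int d * k) 0 \<otimes> act (- int b * m) (int a * m)"
    using g h by (simp add: S.act_def act_def)
  then show ?thesis by (simp add: act_add)
qed

lemma mult_class:
  assumes "\<gamma> \<in> carrier G"
  shows "twisted_mult G g h \<tau> (of_nat d) (S.T (z, \<gamma>)) = T (of_nat d * z, \<gamma>)"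
proof -
  have "(case x of (z', \<gamma>') \<Rightarrow> T (of_nat d * z', \<gamma>')) = T (of_nat d * z, \<gamma>)" if x: "x \<in> S.T (z, \<gamma>)" for x
  proof -
    obtain k m where km: "x = (z - S.w k m, S.act k m \<otimes> \<gamma>)" using x unfolding S.class_eq by blast
    show ?thesis
      unfolding km case_prod_conv right_diff_distrib source_w source_act by (rule class_shift[OF assms])
  qed
  moreover have "S.T (z, \<gamma>) \<noteq> {}" using S.class_self[OF assms] by blast
  moreover have "twisted_mult G g h \<tau> (of_nat d) (S.T (z, \<gamma>)) = (\<Union>x\<in>S.T (z, \<gamma>). T (of_nat d * z, \<gamma>))"
    unfolding twisted_mult_def by (rule SUP_cong[OF refl]) (rule calculation(1))
  ultimately show ?thesis by simp
qed

lemma source_lattice: "(\<lambda>z. of_nat d * z) ` \<Lambda>' \<subseteq> \<Lambda>"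
proof (rule image_subsetI)
  fix z assume "z \<in> \<Lambda>'"
  then obtain k m where "z = S.w k m" unfolding S.range_w by blast
  then have "of_nat d * z = w (int d * k - int b * m) (int a * m)" by (simp only: source_w)
  then show "of_nat d * z \<in> \<Lambda>" unfolding range_w by blast
qed

lemma bundle_map_isogeny: "bundle_map G (of_nat d) P' P (twisted_mult G g h \<tau> (of_nat d))"
  unfolding bundle_map_def base_twisted S.base_twisted
proof (intro conjI ballI source_lattice)
  show "continuous_map (total_space P') (total_space P) (twisted_mult G g h \<tau> (of_nat d))"
  proof (rule S.continuous_from_total)
    fix \<gamma> assume \<gamma>: "\<gamma> \<in> carrier G"
    have "continuous_map euclidean euclidean (\<lambda>z. of_nat d * z :: complex)" by (simp add: continuous_intros)
    from continuous_map_compose[OF this continuous_class[OF \<gamma>]]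
    show "continuous_map euclidean (total_space P) (\<lambda>z. twisted_mult G g h \<tau> (of_nat d) (S.T (z, \<gamma>)))"
      by (simp add: mult_class[OF \<gamma>] comp_def)
  qed
  fix x assume "x \<in> topspace (total_space P')"
  then obtain z \<gamma> where x: "\<gamma> \<in> carrier G" "x = S.T (z, \<gamma>)" by (rule S.total_cases)
  show "bundle_proj P (twisted_mult G g h \<tau> (of_nat d) x) = torus_mult \<Lambda> (of_nat d) (bundle_proj P' x)"
    by (simp add: x(2) mult_class[OF x(1)] proj_class S.proj_class
        L.torus_mult_point[OF S.L.complex_lattice_axioms source_lattice])
  fix \<delta> assume \<delta>: "\<delta> \<in> carrier G"
  show "twisted_mult G g h \<tau> (of_nat d) (bundle_act P' x \<delta>) = bundle_act P (twisted_mult G g h \<tau> (of_nat d) x) \<delta>"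
    using x(1) \<delta> by (simp add: x(2) mult_class S.act_class act_class)
qed

text \<open>In the basis (-1, \<tau>) the sublattice d \<Lambda>' is the stabilizer lattice of the
  permutation pair; this links the isogeny to the type.\<close>

lemma source_lattice_iff:
  "(of_int x * (-1) + of_int y * \<tau>) / of_nat d \<in> \<Lambda>' \<longleftrightarrow> (x, y) \<in> hecke_lattice a b d"
proof
  assume "(of_int x * (-1) + of_int y * \<tau>) / of_nat d \<in> \<Lambda>'"
  then obtain k m where "(of_int x * (-1) + of_int y * \<tau>) / of_nat d = S.w k m" unfolding S.range_w by blast
  then have "of_int x * (-1) + of_int y * \<tau> = of_nat d * S.w k m" using pos(2) by (simp add: field_simps)
  then have eq: "w x y = w (int d * k - int b * m) (int a * m)" unfolding source_w by (simp add: w_def)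
  \<comment> \<open>Imaginary parts isolate the coefficient of \<tau>, because Im \<tau> > 0; the
    other coefficient follows by subtraction.\<close>
  have "of_int y * Im \<tau> = of_int (int a * m) * Im \<tau>" using arg_cong[OF eq, of Im] by (simp add: w_def)
  then have y: "y = int a * m" using \<tau> by (simp only: mult_right_cancel of_int_eq_iff less_numeral_extra)
  have "(of_int x :: complex) = of_int (int d * k - int b * m)"
    using eq unfolding y w_def by (metis add_diff_cancel_left' diff_diff_eq2 diff_add_cancel)
  then have "x = int d * k - int b * m" by (simp only: of_int_eq_iff)
  with y show "(x, y) \<in> hecke_lattice a b d"
    unfolding hecke_lattice_def by (simp add: mult.commute) blast
next
  assume "(x, y) \<in> hecke_lattice a b d"
  then obtain u v where "x = v * int d - u * int b" "y = u * int a" unfolding hecke_lattice_def by blast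
  then have "of_int x * (-1) + of_int y * \<tau> = of_nat d * S.w v u"
    unfolding source_w by (simp add: w_def mult.commute)
  then have "(of_int x * (-1) + of_int y * \<tau>) / of_nat d = S.w v u" using pos(2) by simp
  then show "(of_int x * (-1) + of_int y * \<tau>) / of_nat d \<in> \<Lambda>'" unfolding S.range_w by blast
qed

text \<open>Words applied to 1 and the corresponding points of the fibre over 0 are parametrised
  with the same kernel, namely the lattice of the type. Matching them labels the fibre, and straight
  segments realise the monodromy.\<close>

lemma covering_monodromy_isogeny:
  assumes t: "pair_type n a b d \<sigma> \<rho>"
  shows "covering_monodromy n \<Lambda>' \<Lambda> (of_nat d) (-1) \<tau> \<sigma> \<rho>"
proof -
  have comm': "\<sigma> \<circ> \<rho> = \<rho> \<circ> \<sigma>" using t by (simp only: pair_type_def)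
  have one: "1 \<in> {1..n}" using n by simp
  define i0 :: nat where "i0 = 1"
  have i0: "i0 \<in> {1..n}" using one by (simp only: i0_def)
  \<comment> \<open>The fibre over 0 is \<Lambda>/d modulo \<Lambda>'. The steps by \<sigma> and
    \<rho> move by -1/d and \<tau>/d, according to the chosen basis.\<close>
  define c :: "nat \<times> nat \<Rightarrow> complex" where "c = (\<lambda>(s, t). (of_nat s * (-1) + of_nat t * \<tau>) / of_nat d)"
  let ?f = "\<lambda>(s, t). (\<sigma> ^^ s) ((\<rho> ^^ t) i0)" and ?f' = "\<lambda>p. torus_point \<Lambda>' (c p)"
  have kernel: "?f p = ?f q \<longleftrightarrow> ?f' p = ?f' q" for p q
  proof -
    obtain s t s' t' where pq: "p = (s, t)" "q = (s', t')" by fastforce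
    have "c p - c q = (of_int (int s - int s') * (-1) + of_int (int t - int t') * \<tau>) / of_nat d"
      by (simp add: c_def pq diff_divide_distrib[symmetric] algebra_simps)
    then have "?f' p = ?f' q \<longleftrightarrow> (int s - int s', int t - int t') \<in> hecke_lattice a b d"
      by (simp only: S.L.torus_point_eq_iff source_lattice_iff)
    then show ?thesis unfolding pq by (simp only: case_prod_conv pair_type_iff[OF \<open>pair_type n a b d \<sigma> \<rho>\<close> i0])
  qed
  let ?F = "{y \<in> topspace (torus \<Lambda>'). torus_mult \<Lambda> (of_nat d) y = torus_point \<Lambda> 0}"
  note tm = L.torus_mult_point[OF S.L.complex_lattice_axioms source_lattice]
  have dc: "of_nat d * c (s, t) = w (int s) (int t)" for s t
    using pos(2) by (simp add: c_def w_def)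
  have w_in: "w k m \<in> \<Lambda>" for k m unfolding range_w by blast
  have "?f' ` UNIV = ?F"
  proof (intro equalityI subsetI)
    fix y assume "y \<in> ?f' ` UNIV"
    then obtain s t where y: "y = torus_point \<Lambda>' (c (s, t))" by fastforce
    show "y \<in> ?F" using w_in by (simp add: y topspace_torus tm dc L.torus_point_eq_iff)
  next
    fix y assume y: "y \<in> ?F"
    then obtain z where z: "y = torus_point \<Lambda>' z" by (auto simp: topspace_torus)
    have "of_nat d * z \<in> \<Lambda>" using y by (simp add: z tm L.torus_point_eq_iff)
    then obtain k m where km: "of_nat d * z = w k m" unfolding range_w by blast
    \<comment> \<open>The exponents of a word are natural numbers, so the lattice point is first
      replaced by its representative in the box.\<close>
    obtain s t where st: "hecke_reduce a b d (k, m) = (int s, int t)"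
      by (rule hecke_reduce_nat[OF pos(1,2), of b "(k, m)"])
    have "(k - int s, m - int t) \<in> hecke_lattice a b d"
      using hecke_reduce_reduce[OF pos(1,2), of "(k, m)" b] by (simp add: st)
    then have "(of_int (k - int s) * (-1) + of_int (m - int t) * \<tau>) / of_nat d \<in> \<Lambda>'"
      by (simp only: source_lattice_iff)
    moreover have "z - c (s, t) = (of_int (k - int s) * (-1) + of_int (m - int t) * \<tau>) / of_nat d"
    proof -
      have "of_nat d * (z - c (s, t)) = of_int (k - int s) * (-1) + of_int (m - int t) * \<tau>"
        unfolding right_diff_distrib km dc by (simp add: w_def algebra_simps)
      then show ?thesis using pos(2) by (simp add: field_simps)
    qed
    ultimately have "y = ?f' (s, t)" by (simp add: z S.L.torus_point_eq_iff)
    then show "y \<in> ?f' ` UNIV" by (rule range_eqI)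
  qed
  moreover from kernel obtain l where l: "bij_betw l (range ?f) (range ?f')" "\<And>p. p \<in> UNIV \<Longrightarrow> l (?f p) = ?f' p"
    by (rule bij_betw_same_kernel[of UNIV ?f ?f']) blast
  ultimately have bij: "bij_betw l {1..n} ?F"
    by (simp only: pair_type_orbit_image[OF t n i0])
  have path: "\<exists>p. pathin (torus \<Lambda>') p \<and> p 0 = l i \<and> p 1 = l (\<pi> i) \<and>
        (\<forall>r\<in>{0..1}. torus_mult \<Lambda> (of_nat d) (p r) = torus_point \<Lambda> (of_real r * u))"
    if i: "i \<in> {1..n}" and u: "(u, \<pi>) = (-1, \<sigma>) \<or> (u, \<pi>) = (\<tau>, \<rho>)" for i u \<pi>
  proof -
    obtain s t where ist: "i = (\<sigma> ^^ s) ((\<rho> ^^ t) i0)"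
      by (rule pair_type_reach[OF \<open>pair_type n a b d \<sigma> \<rho>\<close> n i0 i])
    have li: "l i = torus_point \<Lambda>' (c (s, t))" using l(2)[OF UNIV_I, of "(s, t)"] by (simp only: ist case_prod_conv)
    \<comment> \<open>The segment lifting r u through multiplication by d. Its end point differs
      from its start by u/d, one step in the exponents.\<close>
    define p where "p r = torus_point \<Lambda>' (c (s, t) + of_real r * u / of_nat d)" for r :: real
    have "continuous_map (top_of_set {0..1}) euclidean (\<lambda>r. c (s, t) + of_real r * u / of_nat d)"
      unfolding continuous_map_iff_continuous by (intro continuous_intros) (use pos(2) in simp)
    from continuous_map_compose[OF this continuous_torus_point[of \<Lambda>']]
    have "pathin (torus \<Lambda>') p" unfolding pathin_def p_def[abs_def] comp_def .
    moreover have "p 0 = l i" by (simp add: p_def li)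
    moreover have "p 1 = l (\<pi> i)"
      using u
    proof
      assume u: "(u, \<pi>) = (-1, \<sigma>)"
      have "\<pi> i = ?f (Suc s, t)" using u by (simp add: ist)
      then have "l (\<pi> i) = torus_point \<Lambda>' (c (Suc s, t))" using l(2)[OF UNIV_I, of "(Suc s, t)"] by (simp only: case_prod_conv)
      moreover have "c (Suc s, t) = c (s, t) + u / of_nat d"
        using u by (simp add: c_def add_divide_distrib[symmetric] algebra_simps)
      ultimately show ?thesis by (simp add: p_def)
    next
      assume u: "(u, \<pi>) = (\<tau>, \<rho>)"
      have "\<pi> i = ?f (s, Suc t)"
        using u funpow_commute_apply[OF comm', of s 1 "(\<rho> ^^ t) i0"] by (simp add: ist)
      then have "l (\<pi> i) = torus_point \<Lambda>' (c (s, Suc t))" using l(2)[OF UNIV_I, of "(s, Suc t)"] by (simp only: case_prod_conv)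
      moreover have "c (s, Suc t) = c (s, t) + u / of_nat d"
        using u by (simp add: c_def add_divide_distrib[symmetric] algebra_simps)
      ultimately show ?thesis by (simp add: p_def)
    qed
    moreover have "torus_mult \<Lambda> (of_nat d) (p r) = torus_point \<Lambda> (of_real r * u)" for r
    proof -
      have "of_nat d * (c (s, t) + of_real r * u / of_nat d) = w (int s) (int t) + of_real r * u"
        unfolding distrib_left dc using pos(2) by simp
      then show ?thesis using w_in by (simp add: p_def tm L.torus_point_eq_iff)
    qed
    ultimately show ?thesis by (intro exI[of _ p]) simp
  qed
  show ?thesis
    unfolding covering_monodromy_def
  proof (intro conjI source_lattice exI[of _ l] bij ballI)
    show "(of_nat d :: complex) \<noteq> 0" using pos(2) by simp
    fix i u\<pi> assume i: "i \<in> {1..n}" and "u\<pi> \<in> {(-1 :: complex, \<sigma>), (\<tau>, \<rho>)}"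
    then show "case u\<pi> of (v, \<pi>) \<Rightarrow> \<exists>p. pathin (torus \<Lambda>') p \<and> p 0 = l i \<and> p 1 = l (\<pi> i) \<and>
        (\<forall>t\<in>{0..1}. torus_mult \<Lambda> (of_nat d) (p t) = torus_point \<Lambda> (of_real t * v))"
      using path[OF i] by (cases u\<pi>) simp
  qed
qed

lemma covering_pullback_isogeny:
  assumes "pair_type n a b d \<sigma> \<rho>"
  shows "covering_pullback G n (-1) \<tau> P \<sigma> \<rho> (of_nat d) P' (twisted_mult G g h \<tau> (of_nat d))"
  unfolding covering_pullback_def base_twisted S.base_twisted
  using S.elliptic_twisted bundle_map_isogeny covering_monodromy_isogeny[OF assms] by simp

end

text \<open>The definition of the operator may pick any covering with the given monodromy and any
  model of the pullback. All of them have the same image lattice as the standard isogeny, so the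
  pushforward is always the standard one.\<close>

lemma pushforward_covering_pullback:
  assumes F: "elliptic_section G D \<alpha> F" and n: "n \<ge> 1" and t: "pair_type n a b d \<sigma> \<rho>"
    and c: "covering_pullback G n (-1) \<tau> P \<sigma> \<rho> m Q \<psi>"
  shows "pushforward G D Q P \<psi> (F Q) =
    (let P' = twisted_bundle G (g [^] d) (g [^] (- int b) \<otimes> h [^] a) ((of_nat a * \<tau> + of_nat b) / of_nat d)
     in pushforward G D P' P (twisted_mult G g h \<tau> (of_nat d)) (F P'))"
proof -
  have idx: "(a, b, d) \<in> hecke_index n" using t by (simp only: pair_type_def)
  note c' = covering_pullback_isogeny[OF idx n t]
  let ?P' = "twisted_bundle G (g [^] d) (g [^] (- int b) \<otimes> h [^] a) ((of_nat a * \<tau> + of_nat b) / of_nat d)"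
  have Q: "elliptic_bundle G Q" "elliptic_bundle G ?P'"
    and mono: "covering_monodromy n (base_lattice Q) \<Lambda> m (-1) \<tau> \<sigma> \<rho>"
      "covering_monodromy n (base_lattice ?P') \<Lambda> (of_nat d) (-1) \<tau> \<sigma> \<rho>"
    and maps: "bundle_map G m Q P \<psi>" "bundle_map G (of_nat d) ?P' P (twisted_mult G g h \<tau> (of_nat d))"
    using c c' by (simp_all add: covering_pullback_def base_twisted)
  have m: "m \<noteq> 0" "(of_nat d :: complex) \<noteq> 0" using mono by (simp_all add: covering_monodromy_def)
  have span: "\<Lambda> = lattice_span (-1) \<tau>" using lattice(1) by (simp add: lattice_basis_def)
  have "(\<lambda>z. m * z) ` base_lattice Q = (\<lambda>z. of_nat d * z) ` base_lattice ?P'"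
    unfolding covering_lattice[OF lattice(2) elliptic_bundleD(1)[OF is_group Q(1)] mono(1) t n span]
      covering_lattice[OF lattice(2) elliptic_bundleD(1)[OF is_group Q(2)] mono(2) t n span] ..
  from pushforward_pullback_unique[OF is_group F elliptic_twisted Q maps m this]
  show ?thesis by (simp add: Let_def)
qed

text \<open>Every centralizer has order n, so the weights come out of the sum as 1/n.\<close>

lemma geometric_hecke_twisted:
  assumes F: "elliptic_section G D \<alpha> F" and n: "n \<ge> 1"
  shows "geometric_hecke G D n (-1) \<tau> F P =
    (\<lambda>c. 1 / of_nat n * (\<Sum>(a, b, d)\<in>hecke_index n.
       let P' = twisted_bundle G (g [^] d) (g [^] (- int b) \<otimes> h [^] a) ((of_nat a * \<tau> + of_nat b) / of_nat d)
       in pushforward G D P' P (twisted_mult G g h \<tau> (of_nat d)) (F P') c))"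
proof
  fix c
  let ?U = "\<lambda>a b d. let P' = twisted_bundle G (g [^] d) (g [^] (- int b) \<otimes> h [^] a)
      ((of_nat a * \<tau> + of_nat b) / of_nat d)
    in pushforward G D P' P (twisted_mult G g h \<tau> (of_nat d)) (F P') c"
  let ?T = "\<lambda>\<sigma> \<rho>. let (m, Q, \<psi>) = (SOME (m, Q, \<psi>). covering_pullback G n (-1) \<tau> P \<sigma> \<rho> m Q \<psi>)
    in 1 / of_nat (card (pair_centralizer n \<sigma> \<rho>)) * pushforward G D Q P \<psi> (F Q) c"
  have T: "?T \<sigma> \<rho> = 1 / of_nat n * ?U a b d" if t: "pair_type n a b d \<sigma> \<rho>" for a b d \<sigma> \<rho>
  proof -
    have idx: "(a, b, d) \<in> hecke_index n" using t by (simp only: pair_type_def)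
    let ?C = "\<lambda>(m, Q, \<psi>). covering_pullback G n (-1) \<tau> P \<sigma> \<rho> m Q \<psi>"
    obtain m Q \<psi> where some: "(SOME x. ?C x) = (m, Q, \<psi>)" by (metis prod_cases3)
    \<comment> \<open>The standard isogeny witnesses existence, so the chosen triple is a genuine
      pullback.\<close>
    have "?C (SOME x. ?C x)"
      by (rule someI[of ?C "(of_nat d, _, _)"], unfold case_prod_conv, rule covering_pullback_isogeny[OF idx n t])
    then have "covering_pullback G n (-1) \<tau> P \<sigma> \<rho> m Q \<psi>" unfolding some by simp
    from pushforward_covering_pullback[OF F n t this] show ?thesis
      unfolding some by (simp add: Let_def card_pair_centralizer[OF t n])
  qed
  have "geometric_hecke G D n (-1) \<tau> F P c =
      (\<Sum>C\<in>transitive_classes n. let (\<sigma>, \<rho>) = SOME p. p \<in> C in ?T \<sigma> \<rho>)"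
    by (simp only: geometric_hecke_def)
  also have "\<dots> = (\<Sum>(a, b, d)\<in>hecke_index n. 1 / of_nat n * ?U a b d)"
    by (rule sum_transitive_classes[OF n]) (rule T)
  also have "\<dots> = 1 / of_nat n * (\<Sum>(a, b, d)\<in>hecke_index n. ?U a b d)"
    by (simp only: sum_distrib_left case_prod_unfold)
  finally show "geometric_hecke G D n (-1) \<tau> F P c = 1 / of_nat n * (\<Sum>(a, b, d)\<in>hecke_index n. ?U a b d)" .
qed

end

section \<open>Evaluation of fractional power series\<close>

lemma has_sum_finite_sum:
  fixes f :: "'i \<Rightarrow> 'a \<Rightarrow> complex"
  assumes "finite I" "\<And>i. i \<in> I \<Longrightarrow> (f i has_sum S i) A"
  shows "((\<lambda>x. \<Sum>i\<in>I. f i x) has_sum (\<Sum>i\<in>I. S i)) A"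
  using assms
proof (induction I rule: finite_induct)
  case (insert i I)
  then have "((\<lambda>x. f i x + (\<Sum>i\<in>I. f i x)) has_sum (S i + (\<Sum>i\<in>I. S i))) A"
    by (intro has_sum_add) simp_all
  then show ?case using insert.hyps by simp
qed simp

text \<open>The substitution rescales the rational exponents by the bijection x \<mapsto> xd/a, and
  sums over all rational exponents may be reindexed. The power q^y at (a\<tau> + b)/d splits into
  the phase with yb/d and the power of q with exponent ya/d.\<close>

lemma q_subst_has_sum:
  assumes "a > 0" "d > 0" "q_convergent s" "Im \<tau> > 0"
  shows "((\<lambda>x. q_subst a b d s x * q_power x \<tau>) has_sum q_eval s ((of_nat a * \<tau> + of_nat b) / of_nat d)) UNIV"
proof -
  let ?t = "(of_nat a * \<tau> + of_nat b) / of_nat d"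
  have "Im ?t > 0" using assms by (simp add: Im_divide_of_nat)
  then have "((\<lambda>y. s y * q_power y ?t) has_sum q_eval s ?t) UNIV"
    using assms(3) unfolding q_convergent_def q_eval_def by (intro has_sum_infsum) simp
  moreover have "bij (\<lambda>x :: rat. x * of_nat d / of_nat a)"
    by (rule bij_betw_byWitness[where f' = "\<lambda>y. y * of_nat a / of_nat d"]) (use assms in auto)
  ultimately have "((\<lambda>x. s (x * of_nat d / of_nat a) * q_power (x * of_nat d / of_nat a) ?t) has_sum q_eval s ?t) UNIV"
    by (subst has_sum_reindex_bij_betw[where f = "\<lambda>y. s y * q_power y ?t"])
  moreover have "q_power y ?t = q_power y (of_nat b / of_nat d) * q_power x \<tau>"
    if y: "y = x * of_nat d / of_nat a" for x y
  proof -
    have "(of_rat x :: complex) = of_rat y * of_nat a / of_nat d"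
      using assms unfolding y by (simp add: of_rat_mult of_rat_divide)
    then show ?thesis using assms
      by (simp add: q_power_def exp_add[symmetric] add_divide_distrib algebra_simps)
  qed
  ultimately show ?thesis by (simp add: q_subst_def Let_def mult.assoc)
qed

text \<open>Passage from formal series to functions: the finite Hecke sum may be taken term by term
  because each series converges at the shifted point, which lies again in the upper half
  plane.\<close>

lemma q_eval_hecke_sum:
  assumes "n \<ge> 1" "Im \<tau> > 0" "\<And>a b d. (a, b, d) \<in> hecke_index n \<Longrightarrow> q_convergent (s a b d)"
  shows "q_eval (\<lambda>x. 1 / of_nat n * (\<Sum>(a, b, d)\<in>hecke_index n. q_subst a b d (s a b d) x)) \<tau> =
    1 / of_nat n * (\<Sum>(a, b, d)\<in>hecke_index n. q_eval (s a b d) ((of_nat a * \<tau> + of_nat b) / of_nat d))"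
proof -
  have "((\<lambda>x. \<Sum>i\<in>hecke_index n. (case i of (a, b, d) \<Rightarrow> q_subst a b d (s a b d) x) * q_power x \<tau>) has_sum
      (\<Sum>i\<in>hecke_index n. case i of (a, b, d) \<Rightarrow> q_eval (s a b d) ((of_nat a * \<tau> + of_nat b) / of_nat d))) UNIV"
  proof (rule has_sum_finite_sum[OF finite_hecke_index[OF assms(1)]])
    fix i assume i: "i \<in> hecke_index n"
    obtain a b d where abd: "i = (a, b, d)" by (metis prod_cases3)
    note p = hecke_index_pos[OF i[unfolded abd] assms(1)]
    show "((\<lambda>x. (case i of (a, b, d) \<Rightarrow> q_subst a b d (s a b d) x) * q_power x \<tau>) has_sum
      (case i of (a, b, d) \<Rightarrow> q_eval (s a b d) ((of_nat a * \<tau> + of_nat b) / of_nat d))) UNIV"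
      unfolding abd case_prod_conv
      by (rule q_subst_has_sum[OF p(1,2) assms(3)[OF i[unfolded abd]] assms(2)])
  qed
  from has_sum_cmult_right[OF this, of "1 / of_nat n"]
  have "((\<lambda>x. 1 / of_nat n * (\<Sum>(a, b, d)\<in>hecke_index n. q_subst a b d (s a b d) x) * q_power x \<tau>) has_sum
      1 / of_nat n * (\<Sum>(a, b, d)\<in>hecke_index n. q_eval (s a b d) ((of_nat a * \<tau> + of_nat b) / of_nat d))) UNIV"
    by (simp only: sum_distrib_right[symmetric] mult.assoc)
  then show ?thesis unfolding q_eval_def by (rule infsumI)
qed

section \<open>The three Hecke operators\<close>

lemma devoto_hecke_formula:
  fixes G :: "'g monoid"
  assumes "group G" "finite (carrier G)" "devoto_tate_K G f" "power_domain G f"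
    "(g, h) \<in> commuting_pairs G" "n \<ge> 1"
  shows "devoto_hecke G n f g h = (\<lambda>x. 1 / of_nat n * (\<Sum>(a, b, d)\<in>hecke_index n.
    q_subst a b d (tate_series G f (g [^]\<^bsub>G\<^esub> d) (g [^]\<^bsub>G\<^esub> (- int b) \<otimes>\<^bsub>G\<^esub> h [^]\<^bsub>G\<^esub> a)) x))"
proof
  fix x
  have "(\<Sum>C\<in>transitive_classes n. let (\<sigma>, \<rho>) = SOME p. p \<in> C in power_operation G n f \<sigma> \<rho> g h x) =
    (\<Sum>(a, b, d)\<in>hecke_index n.
      q_subst a b d (tate_series G f (g [^]\<^bsub>G\<^esub> d) (g [^]\<^bsub>G\<^esub> (- int b) \<otimes>\<^bsub>G\<^esub> h [^]\<^bsub>G\<^esub> a)) x)"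
    by (rule sum_transitive_classes[OF assms(6)]) (rule power_operation_transitive[OF assms])
  then show "devoto_hecke G n f g h x = 1 / of_nat n * (\<Sum>(a, b, d)\<in>hecke_index n.
    q_subst a b d (tate_series G f (g [^]\<^bsub>G\<^esub> d) (g [^]\<^bsub>G\<^esub> (- int b) \<otimes>\<^bsub>G\<^esub> h [^]\<^bsub>G\<^esub> a)) x)"
    by (simp only: devoto_hecke_def)
qed

text \<open>The replication identity divided by n already has the required shape. The a-th Adams
  operation evaluates characters at h^a, and the power of g = 1 contributes nothing.\<close>

lemma twisted_hecke_formula:
  fixes G :: "'g monoid"
  assumes G: "group G" and r: "replicable G f" and h: "h \<in> carrier G" and n: "n \<ge> 1"
  shows "twisted_hecke n f h = (\<lambda>x. 1 / of_nat n * (\<Sum>(a, b, d)\<in>hecke_index n.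
    q_subst a b d (mt_series f (\<one>\<^bsub>G\<^esub> [^]\<^bsub>G\<^esub> (- int b) \<otimes>\<^bsub>G\<^esub> h [^]\<^bsub>G\<^esub> a)) x))"
proof -
  interpret group G by (rule G)
  obtain \<psi> where A: "\<forall>a\<ge>1. \<forall>i. adams_operation G a (f i) (\<psi> a i)"
    and R: "\<forall>n\<ge>1. \<forall>h\<in>carrier G. q_series 1 (fls_nth (poly_fls (faber n (mt_fls f h)) (mt_fls f h))) =
        (\<lambda>x. \<Sum>(a, b, d)\<in>hecke_index n. q_subst a b d (mt_series (\<psi> a) h) x)"
    using r unfolding replicable_def by (elim exE conjE)
  have mt: "mt_series (\<psi> a) h = mt_series f (\<one>\<^bsub>G\<^esub> [^]\<^bsub>G\<^esub> (- int b) \<otimes>\<^bsub>G\<^esub> h [^]\<^bsub>G\<^esub> a)"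
    if "(a, b, d) \<in> hecke_index n" for a b d
  proof -
    have "a \<ge> 1" using hecke_index_pos(1)[OF that n] by simp
    then have "virtual_char (\<psi> a i) h = virtual_char (f i) (h [^]\<^bsub>G\<^esub> a)" for i
      using A h by (simp add: adams_operation_def)
    then show ?thesis using h by (simp add: mt_series_def int_pow_one)
  qed
  show ?thesis
    unfolding twisted_hecke_def R[rule_format, OF n h]
    by (intro ext arg_cong2[where f = "(*)"] refl sum.cong) (auto simp: mt)
qed

text \<open>For series the formula is an identity of formal expansions; the version for functions is
  added under convergence on the upper half plane. In the geometric case -1 and \<tau> are the
  lattice points of (1,0) and (0,1).\<close>

theorem theorem1p3:
  fixes G :: "'g monoid" and n :: nat
  assumes "group G" and "finite (carrier G)" and "n \<ge> 1"
  shows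
    "(\<forall>(D :: ('e, 'b, 'g) classifying_data) \<alpha> F g h \<tau>.
        classifying_space G D \<and> normalized_cocycle D \<alpha> \<and> elliptic_section G D \<alpha> F \<and>
        (g, h) \<in> commuting_pairs G \<and> Im \<tau> > 0 \<longrightarrow>
        geometric_hecke G D n (-1) \<tau> F (twisted_bundle G g h \<tau>) =
          (\<lambda>c. 1 / of_nat n * (\<Sum>(a, b, d)\<in>hecke_index n.
             let P' = twisted_bundle G (g [^]\<^bsub>G\<^esub> d) (g [^]\<^bsub>G\<^esub> (- int b) \<otimes>\<^bsub>G\<^esub> h [^]\<^bsub>G\<^esub> a)
                        ((of_nat a * \<tau> + of_nat b) / of_nat d)
             in pushforward G D P' (twisted_bundle G g h \<tau>) (twisted_mult G g h \<tau> (of_nat d)) (F P') c)))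
     \<and>
     (\<forall>f g h. devoto_tate_K G f \<and> power_domain G f \<and> (g, h) \<in> commuting_pairs G \<longrightarrow>
        devoto_hecke G n f g h =
          (\<lambda>x. 1 / of_nat n * (\<Sum>(a, b, d)\<in>hecke_index n.
             q_subst a b d (tate_series G f (g [^]\<^bsub>G\<^esub> d) (g [^]\<^bsub>G\<^esub> (- int b) \<otimes>\<^bsub>G\<^esub> h [^]\<^bsub>G\<^esub> a)) x)) \<and>
        ((\<forall>(g', h')\<in>commuting_pairs G. q_convergent (tate_series G f g' h')) \<longrightarrow>
         (\<forall>\<tau>. Im \<tau> > 0 \<longrightarrow>
            q_eval (devoto_hecke G n f g h) \<tau> =
              1 / of_nat n * (\<Sum>(a, b, d)\<in>hecke_index n.
                q_eval (tate_series G f (g [^]\<^bsub>G\<^esub> d) (g [^]\<^bsub>G\<^esub> (- int b) \<otimes>\<^bsub>G\<^esub> h [^]\<^bsub>G\<^esub> a))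
                  ((of_nat a * \<tau> + of_nat b) / of_nat d)))))
     \<and>
     (\<forall>f h. mckay_thompson G f \<and> replicable G f \<and> h \<in> carrier G \<longrightarrow>
        twisted_hecke n f h =
          (\<lambda>x. 1 / of_nat n * (\<Sum>(a, b, d)\<in>hecke_index n.
             q_subst a b d (mt_series f (\<one>\<^bsub>G\<^esub> [^]\<^bsub>G\<^esub> (- int b) \<otimes>\<^bsub>G\<^esub> h [^]\<^bsub>G\<^esub> a)) x)) \<and>
        ((\<forall>h'\<in>carrier G. q_convergent (mt_series f h')) \<longrightarrow>
         (\<forall>\<tau>. Im \<tau> > 0 \<longrightarrow>
            q_eval (twisted_hecke n f h) \<tau> =
              1 / of_nat n * (\<Sum>(a, b, d)\<in>hecke_index n.
                q_eval (mt_series f (\<one>\<^bsub>G\<^esub> [^]\<^bsub>G\<^esub> (- int b) \<otimes>\<^bsub>G\<^esub> h [^]\<^bsub>G\<^esub> a))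
                  ((of_nat a * \<tau> + of_nat b) / of_nat d)))))"
proof (intro conjI allI impI; (elim conjE)?)
  interpret group G by fact
  {
    fix D :: "('e, 'b, 'g) classifying_data" and \<alpha> F g h \<tau>
    assume F: "elliptic_section G D \<alpha> F" and gh: "(g, h) \<in> commuting_pairs G" and \<tau>: "Im \<tau> > 0"
    interpret twisted G g h \<tau> by unfold_locales (fact gh, fact \<tau>)
    show "geometric_hecke G D n (-1) \<tau> F (twisted_bundle G g h \<tau>) =
          (\<lambda>c. 1 / of_nat n * (\<Sum>(a, b, d)\<in>hecke_index n.
             let P' = twisted_bundle G (g [^]\<^bsub>G\<^esub> d) (g [^]\<^bsub>G\<^esub> (- int b) \<otimes>\<^bsub>G\<^esub> h [^]\<^bsub>G\<^esub> a)
                        ((of_nat a * \<tau> + of_nat b) / of_nat d)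
             in pushforward G D P' (twisted_bundle G g h \<tau>) (twisted_mult G g h \<tau> (of_nat d)) (F P') c))"
      by (rule geometric_hecke_twisted[OF F assms(3)])
  }
  {
    fix f g h
    assume K: "devoto_tate_K G f" "power_domain G f" and gh: "(g, h) \<in> commuting_pairs G"
    note formula = devoto_hecke_formula[OF assms(1,2) K gh assms(3)]
    show "devoto_hecke G n f g h =
          (\<lambda>x. 1 / of_nat n * (\<Sum>(a, b, d)\<in>hecke_index n.
             q_subst a b d (tate_series G f (g [^]\<^bsub>G\<^esub> d) (g [^]\<^bsub>G\<^esub> (- int b) \<otimes>\<^bsub>G\<^esub> h [^]\<^bsub>G\<^esub> a)) x))"
      by (rule formula)
    fix \<tau>
    assume conv: "\<forall>(g', h')\<in>commuting_pairs G. q_convergent (tate_series G f g' h')" and \<tau>: "Im \<tau> > 0"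
    \<comment> \<open>The arguments on the right again form commuting pairs, so the convergence
      assumption covers every summand.\<close>
    have "q_convergent (tate_series G f (g [^]\<^bsub>G\<^esub> d) (g [^]\<^bsub>G\<^esub> (- int b) \<otimes>\<^bsub>G\<^esub> h [^]\<^bsub>G\<^esub> a))" for a b d :: nat
      using bspec[OF conv commuting_pairs_hecke[OF assms(1) gh]] by simp
    then show "q_eval (devoto_hecke G n f g h) \<tau> =
              1 / of_nat n * (\<Sum>(a, b, d)\<in>hecke_index n.
                q_eval (tate_series G f (g [^]\<^bsub>G\<^esub> d) (g [^]\<^bsub>G\<^esub> (- int b) \<otimes>\<^bsub>G\<^esub> h [^]\<^bsub>G\<^esub> a))
                  ((of_nat a * \<tau> + of_nat b) / of_nat d))"
      unfolding formula by (intro q_eval_hecke_sum assms(3) \<tau>)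
  }
  {
    fix f h
    assume r: "replicable G f" and h: "h \<in> carrier G"
    note formula = twisted_hecke_formula[OF assms(1) r h assms(3)]
    show "twisted_hecke n f h =
          (\<lambda>x. 1 / of_nat n * (\<Sum>(a, b, d)\<in>hecke_index n.
             q_subst a b d (mt_series f (\<one>\<^bsub>G\<^esub> [^]\<^bsub>G\<^esub> (- int b) \<otimes>\<^bsub>G\<^esub> h [^]\<^bsub>G\<^esub> a)) x))"
      by (rule formula)
    fix \<tau>
    assume conv: "\<forall>h'\<in>carrier G. q_convergent (mt_series f h')" and \<tau>: "Im \<tau> > 0"
    have "q_convergent (mt_series f (\<one>\<^bsub>G\<^esub> [^]\<^bsub>G\<^esub> (- int b) \<otimes>\<^bsub>G\<^esub> h [^]\<^bsub>G\<^esub> a))" for a b :: nat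
      using conv h by simp
    then show "q_eval (twisted_hecke n f h) \<tau> =
              1 / of_nat n * (\<Sum>(a, b, d)\<in>hecke_index n.
                q_eval (mt_series f (\<one>\<^bsub>G\<^esub> [^]\<^bsub>G\<^esub> (- int b) \<otimes>\<^bsub>G\<^esub> h [^]\<^bsub>G\<^esub> a))
                  ((of_nat a * \<tau> + of_nat b) / of_nat d))"
      unfolding formula by (intro q_eval_hecke_sum assms(3) \<tau>)
  }
qed

end
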